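(* Every planar graph $G$ with girth at least $12$ is proper conflict-free $\kappa_G$-choosable.
   Context: All graphs are finite, simple and undirected, with nonempty vertex set. The girth of $G$ is the length of a shortest cycle, and is $\infty$ if $G$ is acyclic. The function $\kappa_G:V(G)\to\mathbb{N}$ is defined by $\kappa_G(v)=4$ if $d_G(v)=2$ and $\kappa_G(v)=d_G(v)+1$ if $d_G(v)\neq 2$. A list assignment $L$ assigns to each vertex $v$ a set $L(v)$ of colors; an $L$-coloring is a map $\varphi$ on $V(G)$ with $\varphi(v)\in L(v)$ for every $v$ and $\varphi(u)\neq\varphi(v)$ for every edge $uv$. A (proper) $L$-coloring is proper conflict-free if for every non-isolated vertex $v$ there is a color that appears exactly once in the neighborhood $N_G(v)$ (i.e. on exactly one neighbor of $v$). $G$ is proper conflict-free $\kappa_G$-choosable if every list assignment $L$ with $|L(v)|\ge\kappa_G(v)$ for all $v\in V(G)$ admits a proper conflict-free $L$-coloring of $G$. *)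

theory Defs
  imports "HOL-Analysis.Analysis" "HOL-Library.Extended_Nat"
begin

locale simple_graph =
  fixes V :: "'a set" and E :: "'a set set"
  assumes finite_verts: "finite V"
    and nonempty_verts: "V \<noteq> {}"
    and edges: "e \<in> E \<Longrightarrow> e \<subseteq> V \<and> card e = 2"

definition nbhd :: "'a set set \<Rightarrow> 'a \<Rightarrow> 'a set" where
  "nbhd E v = {u. {v, u} \<in> E}"

definition vdegree :: "'a set set \<Rightarrow> 'a \<Rightarrow> nat" where
  "vdegree E v = card (nbhd E v)"

text \<open>
  A cycle is given by the list of its vertices in cyclic order, so its length (number of
  edges) is the length of the list. The infimum over no cycles at all is \<open>\<infinity>\<close> in \<^typ>\<open>enat\<close>.
\<close>

definition is_cycle :: "'a set set \<Rightarrow> 'a list \<Rightarrow> bool" where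
  "is_cycle E vs \<longleftrightarrow> 3 \<le> length vs \<and> distinct vs \<and>
     (\<forall>i < length vs. {vs ! i, vs ! (Suc i mod length vs)} \<in> E)"

definition girth :: "'a set set \<Rightarrow> enat" where
  "girth E = (INF vs \<in> {vs. is_cycle E vs}. enat (length vs))"

text \<open>
  A drawing in the plane, taken to be \<^typ>\<open>complex\<close>: vertices are distinct points \<open>pos v\<close>, an edge \<open>e\<close> is
  a Jordan arc \<open>\<gamma> e\<close> joining its two ends and passing through no other vertex, and two different
  edges meet at most in a common end.
\<close>

definition plane_drawing ::
    "'a set \<Rightarrow> 'a set set \<Rightarrow> ('a \<Rightarrow> complex) \<Rightarrow> ('a set \<Rightarrow> real \<Rightarrow> complex) \<Rightarrow> bool" where
  "plane_drawing V E pos \<gamma> \<longleftrightarrow>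
     inj_on pos V \<and>
     (\<forall>e\<in>E. arc (\<gamma> e) \<and> {pathstart (\<gamma> e), pathfinish (\<gamma> e)} = pos ` e \<and>
             path_image (\<gamma> e) \<inter> pos ` V = pos ` e) \<and>
     (\<forall>e\<in>E. \<forall>f\<in>E. e \<noteq> f \<longrightarrow> path_image (\<gamma> e) \<inter> path_image (\<gamma> f) \<subseteq> pos ` (e \<inter> f))"

definition planar :: "'a set \<Rightarrow> 'a set set \<Rightarrow> bool" where
  "planar V E \<longleftrightarrow> (\<exists>pos \<gamma>. plane_drawing V E pos \<gamma>)"

definition kappa :: "'a set set \<Rightarrow> 'a \<Rightarrow> nat" where
  "kappa E v = (if vdegree E v = 2 then 4 else vdegree E v + 1)"

definition list_coloring ::
    "'a set \<Rightarrow> 'a set set \<Rightarrow> ('a \<Rightarrow> 'c set) \<Rightarrow> ('a \<Rightarrow> 'c) \<Rightarrow> bool" where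
  "list_coloring V E L \<phi> \<longleftrightarrow>
     (\<forall>v\<in>V. \<phi> v \<in> L v) \<and> (\<forall>u v. {u, v} \<in> E \<longrightarrow> \<phi> u \<noteq> \<phi> v)"

definition conflict_free :: "'a set \<Rightarrow> 'a set set \<Rightarrow> ('a \<Rightarrow> 'c) \<Rightarrow> bool" where
  "conflict_free V E \<phi> \<longleftrightarrow>
     (\<forall>v\<in>V. nbhd E v \<noteq> {} \<longrightarrow> (\<exists>c. \<exists>!u. u \<in> nbhd E v \<and> \<phi> u = c))"

text \<open>
  The type argument is the type of colors, which a definition cannot quantify over. Lists may be
  infinite; since \<^const>\<open>card\<close> is then \<open>0\<close>, \<open>|L(v)| \<ge> f(v)\<close> needs the extra disjunct.
\<close>

definition pcf_choosable :: "'c itself \<Rightarrow> 'a set \<Rightarrow> 'a set set \<Rightarrow> ('a \<Rightarrow> nat) \<Rightarrow> bool" where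
  "pcf_choosable _ V E f \<longleftrightarrow>
     (\<forall>L :: 'a \<Rightarrow> 'c set. (\<forall>v\<in>V. infinite (L v) \<or> f v \<le> card (L v)) \<longrightarrow>
        (\<exists>\<phi>. list_coloring V E L \<phi> \<and> conflict_free V E \<phi>))"

end

theory Submission
  imports Defs
begin

text \<open>
  Counting faces of a drawing bounds the edges of a planar graph of girth at least 12 by
  \<open>5 |E| < 6 |V|\<close>, and this applies to all induced subgraphs. The face count only needs the Jordan curve
  theorem and Janiszewski's theorem: an arc joining two connected points of a drawing cuts the face
  containing it into exactly two pieces, any other arc cuts nothing.

  Consider a counterexample with fewest vertices and charge each vertex with five times the number
  of its neighbors that are not leaves, minus 12. Vertices of degree 2 draw one unit along each of
  their two edges from the first vertex of larger degree in that direction; a vertex of degree 3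
  that cannot afford this (a \<^emph>\<open>deficient\<close> one) draws one unit from its only neighbor of degree
  greater than 2. If some vertex ended up with negative charge, one could delete it together with its
  leaves, the adjacent threads and its deficient neighbors, color the rest by minimality, and extend:
  the deleted part is a tree, so the options of its branches can be chosen independently.
  This contradicts the edge bound.
\<close>

section \<open>Faces of compact sets in the plane\<close>

text \<open>The constants come from one computation: every face borders at least 12 edges and every
  edge at most two faces, so Euler's inequality gives \<open>5 |E| < 6 |V|\<close>. Summed over a
  vertex set, this says that the charges 5 deg - 12 have negative total. The obstacle in extending a
  coloring is that the branches at a root only offer sets of options, while one color must end up
  unique around the root. A choice exists unless twice the number of offered colors is at most the
  number of neighbors with a single option; the reductions at a deleted root compare these two
  numbers. Girth enters a second time: deleted sets have radius at most 4, so no cycle runs through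
  them and at most one outside vertex. Minimality applies because list sizes are monotone in the
  degree. A vertex with leaves and exactly two other neighbors needs its own argument: it is kept
  and only its leaves are deleted, so that it has degree 2 and its two neighbors get distinct
  colors.\<close>

lemma components_remove_arc:
  fixes X A :: "'a::topological_space set"
  assumes W: "W \<in> components (- X)" and AX: "A - X \<subseteq> W"
  shows "components (- (X \<union> A)) = (components (- X) - {W}) \<union> components (W - A)"
proof (intro subset_antisym subsetI)
  fix C assume C: "C \<in> components (- (X \<union> A))"
  then have CC: "connected C" "C \<noteq> {}" "C \<subseteq> - (X \<union> A)"
    using in_components_connected in_components_nonempty in_components_subset by blast+
  then obtain U where U: "U \<in> components (- X)" "C \<subseteq> U"
    using exists_component_superset[of C "- X"] by (metis Compl_Un Int_lower1 bot.extremum_uniqueI order.trans)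
  show "C \<in> (components (- X) - {W}) \<union> components (W - A)"
  proof (cases "U = W")
    case True
    have "C \<subseteq> W - A" using U True CC by auto
    moreover have "W - A \<subseteq> - (X \<union> A)" using in_components_subset[OF W] by auto
    ultimately show ?thesis using C components_intermediate_subset by blast
  next
    case False
    then have "U \<inter> W = {}" using components_nonoverlap[OF U(1) W] by auto
    then have "U \<subseteq> - (X \<union> A)" using AX in_components_subset[OF U(1)] by auto
    then have "C = U"
      using components_maximal[OF C] in_components_connected[OF U(1)] CC U(2)
      by (metis inf.absorb1 subset_antisym)
    then show ?thesis using U(1) False by auto
  qed
next
  fix C assume "C \<in> (components (- X) - {W}) \<union> components (W - A)"
  then consider "C \<in> components (- X)" "C \<noteq> W" | "C \<in> components (W - A)" by auto
  then show "C \<in> components (- (X \<union> A))"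
  proof cases
    case 1
    then have "C \<inter> W = {}" using components_nonoverlap[OF 1(1) W] by auto
    then have "C \<subseteq> - (X \<union> A)" using AX in_components_subset[OF 1(1)] by auto
    then show ?thesis using components_intermediate_subset[OF 1(1)] by blast
  next
    case 2
    have CC: "connected C" "C \<noteq> {}" "C \<subseteq> W - A"
      using 2 in_components_connected in_components_nonempty in_components_subset by blast+
    have sub: "C \<subseteq> - (X \<union> A)" using CC in_components_subset[OF W] by auto
    then obtain D where D: "D \<in> components (- (X \<union> A))" "C \<subseteq> D"
      using exists_component_superset[of C "- (X \<union> A)"] CC by blast
    have DD: "connected D" "D \<subseteq> - (X \<union> A)"
      using D in_components_connected in_components_subset by blast+
    have "D \<subseteq> W"
      using components_maximal[OF W DD(1)] DD(2) CC D(2) by blast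
    then have "D \<subseteq> W - A" using DD by auto
    then have "D \<subseteq> C" using components_maximal[OF 2 DD(1)] CC D(2) by blast
    then show ?thesis using D by auto
  qed
qed

lemma components_Un_separated:
  assumes "connected I" "connected Q" "I \<noteq> {}" "Q \<noteq> {}" "open I" "open Q" "I \<inter> Q = {}"
  shows "components (I \<union> Q) = {I, Q}"
proof -
  have *: "P \<in> components (P \<union> R)"
    if "connected P" "P \<noteq> {}" "open P" "open R" "P \<inter> R = {}" for P R :: "'a set"
  proof -
    have "T = P" if T: "P \<subseteq> T" "T \<subseteq> P \<union> R" "connected T" for T
    proof -
      have "R \<inter> T = {}"
        using connectedD[OF T(3) \<open>open P\<close> \<open>open R\<close>] \<open>P \<inter> R = {}\<close> T \<open>P \<noteq> {}\<close> by blast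
      then show ?thesis using T by blast
    qed
    then show ?thesis using that unfolding in_components_maximal by blast
  qed
  have I: "I \<in> components (I \<union> Q)" using * assms by blast
  have Q: "Q \<in> components (I \<union> Q)" using *[of Q I] assms by (simp add: Un_commute Int_commute)
  have "C = I \<or> C = Q" if "C \<in> components (I \<union> Q)" for C
    using that I Q components_nonoverlap in_components_nonempty in_components_subset
    by (metis Int_Un_distrib Un_empty inf.absorb_iff1)
  then show ?thesis using I Q by blast
qed

lemma connected_component_within_component:
  assumes "W \<in> components (- X)" "a \<in> W" "connected_component (- (X \<union> A)) a b"
  shows "connected_component (W - A) a b"
proof -
  obtain T where T: "connected T" "T \<subseteq> - (X \<union> A)" "a \<in> T" "b \<in> T"
    using assms(3) by (auto simp: connected_component_def)
  have "T \<subseteq> W" using components_maximal[OF assms(1) T(1)] T assms(2) by blast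
  then show ?thesis using T by (auto simp: connected_component_def)
qed

lemma connected_component_of_mem_component:
  assumes "W \<in> components S" "a \<in> W" "b \<in> W"
  shows "connected_component S a b"
  using assms in_components_connected in_components_subset by (metis connected_component_def)

text \<open>A ball minus a point is connected, but its image in the parameter interval would miss a
  parameter lying between two others. It follows that an arc cannot cover a whole face.\<close>

lemma interior_arc_image_empty:
  fixes g :: "real \<Rightarrow> complex"
  assumes "arc g"
  shows "interior (path_image g) = {}"
proof (rule ccontr)
  assume "interior (path_image g) \<noteq> {}"
  then obtain x r where r: "r > 0" "ball x r \<subseteq> path_image g"
    by (meson equals0I mem_interior)
  obtain h where h: "homeomorphism {0..1} (path_image g) g h"
    using assms homeomorphism_arc by blast
  have inj: "inj_on h (ball x r)"
  proof (rule inj_on_inverseI[where g = g])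
    fix y assume "y \<in> ball x r"
    then show "g (h y) = y" using h r(2) by (meson homeomorphism_apply2 subsetD)
  qed
  have "infinite (h ` ball x r)"
    using uncountable_ball[OF r(1), of x] finite_imageD[OF _ inj] uncountable_infinite by metis
  then obtain T where T: "finite T" "card T = 3" "T \<subseteq> h ` ball x r"
    by (meson infinite_arbitrarily_large)
  obtain t1 t2 t3 where t: "t1 < t2" "t2 < t3" "{t1,t2,t3} \<subseteq> T"
  proof -
    obtain xs where xs: "length xs = 3" "sorted_wrt (<) xs" "set xs = T"
      using T(1,2) by (metis length_sorted_list_of_set set_sorted_list_of_set strict_sorted_list_of_set)
    then obtain a b d where "xs = [a, b, d]"
      by (auto simp: numeral_3_eq_3 length_Suc_conv)
    then show ?thesis using that[of a b d] xs by auto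
  qed
  then obtain y where y: "y \<in> ball x r" "t2 = h y" using T by auto
  have "connected (ball x r - {y})"
    by (rule connected_open_delete) auto
  moreover have "continuous_on (ball x r - {y}) h"
    using h r by (meson Diff_subset continuous_on_subset homeomorphism_cont2 order.trans)
  ultimately have con: "connected (h ` (ball x r - {y}))"
    using connected_continuous_image by blast
  have "h ` (ball x r - {y}) = h ` ball x r - {t2}"
    using inj y by (simp add: inj_on_image_set_diff)
  then have "t1 \<in> h ` (ball x r - {y})" "t3 \<in> h ` (ball x r - {y})" "t2 \<notin> h ` (ball x r - {y})"
    using t T by auto
  then have "{t1..t3} \<subseteq> h ` (ball x r - {y})" using connected_contains_Icc[OF con] by blast
  moreover have "t2 \<in> {t1..t3}" using t by simp
  ultimately show False using \<open>t2 \<notin> _\<close> by blast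
qed

text \<open>Janiszewski's theorem, applied to the drawing and the closed curve through the new arc,
  shows that each side of the curve contributes just one new face.\<close>

lemma components_remove_arc_closing:
  fixes X :: "complex set"
  assumes "compact X" "arc g" "arc b" "path_image b \<subseteq> X"
    and ends: "pathstart b = pathstart g" "pathfinish b = pathfinish g"
    and gX: "path_image g \<inter> X = {pathstart g, pathfinish g}"
    and W: "W \<in> components (- X)" "path_image g - X \<subseteq> W"
  obtains I Q where "components (W - path_image g) = {I, Q}" "I \<noteq> Q"
proof -
  define c where "c = g +++ reversepath b"
  have pc: "path_image c = path_image g \<union> path_image b"
    using ends by (simp add: c_def path_image_join)
  have sc: "simple_path c" "pathfinish c = pathstart c"
  proof -
    have "path_image g \<inter> path_image b \<subseteq> {pathstart g, pathfinish g}"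
      using gX assms(4) by blast
    then show "simple_path c" unfolding c_def
      using assms by (intro simple_path_join_loop arc_reversepath) auto
    show "pathfinish c = pathstart c" using ends by (simp add: c_def)
  qed
  have pb: "{pathstart g, pathfinish g} \<subseteq> path_image b"
    using ends by (metis insert_subset empty_subsetI pathfinish_in_path_image pathstart_in_path_image)
  note J = Jordan_inside_outside[OF sc]
  have Wop: "open W" using W(1) assms(1) by (meson compact_imp_closed open_Compl open_components)
  have XW: "X \<inter> W = {}" using in_components_subset[OF W(1)] by auto
  \<comment> \<open>Closing \<open>g\<close> by an arc inside \<open>X\<close> makes this
    intersection an arc, hence connected, as Janiszewski's theorem demands.\<close>
  have XJ: "X \<inter> path_image c = path_image b"
    using gX pb assms(4) unfolding pc by blast
  have XJ': "X \<union> path_image c = X \<union> path_image g"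
    using assms(4) unfolding pc by auto
  obtain x where x: "x \<in> path_image g" "x \<notin> X"
  proof -
    have "path_image g - {pathstart g, pathfinish g} \<noteq> {}"
      using assms(2) arc_imp_simple_path nonempty_simple_path_endless by blast
    then show ?thesis using that gX by blast
  qed
  \<comment> \<open>An inner point \<open>x\<close> of the new arc is on the frontier of both sides
    of the curve and has the open set \<open>W\<close> as a neighborhood, so \<open>W\<close> meets
    both sides.\<close>
  have side: "connected (W \<inter> R) \<and> W \<inter> R \<noteq> {}"
    if R: "R \<in> components (- path_image c)" "frontier R = path_image c" for R
  proof
    have "x \<in> closure R" using R(2) x pc by (auto simp: frontier_def)
    moreover have "x \<in> W" using x W(2) by auto
    ultimately show "W \<inter> R \<noteq> {}" using Wop
      by (metis IntI Int_commute closure_iff_nhds_not_empty inf.idem subset_refl)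
    show "connected (W \<inter> R)"
      unfolding connected_iff_connected_component
    proof (intro ballI)
      fix a d assume ad: "a \<in> W \<inter> R" "d \<in> W \<inter> R"
      have "connected_component (- (X \<union> path_image c)) a d"
      proof (rule Janiszewski)
        show "compact X" by fact
        show "closed (path_image c)"
          using sc(1) closed_simple_path_image by blast
        show "connected (X \<inter> path_image c)"
          unfolding XJ using assms(3) connected_arc_image by blast
        show "connected_component (- X) a d" "connected_component (- path_image c) a d"
          using ad W R(1) connected_component_of_mem_component by blast+
      qed
      then obtain T where T: "connected T" "T \<subseteq> - (X \<union> path_image c)" "a \<in> T" "d \<in> T"
        by (auto simp: connected_component_def)
      have "T \<subseteq> W" using components_maximal[OF W(1) T(1)] T ad by blast
      moreover have "T \<subseteq> R" using components_maximal[OF R(1) T(1)] T ad by blast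
      ultimately show "connected_component (W \<inter> R) a d"
        using T by (auto simp: connected_component_def)
    qed
  qed
  have cc: "components (- path_image c) = {inside (path_image c), outside (path_image c)}"
    using components_Un_separated[of "inside (path_image c)" "outside (path_image c)"] J by auto
  define I Q where "I = W \<inter> inside (path_image c)" and "Q = W \<inter> outside (path_image c)"
  have "connected I" "I \<noteq> {}" "connected Q" "Q \<noteq> {}"
    unfolding I_def Q_def using side cc J by auto
  moreover have "I \<inter> Q = {}" "open I" "open Q"
    unfolding I_def Q_def using J Wop by (blast, simp_all add: open_Int)
  ultimately have "components (I \<union> Q) = {I, Q}" "I \<noteq> Q"
    using components_Un_separated by blast+
  moreover have "I \<union> Q = W - path_image g"
  proof -
    have "I \<union> Q = W \<inter> (inside (path_image c) \<union> outside (path_image c))"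
      unfolding I_def Q_def by blast
    also have "\<dots> = W \<inter> - path_image c" using J by argo
    also have "\<dots> = W - path_image g" using XW assms(4) unfolding pc by blast
    finally show ?thesis .
  qed
  ultimately show ?thesis using that by auto
qed

text \<open>Janiszewski's theorem is applied twice, first adding the arc to \<open>X1\<close>, then
  adding \<open>X2\<close>; each intersection is at most a single point. The arc alone does not
  separate the plane.\<close>

lemma components_remove_arc_bridge:
  fixes X1 X2 :: "complex set"
  assumes X: "compact X1" "compact X2" "X1 \<inter> X2 = {}" and "arc g"
    and g1: "path_image g \<inter> X1 \<subseteq> {pathstart g}" and g2: "path_image g \<inter> X2 \<subseteq> {pathfinish g}"
    and W: "W \<in> components (- (X1 \<union> X2))" "path_image g - (X1 \<union> X2) \<subseteq> W"
  shows "components (W - path_image g) = {W - path_image g}"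
  unfolding components_eq_sing_iff
proof
  have Wop: "open W" using W(1) X by (meson compact_Un compact_imp_closed open_Compl open_components)
  show "W - path_image g \<noteq> {}"
    using interior_arc_image_empty[OF \<open>arc g\<close>] Wop in_components_nonempty[OF W(1)]
    by (metis Diff_eq_empty_iff interior_maximal subset_empty)
  show "connected (W - path_image g)"
    unfolding connected_iff_connected_component
  proof (intro ballI)
    fix a d assume ad: "a \<in> W - path_image g" "d \<in> W - path_image g"
    have X12: "connected_component (- (X1 \<union> X2)) a d"
      using ad W connected_component_of_mem_component by blast
    have cg: "connected_component (- path_image g) a d"
      using connected_arc_complement[OF \<open>arc g\<close>] ad
      by (simp add: connected_iff_connected_component)
    have single: "connected T" if "T \<subseteq> {x}" for T :: "complex set" and x
      using that by (metis connected_empty connected_sing subset_singletonD)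
    have "connected_component (- (X1 \<union> path_image g)) a d"
    proof (rule Janiszewski)
      show "closed (path_image g)" using \<open>arc g\<close> closed_arc_image by blast
      show "connected (X1 \<inter> path_image g)" using g1 single by (metis Int_commute)
      show "connected_component (- X1) a d"
        using X12 connected_component_of_subset by (metis Compl_anti_mono Un_upper1)
    qed (use X cg in auto)
    then have "connected_component (- ((X1 \<union> path_image g) \<union> X2)) a d"
    proof (rule Janiszewski[rotated 3])
      show "compact (X1 \<union> path_image g)" using X \<open>arc g\<close> compact_arc_image by blast
      show "closed X2" using X compact_imp_closed by blast
      show "connected ((X1 \<union> path_image g) \<inter> X2)"
        using g2 X(3) single by (metis Int_Un_distrib2 Un_empty_left)
      show "connected_component (- X2) a d"
        using X12 connected_component_of_subset by (metis Compl_anti_mono Un_upper2)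
    qed
    then have "connected_component (- ((X1 \<union> X2) \<union> path_image g)) a d"
      by (simp add: Un_ac)
    then show "connected_component (W - path_image g) a d"
      using connected_component_within_component W(1) ad by blast
  qed
qed

section \<open>Paths and reachability\<close>

text \<open>Loops are cut off as soon as they close. The length bound is kept because it is later
  compared with the girth.\<close>

lemma relpow_distinct_path:
  "(x, y) \<in> R ^^ n \<Longrightarrow> \<exists>p. p \<noteq> [] \<and> length p \<le> Suc n \<and> hd p = x \<and> last p = y \<and> distinct p \<and>
     (\<forall>i. Suc i < length p \<longrightarrow> (p ! i, p ! Suc i) \<in> R)"
proof (induction n arbitrary: y)
  case 0
  then show ?case by (intro exI[of _ "[x]"]) auto
next
  case (Suc n)
  then obtain z where "(x, z) \<in> R ^^ n" and zy: "(z, y) \<in> R" by auto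
  with Suc.IH obtain p where p: "p \<noteq> []" "length p \<le> Suc n" "hd p = x" "last p = z" "distinct p"
    "\<forall>i. Suc i < length p \<longrightarrow> (p ! i, p ! Suc i) \<in> R" by blast
  show ?case
  proof (cases "y \<in> set p")
    case True
    then obtain k where k: "k < length p" "p ! k = y" by (auto simp: in_set_conv_nth)
    let ?q = "take (Suc k) p"
    have "last ?q = y" using k by (simp add: take_Suc_conv_app_nth)
    moreover have "hd ?q = x" using p by (simp add: hd_take)
    ultimately show ?thesis using p k by (intro exI[of _ ?q]) auto
  next
    case False
    have "(z, y) = (p ! (length p - 1), y)" using p by (simp add: last_conv_nth)
    then have "(p ! (length p - 1), y) \<in> R" using zy by simp
    moreover have "i = length p - 1" if "\<not> Suc i < length p" "Suc i < length (p @ [y])" for i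
      using that by simp
    ultimately have "\<forall>i. Suc i < length (p @ [y]) \<longrightarrow> ((p @ [y]) ! i, (p @ [y]) ! Suc i) \<in> R"
      using p(6) by (metis Suc_lessD length_append_singleton less_Suc_eq nth_append nth_append_length)
    moreover have "distinct (p @ [y])" "hd (p @ [y]) = x" "length (p @ [y]) \<le> Suc (Suc n)"
      using p(1,2,3,5) False by simp_all
    ultimately show ?thesis by (intro exI[of _ "p @ [y]"] conjI) simp_all
  qed
qed

definition edge_rel :: "'a set set \<Rightarrow> 'a rel" where
  "edge_rel F = {(u, v). {u, v} \<in> F}"

lemma sym_edge_rel: "sym (edge_rel F)"
  by (auto simp: edge_rel_def sym_def insert_commute)

lemma cycle_of_reachable_ends:
  assumes "(u, v) \<in> (edge_rel F)\<^sup>*" "u \<noteq> v" "{u, v} \<notin> F"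
  obtains vs where "is_cycle (insert {u, v} F) vs"
proof -
  obtain n where "(u, v) \<in> edge_rel F ^^ n" using assms(1) rtrancl_imp_relpow by blast
  then obtain p where p: "p \<noteq> []" "hd p = u" "last p = v" "distinct p"
     "\<forall>i. Suc i < length p \<longrightarrow> (p ! i, p ! Suc i) \<in> edge_rel F"
    using relpow_distinct_path by metis
  have "length p \<noteq> 1" using p assms by (auto simp: length_Suc_conv)
  moreover have "length p \<noteq> 2"
  proof
    assume "length p = 2"
    then obtain a b where "p = [a, b]" by (auto simp: numeral_2_eq_2 length_Suc_conv)
    then show False using p assms by (auto simp: edge_rel_def)
  qed
  moreover have "length p \<noteq> 0" using p by simp
  ultimately have len: "3 \<le> length p" by linarith
  have "{p ! i, p ! (Suc i mod length p)} \<in> insert {u, v} F" if "i < length p" for i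
  proof (cases "Suc i < length p")
    case True
    then show ?thesis using p by (auto simp: edge_rel_def)
  next
    case False
    then have "Suc i = length p" using that by simp
    then have "p ! i = v" "p ! (Suc i mod length p) = u" using p
      by (metis diff_Suc_1 last_conv_nth) (metis \<open>Suc i = length p\<close> hd_conv_nth mod_self p(1,2))
    then show ?thesis by (simp add: insert_commute)
  qed
  then have "is_cycle (insert {u, v} F) p" using len p by (simp add: is_cycle_def)
  then show ?thesis using that by blast
qed

lemma card_cycle_edges:
  assumes "is_cycle F vs" "finite F"
  shows "length vs \<le> card F"
proof -
  let ?n = "length vs"
  let ?f = "\<lambda>i. {vs ! i, vs ! (Suc i mod ?n)}"
  have n: "3 \<le> ?n" "distinct vs" and f: "\<forall>i<?n. ?f i \<in> F"
    using assms(1) unfolding is_cycle_def by blast+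
  have "inj_on ?f {..<?n}"
  proof (rule inj_onI)
    fix i j assume ij: "i \<in> {..<?n}" "j \<in> {..<?n}" and eq: "?f i = ?f j"
    show "i = j"
    proof (rule ccontr)
      assume "i \<noteq> j"
      then have "vs ! i \<noteq> vs ! j" using ij n(2) by (simp add: nth_eq_iff_index_eq)
      then have "vs ! i = vs ! (Suc j mod ?n)" "vs ! j = vs ! (Suc i mod ?n)"
        using eq by (metis doubleton_eq_iff)+
      moreover have "Suc j mod ?n < ?n" "Suc i mod ?n < ?n"
        using n(1) by (intro mod_less_divisor; linarith)+
      ultimately have "i = Suc j mod ?n" "j = Suc i mod ?n"
        using ij n(2) by (simp_all add: nth_eq_iff_index_eq)
      moreover have "i mod ?n = i" "j mod ?n = j" using ij by simp_all
      \<comment> \<open>\<open>i\<close> and \<open>j\<close> would be each other's successor modulo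
        the length, which would then divide 2.\<close>
      ultimately show False using n(1) by (simp add: mod_Suc split: if_splits)
    qed
  qed
  moreover have "?f ` {..<?n} \<subseteq> F" using f by blast
  ultimately show ?thesis using card_inj_on_le[of ?f "{..<?n}" F] assms(2) by simp
qed

text \<open>Classes missing both ends persist, the classes of the two ends become one. Indexing by
  all of \<open>V\<close> counts isolated vertices as components.\<close>

lemma card_classes_merge:
  assumes "finite V" "u \<in> V" "v \<in> V" "(u, v) \<notin> (edge_rel F)\<^sup>*"
  shows "card ((\<lambda>x. (edge_rel (insert {u, v} F))\<^sup>* `` {x}) ` V) < card ((\<lambda>x. (edge_rel F)\<^sup>* `` {x}) ` V)"
proof -
  let ?R = "(edge_rel F)\<^sup>*" and ?R' = "(edge_rel (insert {u, v} F))\<^sup>*"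
  have sR: "sym ?R" "sym ?R'" by (simp_all add: sym_edge_rel sym_rtrancl)
  have mono: "?R \<subseteq> ?R'" by (rule rtrancl_mono) (auto simp: edge_rel_def)
  have uv: "(u, v) \<in> ?R'" by (rule r_into_rtrancl) (simp add: edge_rel_def)
  have in_class: "?R' `` {x} = ?R' `` {u}" if "(u, x) \<in> ?R \<or> (v, x) \<in> ?R" for x
  proof -
    have ux: "(u, x) \<in> ?R'" using that mono uv by (meson rtrancl_trans subsetD)
    then have "(x, u) \<in> ?R'" using sR(2) by (meson symD)
    with ux show ?thesis by (auto intro: rtrancl_trans)
  qed
  have other: "?R' `` {x} = ?R `` {x}" if x: "(u, x) \<notin> ?R" "(v, x) \<notin> ?R" for x
  proof -
    have "(x, y) \<in> ?R" if "(x, y) \<in> ?R'" for y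
      using that
    proof (induction rule: rtrancl_induct)
      case base
      then show ?case by simp
    next
      case (step y z)
      have "{y, z} \<noteq> {u, v}"
      proof
        assume "{y, z} = {u, v}"
        then have "y = u \<or> y = v" by (auto simp: doubleton_eq_iff)
        then show False using step.IH x sR(1) by (meson symD)
      qed
      then have "(y, z) \<in> edge_rel F" using step.hyps by (auto simp: edge_rel_def)
      then show ?case using step.IH by (meson rtrancl.rtrancl_into_rtrancl)
    qed
    then show ?thesis using mono by auto
  qed
  let ?C = "(\<lambda>x. ?R `` {x}) ` V"
  have ne: "?R `` {u} \<noteq> ?R `` {v}" using assms(4) by auto
  have "(\<lambda>x. ?R' `` {x}) ` V \<subseteq> insert (?R' `` {u}) (?C - {?R `` {u}, ?R `` {v}})"
  proof
    fix K assume "K \<in> (\<lambda>x. ?R' `` {x}) ` V"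
    then obtain x where x: "x \<in> V" "K = ?R' `` {x}" by auto
    show "K \<in> insert (?R' `` {u}) (?C - {?R `` {u}, ?R `` {v}})"
    proof (cases "(u, x) \<in> ?R \<or> (v, x) \<in> ?R")
      case True
      then show ?thesis using in_class x by blast
    next
      case False
      then have "?R `` {x} \<noteq> ?R `` {u}" "?R `` {x} \<noteq> ?R `` {v}" by auto
      then show ?thesis using other False x by auto
    qed
  qed
  then have "card ((\<lambda>x. ?R' `` {x}) ` V) \<le> card (insert (?R' `` {u}) (?C - {?R `` {u}, ?R `` {v}}))"
    using assms(1) by (intro card_mono) auto
  also have "\<dots> \<le> Suc (card (?C - {?R `` {u}, ?R `` {v}}))" by (rule card_insert_le_m1) auto
  also have "card (?C - {?R `` {u}, ?R `` {v}}) = card ?C - 2"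
    using assms ne by (subst card_Diff_subset) auto
  finally have "card ((\<lambda>x. ?R' `` {x}) ` V) \<le> Suc (card ?C - 2)" .
  moreover have "card {?R `` {u}, ?R `` {v}} \<le> card ?C" using assms by (intro card_mono) auto
  ultimately show ?thesis using ne by simp
qed

section \<open>Edges of plane graphs\<close>

text \<open>Only the parameters 0 and 1 can be sent into \<open>X\<close>, so the remaining ones
  form an interval, whichever of the ends are removed.\<close>

lemma connected_arc_diff_ends:
  fixes g :: "real \<Rightarrow> complex"
  assumes "arc g" "path_image g \<inter> X \<subseteq> {pathstart g, pathfinish g}"
  shows "connected (path_image g - X)"
proof -
  let ?T = "{t \<in> {0..1}. g t \<notin> X}"
  have ends: "t = 0 \<or> t = 1" if "t \<in> {0..1}" "g t \<in> X" for t
  proof -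
    have "g t = g 0 \<or> g t = g 1"
      using assms(2) that unfolding path_image_def pathstart_def pathfinish_def by blast
    moreover have "inj_on g {0..1}" using assms(1) by (simp add: arc_def)
    ultimately show ?thesis using that(1) by (auto dest: inj_onD)
  qed
  have "is_interval ?T"
    unfolding is_interval_1
  proof (intro ballI allI impI)
    fix a b x assume ab: "a \<in> ?T" "b \<in> ?T" "a \<le> x \<and> x \<le> b"
    show "x \<in> ?T"
    proof (rule ccontr)
      assume "x \<notin> ?T"
      then have "x = 0 \<or> x = 1" using ab ends[of x] by auto
      then have "x = a \<or> x = b" using ab by auto
      then show False using ab \<open>x \<notin> ?T\<close> by blast
    qed
  qed
  then have "connected ?T" by (simp add: is_interval_connected)
  moreover have "continuous_on ?T g"
    using assms(1) by (auto simp: arc_def path_def intro: continuous_on_subset)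
  ultimately have "connected (g ` ?T)" by (rule connected_continuous_image[rotated])
  moreover have "g ` ?T = path_image g - X" by (auto simp: path_image_def)
  ultimately show ?thesis by simp
qed

locale plane_graph = simple_graph V E
  for V :: "'a set" and E :: "'a set set" and pos :: "'a \<Rightarrow> complex" and \<gamma> :: "'a set \<Rightarrow> real \<Rightarrow> complex" +
  assumes drawing: "plane_drawing V E pos \<gamma>"
begin

abbreviation img :: "'a set \<Rightarrow> complex set" where "img e \<equiv> path_image (\<gamma> e)"

text \<open>Isolated vertices contribute no points, so with no edges at all the single face is the
  whole plane.\<close>

definition drawn :: "'a set set \<Rightarrow> complex set" where "drawn F = (\<Union>e\<in>F. img e)"

definition open_arc :: "'a set \<Rightarrow> complex set" where "open_arc e = img e - pos ` V"

abbreviation faces :: "'a set set \<Rightarrow> complex set set" where "faces F \<equiv> components (- drawn F)"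

lemma finite_edges: "finite E"
  using edges finite_verts by (meson PowI finite_Pow_iff finite_subset subsetI)

lemma inj_pos: "inj_on pos V"
  using drawing by (simp add: plane_drawing_def)

lemma edge_arc:
  assumes "e \<in> E"
  shows "arc (\<gamma> e)" "img e \<inter> pos ` V = pos ` e"
  using assms drawing by (auto simp: plane_drawing_def)

lemma edge_cases:
  assumes "e \<in> E"
  obtains u v where "e = {u, v}" "u \<noteq> v" "u \<in> V" "v \<in> V"
    "pathstart (\<gamma> e) = pos u" "pathfinish (\<gamma> e) = pos v"
proof -
  obtain a b where ab: "e = {a, b}" "a \<noteq> b" using edges[OF assms] by (meson card_2_iff)
  have "{pathstart (\<gamma> e), pathfinish (\<gamma> e)} = {pos a, pos b}"
    using assms drawing ab by (auto simp: plane_drawing_def)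
  then consider "pathstart (\<gamma> e) = pos a" "pathfinish (\<gamma> e) = pos b"
    | "pathstart (\<gamma> e) = pos b" "pathfinish (\<gamma> e) = pos a" by (auto simp: doubleton_eq_iff)
  then show ?thesis
  proof cases
    case 1
    then show ?thesis using that[of a b] ab edges[OF assms] by auto
  next
    case 2
    then show ?thesis using that[of b a] ab edges[OF assms] by (auto simp: insert_commute)
  qed
qed

lemma img_Int:
  assumes "e \<in> E" "f \<in> E" "e \<noteq> f"
  shows "img e \<inter> img f \<subseteq> pos ` (e \<inter> f)"
  using assms drawing by (auto simp: plane_drawing_def)

lemma open_arc_nonempty:
  assumes "e \<in> E"
  shows "open_arc e \<noteq> {}"
proof -
  obtain u v where "pathstart (\<gamma> e) = pos u" "pathfinish (\<gamma> e) = pos v" "e = {u, v}"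
    using edge_cases[OF assms] by metis
  then have "open_arc e = img e - {pathstart (\<gamma> e), pathfinish (\<gamma> e)}"
    using edge_arc[OF assms] by (auto simp: open_arc_def)
  then show ?thesis
    using edge_arc[OF assms] arc_imp_simple_path nonempty_simple_path_endless by metis
qed

lemma open_arc_Int_drawn:
  assumes "e \<in> E" "F \<subseteq> E" "e \<notin> F"
  shows "open_arc e \<inter> drawn F = {}"
proof -
  have "open_arc e \<inter> img f = {}" if "f \<in> F" for f
  proof -
    have "img e \<inter> img f \<subseteq> pos ` (e \<inter> f)" using img_Int assms that by blast
    also have "\<dots> \<subseteq> pos ` V" using edges[OF assms(1)] by blast
    finally show ?thesis unfolding open_arc_def by blast
  qed
  then show ?thesis by (auto simp: drawn_def)
qed

lemma compact_drawn: "F \<subseteq> E \<Longrightarrow> compact (drawn F)"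
  unfolding drawn_def using finite_edges edge_arc
  by (intro compact_UN) (auto intro: finite_subset compact_arc_image)

lemma drawn_insert: "drawn (insert e F) = drawn F \<union> img e"
  by (auto simp: drawn_def)

lemma img_Int_drawn:
  assumes "e \<in> E" "F \<subseteq> E" "e \<notin> F"
  shows "img e \<inter> drawn F \<subseteq> pos ` e"
  using img_Int assms unfolding drawn_def by fast

lemma path_component_of_reachable:
  assumes "(u, v) \<in> (edge_rel F)\<^sup>*" "F \<subseteq> E"
  shows "u = v \<or> path_component (drawn F) (pos u) (pos v)"
  using assms(1)
proof (induction rule: rtrancl_induct)
  case (step y z)
  have e: "{y, z} \<in> F" using step by (simp add: edge_rel_def)
  have "path_component (img {y, z}) (pos y) (pos z)"
  proof -
    have "path_connected (img {y, z})"
      using edge_arc(1) e assms(2) by (meson arc_imp_path path_connected_path_image subsetD)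
    moreover have "pos y \<in> img {y, z}" "pos z \<in> img {y, z}"
      using edge_arc(2) e assms(2) by blast+
    ultimately show ?thesis by (simp add: path_connected_component)
  qed
  then have "path_component (drawn F) (pos y) (pos z)"
    using e path_component_of_subset by (metis UN_upper drawn_def)
  then show ?case using step.IH path_component_trans by blast
qed simp

lemma face_containing_open_arc:
  assumes e: "e \<in> E" "F \<subseteq> E" "e \<notin> F"
  obtains W where "W \<in> faces F" "img e - drawn F \<subseteq> W"
    "faces (insert e F) = (faces F - {W}) \<union> components (W - img e)"
proof -
  obtain u v where uv: "e = {u, v}" "pathstart (\<gamma> e) = pos u" "pathfinish (\<gamma> e) = pos v"
    using edge_cases[OF e(1)] by metis
  have "connected (img e - drawn F)"
    using connected_arc_diff_ends[of "\<gamma> e" "drawn F"] edge_arc[OF e(1)] img_Int_drawn[OF e] uv by auto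
  moreover have "img e - drawn F \<noteq> {}"
    using open_arc_nonempty[OF e(1)] open_arc_Int_drawn[OF e] by (auto simp: open_arc_def)
  ultimately obtain W where W: "W \<in> faces F" "img e - drawn F \<subseteq> W"
    using exists_component_superset[of "img e - drawn F" "- drawn F"] by blast
  then show ?thesis using components_remove_arc[OF W] that by (simp add: drawn_insert)
qed

lemma components_face_diff:
  assumes e: "e \<in> E" "F \<subseteq> E" "e \<notin> F" "e = {u, v}"
    and W: "W \<in> faces F" "img e - drawn F \<subseteq> W"
  shows "card (components (W - img e)) = (if (u, v) \<in> (edge_rel F)\<^sup>* then 2 else 1)"
    and "finite (components (W - img e))"
proof -
  \<comment> \<open>The ends are renamed in the direction of the parametrization of the arc;
    reachability is symmetric, so the case distinction does not change.\<close>
  obtain u' v' where uv': "e = {u', v'}" "u' \<noteq> v'" "u' \<in> V" "v' \<in> V"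
      and se: "pathstart (\<gamma> e) = pos u'" "pathfinish (\<gamma> e) = pos v'"
    using edge_cases[OF e(1)] by metis
  have "(u, v) = (u', v') \<or> (u, v) = (v', u')" using uv' e(4) by (auto simp: doubleton_eq_iff)
  then have sw: "(u, v) \<in> (edge_rel F)\<^sup>* \<longleftrightarrow> (u', v') \<in> (edge_rel F)\<^sup>*"
    using sym_rtrancl[OF sym_edge_rel] by (metis Pair_inject symD)
  have "card (components (W - img e)) = (if (u', v') \<in> (edge_rel F)\<^sup>* then 2 else 1)
      \<and> finite (components (W - img e))"
  proof (cases "(u', v') \<in> (edge_rel F)\<^sup>*")
    case True
    then have pc: "path_component (drawn F) (pos u') (pos v')"
      using path_component_of_reachable e uv' by blast
    then obtain p where p: "path p" "path_image p \<subseteq> drawn F" "pathstart p = pos u'" "pathfinish p = pos v'"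
      by (auto simp: path_component_def)
    have "pos u' \<noteq> pos v'" using inj_pos uv' by (meson inj_onD)
    \<comment> \<open>Reachability only gives a path in the drawing; closing the curve needs an
      arc.\<close>
    then obtain b where b: "arc b" "path_image b \<subseteq> path_image p" "pathstart b = pos u'" "pathfinish b = pos v'"
      using path_contains_arc[OF p(1,3,4)] by blast
    have "{pos u', pos v'} \<subseteq> img e \<inter> drawn F"
      using se b p by (metis Int_iff empty_subsetI insert_subset pathfinish_in_path_image pathstart_in_path_image subsetD)
    then have "img e \<inter> drawn F = {pathstart (\<gamma> e), pathfinish (\<gamma> e)}"
      using img_Int_drawn[OF e(1-3)] uv' se by auto
    moreover have "path_image b \<subseteq> drawn F" using b p by blast
    ultimately obtain I Q where "components (W - img e) = {I, Q}" "I \<noteq> Q"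
      using components_remove_arc_closing[OF compact_drawn[OF e(2)] edge_arc(1)[OF e(1)] b(1) _ _ _ _ W]
        b se by metis
    then show ?thesis using True by simp
  next
    case False
    \<comment> \<open>\<open>R\<close> is the component of one end. Edges touching it lie inside it,
      so the drawing splits into two disjoint compact parts, each met by the new arc in at most one
      end.\<close>
    define R where "R = (edge_rel F)\<^sup>* `` {u'}"
    define F1 where "F1 = {f \<in> F. f \<inter> R \<noteq> {}}"
    have F1: "f \<subseteq> R" if f: "f \<in> F1" for f
    proof
      fix x assume x: "x \<in> f"
      obtain y where y: "y \<in> f" "(u', y) \<in> (edge_rel F)\<^sup>*" using f by (auto simp: F1_def R_def)
      have "f \<in> F" using f by (simp add: F1_def)
      then obtain a b where ab: "f = {a, b}" using edges e(2) by (meson card_2_iff subsetD)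
      then have "x = y \<or> (y, x) \<in> edge_rel F"
        using x y \<open>f \<in> F\<close> by (auto simp: edge_rel_def insert_commute)
      then show "x \<in> R" using y by (auto simp: R_def intro: rtrancl_into_rtrancl)
    qed
    have sub: "F1 \<subseteq> E" "F - F1 \<subseteq> E" "F = F1 \<union> (F - F1)" using e by (auto simp: F1_def)
    have dF: "drawn F = drawn F1 \<union> drawn (F - F1)" using sub by (auto simp: drawn_def F1_def)
    have disj: "drawn F1 \<inter> drawn (F - F1) = {}"
    proof -
      have "img f \<inter> img f' = {}" if f: "f \<in> F1" "f' \<in> F - F1" for f f'
      proof -
        have "f \<inter> f' = {}" using F1[OF f(1)] f by (auto simp: F1_def)
        then show ?thesis using img_Int[of f f'] f sub by auto
      qed
      then show ?thesis by (fastforce simp: drawn_def)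
    qed
    have u'R: "u' \<in> R" "v' \<notin> R" using False by (auto simp: R_def)
    have "img e \<inter> drawn F1 \<subseteq> {pathstart (\<gamma> e)}"
    proof -
      have "img e \<inter> img f \<subseteq> {pos u'}" if "f \<in> F1" for f
      proof -
        have "f \<in> E" "f \<noteq> e" using that e sub by auto
        moreover have "e \<inter> f \<subseteq> {u'}" using F1[OF that] uv'(1) u'R by blast
        ultimately show ?thesis using img_Int[OF e(1), of f] by blast
      qed
      then show ?thesis unfolding drawn_def se by blast
    qed
    moreover have "img e \<inter> drawn (F - F1) \<subseteq> {pathfinish (\<gamma> e)}"
    proof -
      have "img e \<inter> img f \<subseteq> {pos v'}" if "f \<in> F - F1" for f
      proof -
        have "u' \<notin> f" using that u'R by (auto simp: F1_def)
        then have "e \<inter> f \<subseteq> {v'}" using uv'(1) by blast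
        moreover have "f \<in> E" "f \<noteq> e" using that e sub by auto
        ultimately show ?thesis using img_Int[OF e(1), of f] by blast
      qed
      then show ?thesis unfolding drawn_def se by blast
    qed
    ultimately have "components (W - img e) = {W - img e}"
      using components_remove_arc_bridge[OF compact_drawn[OF sub(1)] compact_drawn[OF sub(2)] disj
          edge_arc(1)[OF e(1)]] W dF by auto
    then show ?thesis using False by simp
  qed
  then show "card (components (W - img e)) = (if (u, v) \<in> (edge_rel F)\<^sup>* then 2 else 1)"
    and "finite (components (W - img e))" using sw by auto
qed

lemma faces_insert:
  assumes e: "e \<in> E" "F \<subseteq> E" "e \<notin> F" "e = {u, v}" and fin: "finite (faces F)"
  shows "finite (faces (insert e F))"
    and "card (faces (insert e F)) = card (faces F) + (if (u, v) \<in> (edge_rel F)\<^sup>* then 1 else 0)"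
proof -
  obtain W where W: "W \<in> faces F" "img e - drawn F \<subseteq> W"
    and eq: "faces (insert e F) = (faces F - {W}) \<union> components (W - img e)"
    using face_containing_open_arc[OF e(1-3)] by blast
  note comp = components_face_diff[OF e W]
  show "finite (faces (insert e F))" using eq fin comp by simp
  have "(faces F - {W}) \<inter> components (W - img e) = {}"
  proof -
    have False if C: "C \<in> faces F" "C \<noteq> W" "C \<in> components (W - img e)" for C
    proof -
      have "C \<subseteq> W" "C \<noteq> {}" using C in_components_subset in_components_nonempty by blast+
      then show False using components_nonoverlap[OF C(1) W(1)] C(2) by auto
    qed
    then show ?thesis by blast
  qed
  then have "card (faces (insert e F)) = card (faces F - {W}) + card (components (W - img e))"
    unfolding eq using fin comp by (intro card_Un_disjoint) auto
  moreover have "card (faces F) > 0" using W fin by (auto simp: card_gt_0_iff)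
  ultimately show "card (faces (insert e F)) = card (faces F) + (if (u, v) \<in> (edge_rel F)\<^sup>* then 1 else 0)"
    using comp(1) W fin by (simp add: card_Diff_singleton)
qed


text \<open>Half of Euler's formula: edges plus components plus one is at most faces plus vertices.
  A new edge either adds exactly one face or removes at least one component.\<close>

lemma face_count:
  assumes "F \<subseteq> E"
  shows "finite (faces F)"
    and "card F + card ((\<lambda>x. (edge_rel F)\<^sup>* `` {x}) ` V) < card (faces F) + card V"
proof -
  have "finite F" using finite_subset[OF assms(1) finite_edges] .
  then have "F \<subseteq> E \<longrightarrow> finite (faces F) \<and>
    card F + card ((\<lambda>x. (edge_rel F)\<^sup>* `` {x}) ` V) < card (faces F) + card V" (is "_ \<longrightarrow> ?P F")
  proof (induction F rule: finite_induct)
    case empty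
    have "faces {} = {UNIV :: complex set}"
      by (simp add: drawn_def components_eq_sing_iff connected_UNIV)
    moreover have "card ((\<lambda>x. (edge_rel {})\<^sup>* `` {x}) ` V) \<le> card V"
      using finite_verts card_image_le by blast
    ultimately show ?case by simp
  next
    case (insert e F)
    show ?case
    proof
      assume F: "insert e F \<subseteq> E"
      then have IH: "finite (faces F)"
        "card F + card ((\<lambda>x. (edge_rel F)\<^sup>* `` {x}) ` V) < card (faces F) + card V"
        using insert by auto
      obtain u v where uv: "e = {u, v}" "u \<in> V" "v \<in> V" using edge_cases F by (metis insert_subset)
      have e: "e \<in> E" "F \<subseteq> E" "e \<notin> F" using F insert by auto
      note step = faces_insert[OF e uv(1) IH(1)]
      have "card ((\<lambda>x. (edge_rel (insert e F))\<^sup>* `` {x}) ` V) + 1 \<le>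
        card ((\<lambda>x. (edge_rel F)\<^sup>* `` {x}) ` V) + (if (u, v) \<in> (edge_rel F)\<^sup>* then 1 else 0)"
      proof (cases "(u, v) \<in> (edge_rel F)\<^sup>*")
        case True
        have "(edge_rel (insert e F))\<^sup>* = (edge_rel F)\<^sup>*"
        proof (rule rtrancl_subset)
          show "edge_rel F \<subseteq> edge_rel (insert e F)" by (auto simp: edge_rel_def)
          have "(v, u) \<in> (edge_rel F)\<^sup>*"
            using True sym_rtrancl[OF sym_edge_rel] by (metis symD)
          then show "edge_rel (insert e F) \<subseteq> (edge_rel F)\<^sup>*"
            using True uv by (auto simp: edge_rel_def doubleton_eq_iff)
        qed
        then show ?thesis using True by simp
      next
        case False
        then show ?thesis
          using card_classes_merge[OF finite_verts uv(2,3) False] uv(1) by (simp add: Suc_le_eq)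
      qed
      then show "?P (insert e F)" using step IH insert.hyps by (simp split: if_splits)
    qed
  qed
  then show "finite (faces F)"
    and "card F + card ((\<lambda>x. (edge_rel F)\<^sup>* `` {x}) ` V) < card (faces F) + card V"
    using assms by auto
qed

lemma edges_lt_faces_plus_verts:
  assumes "F \<subseteq> E"
  shows "card F + 1 < card (faces F) + card V"
proof -
  have "card ((\<lambda>x. (edge_rel F)\<^sup>* `` {x}) ` V) > 0"
    using finite_verts nonempty_verts by (simp add: card_gt_0_iff)
  then show ?thesis using face_count(2)[OF assms] by linarith
qed

text \<open>An edge closing no cycle joins two different components, and such an edge leaves the
  number of faces unchanged.\<close>

lemma card_faces_forest:
  assumes "F \<subseteq> E" "\<nexists>vs. is_cycle F vs"
  shows "card (faces F) = 1"
proof -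
  have "finite F" using finite_subset[OF assms(1) finite_edges] .
  then have "F \<subseteq> E \<longrightarrow> (\<nexists>vs. is_cycle F vs) \<longrightarrow> card (faces F) = 1"
  proof (induction F rule: finite_induct)
    case empty
    have "faces {} = {UNIV :: complex set}"
      by (simp add: drawn_def components_eq_sing_iff connected_UNIV)
    then show ?case by simp
  next
    case (insert e F)
    show ?case
    proof (intro impI)
      assume F: "insert e F \<subseteq> E" and ac: "\<nexists>vs. is_cycle (insert e F) vs"
      then have "\<nexists>vs. is_cycle F vs" by (auto simp: is_cycle_def)
      then have IH: "card (faces F) = 1" using insert F by auto
      obtain u v where uv: "e = {u, v}" "u \<noteq> v" using edge_cases F by (metis insert_subset)
      have e: "e \<in> E" "F \<subseteq> E" "e \<notin> F" using F insert by auto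
      have "(u, v) \<notin> (edge_rel F)\<^sup>*"
        using cycle_of_reachable_ends[of u v F] uv ac insert.hyps by blast
      then show "card (faces (insert e F)) = 1"
        using faces_insert(2)[OF e uv(1)] face_count(1) e IH by simp
    qed
  qed
  then show ?thesis using assms by blast
qed

text \<open>Tested at inner points of the edge, since a vertex can lie in the closure of many other
  faces.\<close>

definition borders :: "'a set \<Rightarrow> complex set \<Rightarrow> bool" where
  "borders e C \<longleftrightarrow> open_arc e \<inter> closure C \<noteq> {}"

text \<open>The inner points of \<open>e\<close> lie in one open face \<open>W\<close> of the
  drawing without \<open>e\<close>. A face whose closure meets them meets \<open>W\<close>, hence is
  one of the at most two pieces into which \<open>e\<close> cuts \<open>W\<close>.\<close>

lemma card_bordered_faces:
  assumes "e \<in> E"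
  shows "card {C \<in> faces E. borders e C} \<le> 2"
proof -
  let ?F = "E - {e}"
  have e: "e \<in> E" "?F \<subseteq> E" "e \<notin> ?F" "insert e ?F = E" using assms by blast+
  obtain u v where uv: "e = {u, v}" using edge_cases[OF assms] by metis
  obtain W where W: "W \<in> faces ?F" "img e - drawn ?F \<subseteq> W"
    and eq: "faces E = (faces ?F - {W}) \<union> components (W - img e)"
    using face_containing_open_arc[OF e(1-3)] e(4) by metis
  note comp = components_face_diff[OF e(1-3) uv W]
  have Wop: "open W"
    using W(1) compact_drawn[OF e(2)] by (meson compact_imp_closed open_Compl open_components)
  have "{C \<in> faces E. borders e C} \<subseteq> components (W - img e)"
  proof
    fix C assume "C \<in> {C \<in> faces E. borders e C}"
    then have C: "C \<in> faces E" "open_arc e \<inter> closure C \<noteq> {}" by (auto simp: borders_def)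
    have "open_arc e \<subseteq> W"
      using open_arc_Int_drawn[OF e(1-3)] W(2) by (auto simp: open_arc_def)
    then have "W \<inter> closure C \<noteq> {}" using C(2) by blast
    then have "W \<inter> C \<noteq> {}" using open_Int_closure_eq_empty[OF Wop] by blast
    then have "C \<notin> faces ?F - {W}" using components_nonoverlap[OF _ W(1), of C] by blast
    then show "C \<in> components (W - img e)" using C(1) eq by blast
  qed
  then have "card {C \<in> faces E. borders e C} \<le> card (components (W - img e))"
    using comp by (intro card_mono) auto
  then show ?thesis using comp(1) by (auto split: if_splits)
qed

text \<open>If the edges bordering a face formed a forest, their complement would be connected,
  hence equal to that face, leaving no room for the remaining edges.\<close>

lemma face_border_has_cycle:
  assumes C: "C \<in> faces E" and cyc: "is_cycle E vs0"
  obtains vs where "is_cycle {e \<in> E. borders e C} vs"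
proof (rule ccontr)
  let ?F = "{e \<in> E. borders e C}"
  assume "\<not> thesis"
  then have ac: "\<nexists>vs. is_cycle ?F vs" using that by blast
  have cl: "closed (drawn E)" "closed (drawn ?F)"
    by (auto intro!: compact_imp_closed compact_drawn)
  have "connected (- drawn ?F)"
  proof -
    have "card (faces ?F) = 1" using card_faces_forest[OF _ ac] by blast
    then obtain K where "faces ?F = {K}" by (rule card_1_singletonE)
    then show ?thesis using components_eq_sing_exists by blast
  qed
  \<comment> \<open>Frontier points at vertices cannot be attributed to one edge, so the finitely
    many vertices are taken out; an open connected plane set stays connected.\<close>
  then have con: "connected (- drawn ?F - pos ` V)"
    using cl finite_verts by (intro connected_open_delete_finite) (auto simp: open_Compl)
  have Cne: "C \<noteq> {}" and Csub: "C \<subseteq> - drawn E" and Cop: "open C"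
    using C cl in_components_nonempty in_components_subset open_components by (blast, blast, metis open_Compl)
  have front: "frontier C \<subseteq> drawn ?F \<union> pos ` V"
  proof
    fix x assume x: "x \<in> frontier C"
    then have "x \<in> drawn E" using frontier_of_components_closed_complement[OF cl(1) C] by blast
    then obtain e where e: "e \<in> E" "x \<in> img e" by (auto simp: drawn_def)
    show "x \<in> drawn ?F \<union> pos ` V"
    proof (cases "x \<in> pos ` V")
      case False
      then have "x \<in> open_arc e" using e by (simp add: open_arc_def)
      moreover have "x \<in> closure C" using x by (simp add: frontier_def)
      ultimately have "e \<in> ?F" using e by (auto simp: borders_def)
      then show ?thesis using e by (auto simp: drawn_def)
    qed simp
  qed
  \<comment> \<open>A connected set that meets \<open>C\<close> but not its frontier stays inside
    \<open>C\<close>.\<close>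
  have sub: "- drawn ?F - pos ` V \<subseteq> C"
  proof (rule ccontr)
    assume n: "\<not> - drawn ?F - pos ` V \<subseteq> C"
    have "C \<subseteq> - drawn ?F" using Csub by (auto simp: drawn_def)
    moreover have "\<not> C \<subseteq> pos ` V"
      using Cop Cne finite_verts by (metis finite_imageI finite_imp_not_open finite_subset)
    ultimately have "(- drawn ?F - pos ` V) \<inter> C \<noteq> {}" by blast
    moreover have "(- drawn ?F - pos ` V) - C \<noteq> {}" using n by blast
    ultimately have "(- drawn ?F - pos ` V) \<inter> frontier C \<noteq> {}"
      using connected_Int_frontier[OF con] by blast
    then show False using front by blast
  qed
  have "E \<subseteq> ?F"
  proof
    fix e assume e: "e \<in> E"
    show "e \<in> ?F"
    proof (rule ccontr)
      assume "e \<notin> ?F"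
      then have "open_arc e \<inter> drawn ?F = {}" using open_arc_Int_drawn[OF e, of ?F] by blast
      then have "open_arc e \<subseteq> C" using sub by (auto simp: open_arc_def)
      moreover have "open_arc e \<subseteq> drawn E" using e by (auto simp: open_arc_def drawn_def)
      ultimately show False using Csub open_arc_nonempty[OF e] by blast
    qed
  qed
  then have "?F = E" by blast
  then show False using ac cyc by auto
qed

text \<open>Counting incidences of edges with the \<open>f\<close> faces gives
  \<open>12 f <= 2 |E|\<close>; together with \<open>|E| + 1 < f + |V|\<close> this yields the
  bound. Forests are treated apart because a face border contains a cycle only if the graph has
  one.\<close>

lemma sparse_of_girth:
  assumes "12 \<le> girth E"
  shows "5 * card E < 6 * card V"
proof (cases "\<exists>vs. is_cycle E vs")
  case False
  have "card E + 1 < 1 + card V"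
    using edges_lt_faces_plus_verts[of E] card_faces_forest[of E] False by auto
  then show ?thesis by linarith
next
  case True
  then obtain vs0 where vs0: "is_cycle E vs0" by blast
  let ?B = "{(e, C). e \<in> E \<and> C \<in> faces E \<and> borders e C}"
  have fin: "finite (faces E)" using face_count(1) by blast
  have B1: "?B = Sigma E (\<lambda>e. {C \<in> faces E. borders e C})" by auto
  have "card ?B = (\<Sum>e\<in>E. card {C \<in> faces E. borders e C})"
    unfolding B1 using finite_edges fin by (intro card_SigmaI) auto
  also have "\<dots> \<le> (\<Sum>e\<in>E. 2)" by (intro sum_mono card_bordered_faces)
  finally have up: "card ?B \<le> 2 * card E" by simp
  have B2: "?B = (\<lambda>(C, e). (e, C)) ` Sigma (faces E) (\<lambda>C. {e \<in> E. borders e C})" by auto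
  have "card ?B = card (Sigma (faces E) (\<lambda>C. {e \<in> E. borders e C}))"
    unfolding B2 by (intro card_image) (auto simp: inj_on_def)
  also have "\<dots> = (\<Sum>C\<in>faces E. card {e \<in> E. borders e C})"
    using finite_edges fin by (intro card_SigmaI) auto
  finally have "card ?B = (\<Sum>C\<in>faces E. card {e \<in> E. borders e C})" .
  moreover have "12 \<le> card {e \<in> E. borders e C}" if C: "C \<in> faces E" for C
  proof -
    obtain vs where vs: "is_cycle {e \<in> E. borders e C} vs"
      using face_border_has_cycle[OF C vs0] by blast
    then have "is_cycle E vs" by (auto simp: is_cycle_def)
    then have "girth E \<le> enat (length vs)" unfolding girth_def by (intro INF_lower) simp
    then have "(12::enat) \<le> enat (length vs)" using assms order_trans by blast
    then have "12 \<le> length vs" by (simp add: numeral_eq_enat)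
    also have "\<dots> \<le> card {e \<in> E. borders e C}"
      using card_cycle_edges[OF vs] finite_edges by auto
    finally show ?thesis .
  qed
  ultimately have "12 * card (faces E) \<le> card ?B"
    using sum_mono[of "faces E" "\<lambda>_. 12" "\<lambda>C. card {e \<in> E. borders e C}"] by (simp add: mult.commute)
  then show ?thesis using up edges_lt_faces_plus_verts[of E] by auto
qed

end

section \<open>Short cycles and trees\<close>

definition has_unique :: "('a \<Rightarrow> 'c) \<Rightarrow> 'a set \<Rightarrow> bool" where
  "has_unique f A \<longleftrightarrow> (\<exists>y\<in>A. \<forall>z\<in>A. f z = f y \<longrightarrow> z = y)"

lemma has_unique_cong: "(\<And>x. x \<in> A \<Longrightarrow> f x = g x) \<Longrightarrow> has_unique f A = has_unique g A"
  by (simp add: has_unique_def)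

lemma choose_unique_at:
  assumes "i \<in> I" "n \<in> Q i" and ne: "\<And>j. j \<in> I \<Longrightarrow> Q j \<noteq> {}"
    and other: "\<And>j. j \<in> I \<Longrightarrow> j \<noteq> i \<Longrightarrow> Q j \<noteq> {n}"
  shows "\<exists>f. (\<forall>j\<in>I. f j \<in> Q j) \<and> has_unique f I"
proof -
  have "\<forall>j\<in>I. j \<noteq> i \<longrightarrow> (\<exists>y. y \<in> Q j \<and> y \<noteq> n)" using ne other by blast
  then obtain g where g: "\<forall>j\<in>I. j \<noteq> i \<longrightarrow> g j \<in> Q j \<and> g j \<noteq> n" by metis
  then show ?thesis
    using assms(1,2) by (intro exI[of _ "g(i := n)"]) (auto simp: has_unique_def)
qed

text \<open>If no choice works, then every available color is the only option of at least two indices.\<close>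

lemma choose_unique:
  assumes fin: "finite I" and ne: "\<And>j. j \<in> I \<Longrightarrow> Q j \<noteq> {}"
    and few: "card {j \<in> I. \<exists>x. Q j = {x}} < 2 * card (\<Union>j\<in>I. Q j)"
  shows "\<exists>f. (\<forall>j\<in>I. f j \<in> Q j) \<and> has_unique f I"
proof (rule ccontr)
  assume no: "\<not> ?thesis"
  let ?P = "{j \<in> I. \<exists>x. Q j = {x}}" and ?U = "\<Union>j\<in>I. Q j"
  have two: "\<exists>j k. j \<in> ?P \<and> k \<in> ?P \<and> j \<noteq> k \<and> Q j = {n} \<and> Q k = {n}" if n: "n \<in> ?U" for n
  proof -
    \<comment> \<open>Choosing \<open>n\<close> at \<open>i\<close> fails only if another index has
      \<open>n\<close> as its only option. Used first for any \<open>i\<close> offering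
      \<open>n\<close>, then for the index so found, this produces two such indices.\<close>
    have *: "\<exists>j\<in>I. j \<noteq> i \<and> Q j = {n}" if "i \<in> I" "n \<in> Q i" for i
      using choose_unique_at[of i I n Q] that ne no by blast
    from n obtain i where "i \<in> I" "n \<in> Q i" by blast
    then obtain j where j: "j \<in> I" "Q j = {n}" using * by blast
    then obtain k where "k \<in> I" "k \<noteq> j" "Q k = {n}" using *[of j] by blast
    with j show ?thesis by blast
  qed
  have finU: "finite ?U" by (rule card_ge_0_finite) (use few in linarith)
  have "2 * card ?U = (\<Sum>n\<in>?U. 2)" by simp
  also have "\<dots> \<le> (\<Sum>n\<in>?U. card {j \<in> ?P. Q j = {n}})"
  proof (rule sum_mono)
    fix n assume "n \<in> ?U"
    then obtain j k where jk: "j \<in> ?P" "k \<in> ?P" "j \<noteq> k" "Q j = {n}" "Q k = {n}"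
      using two[OF \<open>n \<in> ?U\<close>] by (elim exE conjE)
    then have "card {j, k} \<le> card {j \<in> ?P. Q j = {n}}" using fin by (intro card_mono) auto
    then show "2 \<le> card {j \<in> ?P. Q j = {n}}" using jk by simp
  qed
  also have "\<dots> = card (\<Union>n\<in>?U. {j \<in> ?P. Q j = {n}})"
    using finU fin by (intro card_UN_disjoint[symmetric]) auto
  also have "\<dots> \<le> card ?P" using fin by (intro card_mono) auto
  finally show False using few by simp
qed

text \<open>With neighborhoods in place of edges, passing to an induced subgraph is just an
  intersection with its vertex set. The last assumption is girth at least 12, for cycles given as
  vertex lists.\<close>

locale ngraph =
  fixes V :: "'a set" and N :: "'a \<Rightarrow> 'a set"
  assumes finV: "finite V"
    and N_sub: "N x \<subseteq> V"
    and N_sym: "y \<in> N x \<Longrightarrow> x \<in> N y"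
    and N_irr: "x \<notin> N x"
    and no_short_cycle: "\<lbrakk>distinct p; 3 \<le> length p; \<forall>i. Suc i < length p \<longrightarrow> p ! Suc i \<in> N (p ! i);
      hd p \<in> N (last p)\<rbrakk> \<Longrightarrow> 12 \<le> length p"
begin

lemma finN [simp]: "finite (N x)"
  using finV N_sub finite_subset by blast

definition adj :: "'a set \<Rightarrow> 'a rel" where
  "adj S = {(x, y). x \<in> S \<and> y \<in> S \<and> y \<in> N x}"

text \<open>Only the radius is bounded; the absence of cycles follows from the girth. The 4 is one
  step from a root to a deficient neighbor plus a thread of at most three vertices.\<close>

definition tree_set :: "'a \<Rightarrow> 'a set \<Rightarrow> bool" where
  "tree_set r S \<longleftrightarrow> r \<in> S \<and> S \<subseteq> V \<and> (\<forall>x\<in>S. \<exists>n\<le>4. (r, x) \<in> adj S ^^ n)"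

lemma adj_mono: "S \<subseteq> T \<Longrightarrow> adj S \<subseteq> adj T"
  by (auto simp: adj_def)

lemma adj_relpow_mono: "S \<subseteq> T \<Longrightarrow> (x, y) \<in> adj S ^^ n \<Longrightarrow> (x, y) \<in> adj T ^^ n"
proof (induction n arbitrary: y)
  case (Suc n)
  then show ?case using adj_mono[of S T] by auto
qed simp

lemma sym_adj: "sym (adj S)"
  by (auto simp: adj_def sym_def N_sym)

lemma sym_adj_relpow: "(x, y) \<in> adj S ^^ n \<Longrightarrow> (y, x) \<in> adj S ^^ n"
proof (induction n arbitrary: y)
  case (Suc n)
  obtain z where z: "(x, z) \<in> adj S ^^ n" "(z, y) \<in> adj S"
    using Suc.prems by (rule relpow_Suc_E)
  have "(y, z) \<in> adj S" using z(2) sym_adj by (metis symD)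
  then show ?case using Suc.IH[OF z(1)] by (rule relpow_Suc_I2)
qed simp

lemma sym_adj_rtrancl: "(x, y) \<in> (adj S)\<^sup>* \<Longrightarrow> (y, x) \<in> (adj S)\<^sup>*"
  using sym_rtrancl[OF sym_adj] by (rule symD)

text \<open>Such a walk contains a path with at most 10 vertices, and \<open>x\<close> closes it to
  a cycle of length at most 11.\<close>

lemma no_two_short_walks:
  assumes "(y1, y2) \<in> adj (V - {x}) ^^ n" "n \<le> 9" "y1 \<noteq> y2" "y1 \<in> N x" "y2 \<in> N x"
  shows False
proof -
  obtain p where p: "p \<noteq> []" "length p \<le> Suc n" "hd p = y1" "last p = y2" "distinct p"
     "\<forall>i. Suc i < length p \<longrightarrow> (p ! i, p ! Suc i) \<in> adj (V - {x})"
    using relpow_distinct_path[OF assms(1)] by blast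
  have "length p \<noteq> 1" using p(3,4) assms(3) by (auto simp: length_Suc_conv)
  then have len: "2 \<le> length p" using p(1) by (cases p) (auto simp: Suc_le_eq)
  have "x \<noteq> p ! i" if i: "i < length p" for i
  proof (cases "Suc i < length p")
    case True
    then show ?thesis using p(6) by (auto simp: adj_def)
  next
    case False
    then have "Suc (i - 1) < length p" "i = Suc (i - 1)" using i len by auto
    then have "(p ! (i - 1), p ! i) \<in> adj (V - {x})" using p(6) by metis
    then show ?thesis by (auto simp: adj_def)
  qed
  then have "x \<notin> set p" by (auto simp: in_set_conv_nth)
  then have "distinct (x # p)" using p(5) by simp
  moreover have "\<forall>i. Suc i < length (x # p) \<longrightarrow> (x # p) ! Suc i \<in> N ((x # p) ! i)"
  proof (intro allI impI)
    fix i assume "Suc i < length (x # p)"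
    then show "(x # p) ! Suc i \<in> N ((x # p) ! i)"
      using p(1,3,6) assms(4) by (cases i) (auto simp: hd_conv_nth adj_def)
  qed
  moreover have "hd (x # p) \<in> N (last (x # p))" using p(1,4) assms(5) N_sym by simp
  ultimately have "12 \<le> length (x # p)" using len by (intro no_short_cycle) auto
  then show False using p(2) assms(2) by simp
qed

text \<open>A vertex \<open>x\<close> of \<open>C\<close> farthest from \<open>r\<close> has two
  neighbors in \<open>C\<close>, both reached from \<open>r\<close> without passing
  \<open>x\<close>, and these walks together are too short for the girth. One vertex
  \<open>z\<close> outside \<open>S\<close> is permitted so that cycles closed by an outside vertex
  are covered too.\<close>

lemma no_min_degree_two_near:
  assumes T: "tree_set r S" and C: "C \<noteq> {}" "C \<subseteq> V" "C - S \<subseteq> {z}"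
    and deg: "\<And>x. x \<in> C \<Longrightarrow> \<exists>y1 y2. y1 \<noteq> y2 \<and> y1 \<in> N x \<inter> C \<and> y2 \<in> N x \<inter> C"
  shows False
proof -
  define dist where "dist x = (LEAST n. (r, x) \<in> adj V ^^ n)" for x
  have dist_le: "dist x \<le> n" if "(r, x) \<in> adj V ^^ n" for x n
    using that unfolding dist_def by (rule Least_le)
  have SV: "S \<subseteq> V" and near: "\<And>x. x \<in> S \<Longrightarrow> \<exists>n\<le>4. (r, x) \<in> adj V ^^ n"
    using T adj_relpow_mono[of S V] unfolding tree_set_def by blast+
  have distS: "dist x \<le> 4" if "x \<in> S" for x
    using near[OF that] dist_le order_trans by blast
  have reach: "\<exists>n. (r, x) \<in> adj V ^^ n" if x: "x \<in> C" for x
  proof (cases "x \<in> S")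
    case True
    then show ?thesis using near by blast
  next
    case False
    obtain y1 y2 where y: "y1 \<noteq> y2" "y1 \<in> N x \<inter> C" "y2 \<in> N x \<inter> C" using deg[OF x] by blast
    have "x = z" using False x C(3) by blast
    then have "y1 \<in> S" using y C(3) N_irr by blast
    then obtain n where "(r, y1) \<in> adj V ^^ n" using near by blast
    moreover have "(y1, x) \<in> adj V" using y x C(2) N_sym by (auto simp: adj_def)
    ultimately show ?thesis using relpow_Suc_I by metis
  qed
  have walk: "(r, x) \<in> adj V ^^ dist x" if "x \<in> C" for x
    using reach[OF that] unfolding dist_def by (rule LeastI_ex)
  obtain x where x: "x \<in> C" and xmax: "\<And>y. y \<in> C \<Longrightarrow> dist y \<le> dist x"
  proof -
    have "finite C" using C(2) finV finite_subset by blast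
    then have "Max (dist ` C) \<in> dist ` C" using C(1) by (intro Max_in) auto
    then obtain x where "x \<in> C" "dist x = Max (dist ` C)" by auto
    then show ?thesis using that \<open>finite C\<close> by simp
  qed
  obtain y1 y2 where y: "y1 \<noteq> y2" "y1 \<in> N x \<inter> C" "y2 \<in> N x \<inter> C" using deg[OF x] by blast
  \<comment> \<open>On a shortest walk all earlier vertices are strictly closer to \<open>r\<close>
    than its end, hence closer than \<open>x\<close>; the induction therefore carries
    \<open>n = dist y\<close>.\<close>
  have avoid: "(r, y) \<in> adj (V - {x}) ^^ n"
    if "(r, y) \<in> adj V ^^ n" "n = dist y" "n \<le> dist x" "y \<noteq> x" for y n
    using that
  proof (induction n arbitrary: y)
    case 0
    then show ?case by simp
  next
    case (Suc n)
    obtain w where w: "(r, w) \<in> adj V ^^ n" "(w, y) \<in> adj V"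
      using Suc.prems(1) by (rule relpow_Suc_E)
    then have "(r, y) \<in> adj V ^^ Suc (dist w)"
      using LeastI[of "\<lambda>n. (r, w) \<in> adj V ^^ n", OF w(1)] w(2) unfolding dist_def[of w]
      by (intro relpow_Suc_I)
    then have "dist y \<le> Suc (dist w)" by (rule dist_le)
    then have dw: "dist w = n" using dist_le[OF w(1)] Suc.prems(2) by simp
    then have "w \<noteq> x" using Suc.prems by auto
    then have "(r, w) \<in> adj (V - {x}) ^^ n" 
      using Suc.IH[OF w(1)] dw[symmetric] Suc.prems(3) \<open>w \<noteq> x\<close> by simp
    moreover have "(w, y) \<in> adj (V - {x})" using w(2) \<open>w \<noteq> x\<close> Suc.prems(4) by (auto simp: adj_def)
    ultimately show ?case by auto
  qed
  \<comment> \<open>If \<open>y\<close> is the exceptional vertex \<open>z\<close>, then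
    \<open>x\<close> lies in \<open>S\<close>, and maximality bounds \<open>dist y\<close> by
    \<open>dist x\<close>.\<close>
  have d4: "dist y \<le> 4" if "y \<in> N x \<inter> C" for y
  proof (cases "y \<in> S")
    case False
    then have "x \<in> S" using that C(3) x N_irr by blast
    then show ?thesis using distS xmax that le_trans by blast
  qed (rule distS)
  have ne: "y1 \<noteq> x" "y2 \<noteq> x" using y N_irr by auto
  have w1: "(r, y1) \<in> adj (V - {x}) ^^ dist y1" and w2: "(r, y2) \<in> adj (V - {x}) ^^ dist y2"
    using avoid walk xmax y ne by auto
  have "(y1, r) \<in> adj (V - {x}) ^^ dist y1"
    using w1 by (rule sym_adj_relpow)
  with w2 have "(y1, y2) \<in> adj (V - {x}) ^^ (dist y1 + dist y2)" by (auto simp: relpow_add)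
  moreover have "dist y1 + dist y2 \<le> 9" using d4[OF y(2)] d4[OF y(3)] by linarith
  ultimately show False using no_two_short_walks y by blast
qed

text \<open>A path between the two vertices would form with \<open>w\<close> a cycle, all of whose
  vertices except possibly \<open>w\<close> lie in \<open>S\<close>.\<close>

lemma tree_set_separated:
  assumes T: "tree_set r S" and u: "u \<in> S" "u' \<in> S" "u \<noteq> u'" "u \<in> N w" "u' \<in> N w"
  shows "(u, u') \<notin> (adj (S - {w}))\<^sup>*"
proof
  assume "(u, u') \<in> (adj (S - {w}))\<^sup>*"
  then obtain n where "(u, u') \<in> adj (S - {w}) ^^ n" using rtrancl_imp_relpow by blast
  then obtain p where p: "p \<noteq> []" "hd p = u" "last p = u'" "distinct p"
     "\<forall>i. Suc i < length p \<longrightarrow> (p ! i, p ! Suc i) \<in> adj (S - {w})"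
    using relpow_distinct_path by metis
  have len: "2 \<le> length p" using p(1-3) u(3) by (cases p; cases "tl p") auto
  have inS: "p ! i \<in> S - {w}" if i: "i < length p" for i
  proof (cases "Suc i < length p")
    case True
    then show ?thesis using p(5) by (auto simp: adj_def)
  next
    case False
    then have "Suc (i - 1) < length p" "i = Suc (i - 1)" using i len by auto
    then have "(p ! (i - 1), p ! i) \<in> adj (S - {w})" using p(5) by metis
    then show ?thesis by (auto simp: adj_def)
  qed
  have SV: "S \<subseteq> V" using T by (simp add: tree_set_def)
  have wV: "w \<in> V" using u(4) N_sym N_sub by blast
  have hl: "p ! 0 = u" "p ! (length p - 1) = u'" using p by (simp_all add: hd_conv_nth last_conv_nth)
  show False
  proof (rule no_min_degree_two_near[OF T, of "insert w (set p)" w])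
    have "set p \<subseteq> S - {w}" using inS by (metis in_set_conv_nth subsetI)
    then show "insert w (set p) \<subseteq> V" "insert w (set p) - S \<subseteq> {w}" using SV wV by auto
    fix x assume "x \<in> insert w (set p)"
    then consider "x = w" | i where "i < length p" "x = p ! i" by (auto simp: in_set_conv_nth)
    then show "\<exists>y1 y2. y1 \<noteq> y2 \<and> y1 \<in> N x \<inter> insert w (set p) \<and> y2 \<in> N x \<inter> insert w (set p)"
    proof cases
      case 1
      then show ?thesis using u p(1,2,3) by (intro exI[of _ u] exI[of _ u']) auto
    next
      case 2
      \<comment> \<open>Predecessor and successor of \<open>x\<close> on the cycle, with
        \<open>w\<close> closing both ends of the path.\<close>
      define a where "a = (if i = 0 then w else p ! (i - 1))"
      define b where "b = (if Suc i = length p then w else p ! Suc i)"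
      have "a \<in> insert w (set p)" "b \<in> insert w (set p)" using 2 by (auto simp: a_def b_def)
      moreover have "a \<in> N x"
      proof (cases "i = 0")
        case True
        then show ?thesis using 2 hl u N_sym by (simp add: a_def)
      next
        case False
        then have "(p ! (i - 1), p ! i) \<in> adj (S - {w})" using p(5) 2(1)
          by (metis Suc_diff_1 gr0I)
        then show ?thesis using False 2 N_sym by (auto simp: a_def adj_def)
      qed
      moreover have "b \<in> N x"
      proof (cases "Suc i = length p")
        case True
        then have "x = u'" using 2 hl by (metis diff_Suc_1)
        then show ?thesis using True u N_sym by (simp add: b_def)
      next
        case False
        then have "(p ! i, p ! Suc i) \<in> adj (S - {w})" using p(5) 2(1) by simp
        then show ?thesis using False 2 by (auto simp: b_def adj_def)
      qed
      moreover have "a \<noteq> b"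
      proof -
        have nw: "p ! j \<noteq> w" if "j < length p" for j using inS[OF that] by blast
        have ne: "p ! (i - 1) \<noteq> p ! Suc i" if "Suc i < length p"
          using p(4) that by (simp add: nth_eq_iff_index_eq)
        show ?thesis
        proof (cases "i = 0")
          case True
          then have "Suc i < length p" using len by simp
          then show ?thesis using True nw[of "Suc i"] by (auto simp: a_def b_def)
        next
          case False
          then have "a \<noteq> w" using nw[of "i - 1"] 2(1) by (simp add: a_def)
          then show ?thesis using False ne 2(1) by (auto simp: a_def b_def)
        qed
      qed
      ultimately show ?thesis by blast
    qed
  qed simp
qed

lemma tree_set_connected:
  assumes T: "tree_set r S" and "x \<in> S" "y \<in> S"
  shows "(x, y) \<in> (adj S)\<^sup>*"
proof -
  have "(r, x) \<in> (adj S)\<^sup>*" "(r, y) \<in> (adj S)\<^sup>*"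
    using assms by (auto simp: tree_set_def intro: relpow_imp_rtrancl)
  then show ?thesis using sym_adj_rtrancl[of r x S] by (metis rtrancl_trans)
qed

text \<open>Removing a vertex outside \<open>S\<close> cannot separate \<open>S\<close>, so two such
  neighbors would contradict the separation. This is why an outside vertex gains at most one new
  neighbor when \<open>S\<close> is colored.\<close>

lemma tree_set_outside:
  assumes T: "tree_set r S" and "z \<notin> S" "s \<in> N z" "s' \<in> N z" "s \<in> S" "s' \<in> S"
  shows "s = s'"
proof (rule ccontr)
  assume "s \<noteq> s'"
  then have "(s, s') \<notin> (adj (S - {z}))\<^sup>*" using tree_set_separated[OF T] assms by blast
  then show False using tree_set_connected[OF T] assms by simp
qed

end

section \<open>Extending colorings of vertex-deleted subgraphs\<close>

definition kap :: "nat \<Rightarrow> nat" where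
  "kap n = (if n = 2 then 4 else n + 1)"

text \<open>The exceptional value 4 at degree 2 is also the value at degree 3. Hence deleting
  vertices never makes the remaining lists too short.\<close>

lemma kap_mono: "m \<le> n \<Longrightarrow> kap m \<le> kap n"
  by (auto simp: kap_def)

context ngraph
begin

definition pcf :: "'a set \<Rightarrow> ('a \<Rightarrow> 'c set) \<Rightarrow> ('a \<Rightarrow> 'c) \<Rightarrow> bool" where
  "pcf U L \<phi> \<longleftrightarrow> (\<forall>x\<in>U. \<phi> x \<in> L x \<and> (\<forall>y\<in>N x \<inter> U. \<phi> y \<noteq> \<phi> x) \<and>
     (N x \<inter> U \<noteq> {} \<longrightarrow> has_unique \<phi> (N x \<inter> U)))"

end

text \<open>\<open>smaller\<close> allows other lists \<open>L'\<close>, since one reduction first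
  removes a color from a list. The lists of the counterexample have exact size, which the counting
  of leaf colors uses.\<close>

locale minimal_counterexample = ngraph V N for V :: "'a set" and N +
  fixes L :: "'a \<Rightarrow> 'c set"
  assumes finL: "x \<in> V \<Longrightarrow> finite (L x)"
    and cardL: "x \<in> V \<Longrightarrow> card (L x) = kap (card (N x))"
    and smaller: "\<And>S (L' :: 'a \<Rightarrow> 'c set). \<lbrakk>S \<subseteq> V; S \<noteq> {};
      \<And>x. x \<in> V - S \<Longrightarrow> finite (L' x) \<and> kap (card (N x - S)) \<le> card (L' x)\<rbrakk> \<Longrightarrow> \<exists>\<phi>. pcf (V - S) L' \<phi>"
    and not_colorable: "\<not> pcf V L \<phi>"

text \<open>\<open>S\<close> is the deleted set, \<open>\<phi>\<close> a coloring of the rest and \<open>c z\<close> a color that occurs exactly once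
  around \<open>z\<close> there; since \<open>z\<close> gets at most one new neighbor, it suffices that this neighbor avoids
  both \<open>\<phi> z\<close> and \<open>c z\<close>.\<close>

locale deletion = minimal_counterexample V N L for V :: "'a set" and N and L :: "'a \<Rightarrow> 'c set" +
  fixes r :: 'a and S :: "'a set" and \<phi> c :: "'a \<Rightarrow> 'c"
  assumes tree: "tree_set r S"
    and rest: "pcf (V - S) L \<phi>"
    and c_unique: "\<lbrakk>z \<in> V - S; N z - S \<noteq> {}\<rbrakk> \<Longrightarrow>
      \<exists>y\<in>N z - S. \<phi> y = c z \<and> (\<forall>y'\<in>N z - S. \<phi> y' = c z \<longrightarrow> y' = y)"

lemma (in minimal_counterexample) deletion_exists:
  assumes "tree_set r S"
  obtains \<phi> c where "deletion V N L r S \<phi> c"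
proof -
  have "S \<subseteq> V" "S \<noteq> {}" using assms by (auto simp: tree_set_def)
  moreover have "finite (L x) \<and> kap (card (N x - S)) \<le> card (L x)" if "x \<in> V - S" for x
    using that finL cardL kap_mono[of "card (N x - S)" "card (N x)"] by (auto simp: card_mono)
  ultimately obtain \<phi> where \<phi>: "pcf (V - S) L \<phi>" using smaller by metis
  define P where "P z k \<longleftrightarrow> (\<exists>y\<in>N z - S. \<phi> y = k \<and> (\<forall>y'\<in>N z - S. \<phi> y' = k \<longrightarrow> y' = y))" for z k
  have "\<exists>k. P z k" if "z \<in> V - S" "N z - S \<noteq> {}" for z
  proof -
    have "N z \<inter> (V - S) = N z - S" using N_sub by blast
    then have "has_unique \<phi> (N z - S)" using \<phi> that unfolding pcf_def by metis
    then show ?thesis unfolding has_unique_def P_def by blast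
  qed
  then have "\<forall>z\<in>{z \<in> V - S. N z - S \<noteq> {}}. \<exists>k. P z k" by blast
  from bchoice[OF this] obtain c where "\<forall>z\<in>{z \<in> V - S. N z - S \<noteq> {}}. P z (c z)" by blast
  then have "deletion V N L r S \<phi> c"
    using assms \<phi> unfolding P_def by unfold_locales blast+
  then show ?thesis by (rule that)
qed

context deletion
begin

lemma S_sub: "S \<subseteq> V" and r_in: "r \<in> S"
  using tree by (auto simp: tree_set_def)

text \<open>The clause on \<open>c z\<close> protects the outside neighbors of \<open>x\<close>. The
  predicate looks only at \<open>x\<close> and its neighbors, so colorings of different branches can
  be glued.\<close>

definition okv :: "('a \<Rightarrow> 'c) \<Rightarrow> 'a \<Rightarrow> bool" where
  "okv g x \<longleftrightarrow> g x \<in> L x \<and> (\<forall>y\<in>N x. g y \<noteq> g x) \<and> (\<forall>z\<in>N x - S. g x \<noteq> c z) \<and>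
     (N x \<noteq> {} \<longrightarrow> has_unique g (N x))"

lemma okv_cong:
  assumes "g x = g' x" "\<And>y. y \<in> N x \<Longrightarrow> g y = g' y"
  shows "okv g x = okv g' x"
  using assms has_unique_cong[of "N x" g g'] by (simp add: okv_def)

lemma not_completable:
  assumes ext: "\<And>x. x \<in> V - S \<Longrightarrow> g x = \<phi> x" and ok: "\<And>x. x \<in> S \<Longrightarrow> okv g x"
  shows False
proof -
  have "pcf V L g"
    unfolding pcf_def
  proof (intro ballI conjI impI)
    have NV: "N x \<inter> V = N x" for x using N_sub by blast
    fix x assume x: "x \<in> V"
    show "g x \<in> L x"
      using x ok ext rest by (cases "x \<in> S") (auto simp: okv_def pcf_def)
    show "g y \<noteq> g x" if y: "y \<in> N x \<inter> V" for y
    proof (cases "x \<in> S \<or> y \<in> S")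
      case True
      then show ?thesis
      proof
        assume "x \<in> S"
        then show ?thesis using ok y by (auto simp: okv_def)
      next
        assume "y \<in> S"
        moreover have "x \<in> N y" using y N_sym by blast
        ultimately show ?thesis using ok[of y] unfolding okv_def by metis
      qed
    next
      case False
      then show ?thesis using rest x y ext by (auto simp: pcf_def)
    qed
    assume ne: "N x \<inter> V \<noteq> {}"
    show "has_unique g (N x \<inter> V)"
      unfolding NV
    proof (cases "x \<in> S")
      case True
      then show "has_unique g (N x)" using ok ne NV by (auto simp: okv_def)
    next
      case False
      show "has_unique g (N x)"
      \<comment> \<open>Without outside neighbors \<open>x\<close> has a single neighbor in total,
        whose color is trivially unique; otherwise the old unique color \<open>c x\<close>
        survives.\<close>
      proof (cases "N x - S = {}")
        case True
        then obtain s where "s \<in> N x" "s \<in> S" using ne by blast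
        moreover have "z = s" if "z \<in> N x" for z
          using tree_set_outside[OF tree False] that True calculation by blast
        ultimately show ?thesis unfolding has_unique_def by blast
      next
        case ne': False
        obtain y where y: "y \<in> N x - S" "\<phi> y = c x" "\<forall>y'\<in>N x - S. \<phi> y' = c x \<longrightarrow> y' = y"
          using c_unique[of x] x False ne' by blast
        have psi: "g z = \<phi> z" if "z \<in> N x - S" for z using that ext N_sub by blast
        have "z = y" if z: "z \<in> N x" "g z = g y" for z
        proof (cases "z \<in> S")
          case True
          then have "g z \<noteq> c x" using ok[OF True] z(1) False N_sym by (auto simp: okv_def)
          then show ?thesis using z(2) psi[of y] y(1,2) by simp
        next
          case False
          then have "\<phi> z = c x" using z psi[of y] psi[of z] y(1,2) by simp
          then show ?thesis using y(3) z(1) False by blast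
        qed
        then show ?thesis using y unfolding has_unique_def by blast
      qed
    qed
  qed
  then show False using not_colorable by blast
qed

text \<open>The branch behind \<open>w\<close> seen from \<open>v\<close>. It is empty for
  \<open>w\<close> outside \<open>S\<close>, whose color is already fixed.\<close>

definition D :: "'a \<Rightarrow> 'a \<Rightarrow> 'a set" where
  "D v w = (if w \<in> S then {x. (w, x) \<in> (adj (S - {v}))\<^sup>*} else {})"

text \<open>\<open>opt v w \<beta>\<close> collects the colors of \<open>w\<close> for which the branch \<open>D v w\<close> can be completed
  once \<open>v\<close> has color \<open>\<beta>\<close>.\<close>

definition opt :: "'a \<Rightarrow> 'a \<Rightarrow> 'c \<Rightarrow> 'c set" where
  "opt v w \<beta> = {t. \<exists>g. g v = \<beta> \<and> g w = t \<and> (\<forall>x\<in>V - S. g x = \<phi> x) \<and> (\<forall>x\<in>D v w. okv g x)}"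

lemma D_sub: "v \<noteq> w \<Longrightarrow> D v w \<subseteq> S - {v}"
proof
  fix x assume "v \<noteq> w" "x \<in> D v w"
  then have "w \<in> S - {v}" "(w, x) \<in> (adj (S - {v}))\<^sup>*" by (auto simp: D_def split: if_splits)
  from this(2,1) show "x \<in> S - {v}"
    by (induction rule: rtrancl_induct) (auto simp: adj_def)
qed

lemma D_self: "w \<in> S \<Longrightarrow> w \<in> D v w"
  by (simp add: D_def)

lemma D_step: "\<lbrakk>x \<in> D v w; y \<in> N x; y \<in> S; x \<in> S; x \<noteq> v; y \<noteq> v\<rbrakk> \<Longrightarrow> y \<in> D v w"
  by (auto simp: D_def adj_def intro: rtrancl_into_rtrancl split: if_splits)

lemma branch_cases:
  assumes "(w, x) \<in> (adj T)\<^sup>*" "T \<subseteq> S"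
  shows "x = w \<or> (\<exists>u\<in>N w \<inter> T. x \<in> D w u)"
  using assms(1)
proof (induction rule: rtrancl_induct)
  case (step x y)
  have xy: "x \<in> S" "y \<in> S" "y \<in> T" "y \<in> N x" using step.hyps assms(2) by (auto simp: adj_def)
  show ?case
  proof (cases "x = w \<or> y = w")
    case True
    then show ?thesis using xy D_self by auto
  next
    case False
    then obtain u where "u \<in> N w \<inter> T" "x \<in> D w u" using step.IH by blast
    moreover have "y \<in> D w u" using D_step[OF \<open>x \<in> D w u\<close>] xy False by blast
    ultimately show ?thesis by blast
  qed
qed simp

lemma D_disjoint:
  assumes "u \<in> N w" "u' \<in> N w" "u \<noteq> u'" "x \<in> D w u" "x \<in> D w u'"
  shows False
proof -
  have "u \<in> S" "u' \<in> S" "(u, x) \<in> (adj (S - {w}))\<^sup>*" "(u', x) \<in> (adj (S - {w}))\<^sup>*"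
    using assms by (auto simp: D_def split: if_splits)
  then have "(u, u') \<in> (adj (S - {w}))\<^sup>*" using sym_adj_rtrancl[of u' x] by (metis rtrancl_trans)
  then show False using tree_set_separated[OF tree \<open>u \<in> S\<close> \<open>u' \<in> S\<close>] assms by blast
qed

text \<open>The witnesses of the branches can be combined because branches are disjoint, and a
  neighbor of a branch vertex is in the same branch, equal to \<open>w\<close>, or outside
  \<open>S\<close>, where all witnesses agree with \<open>\<phi>\<close>. The color
  \<open>\<beta>\<close> is meant for the parent of \<open>w\<close>.\<close>

lemma glue:
  assumes w: "w \<in> S" and A: "A \<subseteq> N w" and o: "\<And>u. u \<in> A \<Longrightarrow> f u \<in> opt w u t"
  shows "\<exists>g. g w = t \<and> (\<forall>u\<in>A. g u = f u) \<and> (\<forall>x\<in>V - S. g x = \<phi> x) \<and>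
    (\<forall>u\<in>A. \<forall>x\<in>D w u. okv g x) \<and> (\<forall>v\<in>N w - A. v \<in> S \<longrightarrow> g v = \<beta>)"
proof -
  have "\<forall>u\<in>A. \<exists>g. g w = t \<and> g u = f u \<and> (\<forall>x\<in>V - S. g x = \<phi> x) \<and> (\<forall>x\<in>D w u. okv g x)"
    using o by (auto simp: opt_def)
  then obtain \<Psi> where \<Psi>: "\<And>u. u \<in> A \<Longrightarrow> \<Psi> u w = t" "\<And>u. u \<in> A \<Longrightarrow> \<Psi> u u = f u"
    "\<And>u x. u \<in> A \<Longrightarrow> x \<in> V - S \<Longrightarrow> \<Psi> u x = \<phi> x" "\<And>u x. u \<in> A \<Longrightarrow> x \<in> D w u \<Longrightarrow> okv (\<Psi> u) x"
    by metis
  define g where "g x = (if x = w then t else if \<exists>u\<in>A. x \<in> D w u then \<Psi> (THE u. u \<in> A \<and> x \<in> D w u) x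
     else if x \<in> S then \<beta> else \<phi> x)" for x
  have nw: "u \<noteq> w" if "u \<in> N w" for u using that N_irr by blast
  have DS: "D w u \<subseteq> S - {w}" if "u \<in> N w" for u using D_sub[of w u] nw[OF that] by metis
  have psiD: "g x = \<Psi> u x" if "u \<in> A" "x \<in> D w u" for u x
  proof -
    have "(THE u. u \<in> A \<and> x \<in> D w u) = u"
      using that A D_disjoint by (intro the_equality) blast+
    moreover have "x \<noteq> w" using DS that A by blast
    ultimately show ?thesis using that by (auto simp: g_def)
  qed
  have psiV: "g x = \<phi> x" if "x \<in> V - S" for x
  proof -
    have "x \<notin> D w u" if "u \<in> A" for u using DS A that \<open>x \<in> V - S\<close> by blast
    then show ?thesis using w that by (auto simp: g_def)
  qed
  show ?thesis
  proof (intro exI[of _ g] conjI ballI impI)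
    show "g w = t" by (simp add: g_def)
    show "g x = \<phi> x" if "x \<in> V - S" for x using psiV that .
    show "g u = f u" if u: "u \<in> A" for u
    proof (cases "u \<in> S")
      case True
      then show ?thesis using psiD[OF u D_self] \<Psi> u by simp
    next
      case False
      then have "u \<in> V - S" using u A N_sub by blast
      then show ?thesis using psiV \<Psi>(2,3) u by metis
    qed
    show "okv g x" if u: "u \<in> A" and x: "x \<in> D w u" for u x
    proof -
      have "g y = \<Psi> u y" if y: "y \<in> N x" for y
      proof -
        consider "y = w" | "y \<in> V - S" | "y \<in> S" "y \<noteq> w" using y N_sub by blast
        then show ?thesis
        proof cases
          case 1
          then show ?thesis using \<Psi>(1) u by (simp add: g_def)
        next
          case 2
          then show ?thesis using psiV \<Psi>(3) u by simp
        next
          case 3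
          then have "y \<in> D w u" using D_step[OF x y] DS x u A by blast
          then show ?thesis using psiD u by blast
        qed
      qed
      then show ?thesis using \<Psi>(4)[OF u x] okv_cong[of g x "\<Psi> u"] psiD[OF u x] by blast
    qed
    show "g v = \<beta>" if v: "v \<in> N w - A" "v \<in> S" for v
    proof -
      have "v \<notin> D w u" if u: "u \<in> A" for u
        using D_disjoint[of u w v v] D_self[OF v(2), of w] u A v(1) by blast
      then show ?thesis using v nw by (auto simp: g_def)
    qed
  qed
qed

lemma opt_outside: "\<lbrakk>u \<in> V; u \<notin> S; w \<in> S\<rbrakk> \<Longrightarrow> \<phi> u \<in> opt w u t"
  by (auto simp: opt_def D_def intro!: exI[of _ "\<phi>(w := t)"])

lemma opt_outside_eq: "\<lbrakk>u \<in> V; u \<notin> S; w \<in> S\<rbrakk> \<Longrightarrow> opt w u t = {\<phi> u}"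
  using opt_outside by (auto simp: opt_def)

lemma opt_inside:
  assumes "u \<in> S" "u \<in> N w" "t' \<in> opt w u t"
  shows "t' \<in> L u \<and> t' \<noteq> t"
proof -
  obtain g where g: "g w = t" "g u = t'" "okv g u"
    using assms(3) D_self[OF assms(1)] unfolding opt_def by blast
  then show ?thesis using N_sym[OF assms(2)] unfolding okv_def by metis
qed

lemma finite_opt:
  assumes "w \<in> S" "u \<in> N w"
  shows "finite (opt w u t)"
proof (cases "u \<in> S")
  case True
  then have "opt w u t \<subseteq> L u" using opt_inside assms by blast
  moreover have "finite (L u)" using finL True S_sub by blast
  ultimately show ?thesis by (rule finite_subset)
next
  case False
  moreover have "u \<in> V" using assms N_sub by blast
  ultimately show ?thesis using opt_outside_eq assms by simp
qed

text \<open>Recursion for options: with the branches beyond \<open>w\<close> glued, only the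
  requirements at \<open>w\<close> itself remain. The update of \<open>f\<close> accounts for the
  parent \<open>v\<close> among the neighbors of \<open>w\<close>.\<close>

lemma opt_compose:
  assumes v: "v \<in> S" "w \<in> S" "w \<in> N v" and t: "t \<in> L w" "t \<noteq> \<beta>"
    and f: "\<And>u. u \<in> N w - {v} \<Longrightarrow> f u \<in> opt w u t"
    and out: "\<And>u. u \<in> N w - S \<Longrightarrow> t \<noteq> \<phi> u \<and> t \<noteq> c u"
    and uniq: "has_unique (f(v := \<beta>)) (N w)"
  shows "t \<in> opt v w \<beta>"
proof -
  have vw: "v \<in> N w" "v \<noteq> w" using v N_sym N_irr by blast+
  have "\<exists>g. g w = t \<and> (\<forall>u\<in>N w - {v}. g u = f u) \<and> (\<forall>x\<in>V - S. g x = \<phi> x) \<and>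
    (\<forall>u\<in>N w - {v}. \<forall>x\<in>D w u. okv g x) \<and> (\<forall>y\<in>N w - (N w - {v}). y \<in> S \<longrightarrow> g y = \<beta>)"
    by (rule glue[OF v(2) Diff_subset]) (rule f)
  then obtain g where G: "g w = t" "\<forall>u\<in>N w - {v}. g u = f u" "\<forall>x\<in>V - S. g x = \<phi> x"
    "\<forall>u\<in>N w - {v}. \<forall>x\<in>D w u. okv g x" "\<forall>y\<in>N w - (N w - {v}). y \<in> S \<longrightarrow> g y = \<beta>"
    by (elim exE conjE)
  note g = G[rule_format]
  have pv: "g v = \<beta>" using g(5) v vw by blast
  have dec: "x = w \<or> (\<exists>u\<in>N w - {v}. x \<in> D w u)" if "x \<in> D v w" for x
  proof -
    have "(w, x) \<in> (adj (S - {v}))\<^sup>*" using that v by (simp add: D_def)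
    from branch_cases[OF this Diff_subset] show ?thesis by blast
  qed
  have agree: "g y = (f(v := \<beta>)) y" if "y \<in> N w" for y using that g(2) pv by auto
  have "okv g w"
    unfolding okv_def
  proof (intro conjI ballI impI)
    show "g w \<in> L w" using g(1) t by simp
    show "g w \<noteq> c z" if "z \<in> N w - S" for z using out[OF that] g(1) by simp
    show "g y \<noteq> g w" if y: "y \<in> N w" for y
    proof -
      consider "y = v" | "y \<in> N w - S" | "y \<in> N w - {v}" "y \<in> S" using y by blast
      then show ?thesis
      proof cases
        case 1
        then show ?thesis using pv g(1) t by simp
      next
        case 2
        then have "g y = \<phi> y" using g(3) N_sub by blast
        then show ?thesis using out[OF 2] g(1) by auto
      next
        case 3
        then have "f y \<noteq> t" using opt_inside[of y w] f by blast
        then show ?thesis using g(1,2) 3 by simp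
      qed
    qed
    show "has_unique g (N w)" using uniq has_unique_cong[of "N w" g] agree by blast
  qed
  then have "okv g x" if "x \<in> D v w" for x using dec[OF that] g(4) by blast
  then show ?thesis using pv g(1,3) by (auto simp: opt_def)
qed

text \<open>At the root no parent is left, so gluing all branches would color the whole
  graph.\<close>

lemma root_contradiction:
  assumes t: "t \<in> L r"
    and f: "\<And>u. u \<in> N r \<Longrightarrow> f u \<in> opt r u t"
    and out: "\<And>u. u \<in> N r - S \<Longrightarrow> t \<noteq> \<phi> u \<and> t \<noteq> c u"
    and uniq: "N r \<noteq> {} \<Longrightarrow> has_unique f (N r)"
  shows False
proof -
  have "\<exists>g. g r = t \<and> (\<forall>u\<in>N r. g u = f u) \<and> (\<forall>x\<in>V - S. g x = \<phi> x) \<and>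
    (\<forall>u\<in>N r. \<forall>x\<in>D r u. okv g x) \<and> (\<forall>y\<in>N r - N r. y \<in> S \<longrightarrow> g y = t)"
    by (rule glue[OF r_in subset_refl f])
  then obtain g where G: "g r = t" "\<forall>u\<in>N r. g u = f u" "\<forall>x\<in>V - S. g x = \<phi> x"
    "\<forall>u\<in>N r. \<forall>x\<in>D r u. okv g x"
    by (elim exE conjE)
  note g = G[rule_format]
  have dec: "x = r \<or> (\<exists>u\<in>N r. x \<in> D r u)" if "x \<in> S" for x
    using branch_cases[OF tree_set_connected[OF tree r_in that] subset_refl] by blast
  have "okv g r"
    unfolding okv_def
  proof (intro conjI ballI impI)
    show "g r \<in> L r" using g(1) t by simp
    show "g r \<noteq> c z" if "z \<in> N r - S" for z using out[OF that] g(1) by simp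
    show "g y \<noteq> g r" if y: "y \<in> N r" for y
    proof (cases "y \<in> S")
      case True
      then have "f y \<noteq> t" using opt_inside[of y r] f y by blast
      then show ?thesis using g(1,2) y by simp
    next
      case False
      then have "g y = \<phi> y" using g(3) y N_sub by blast
      then show ?thesis using out[of y] y False g(1) by auto
    qed
    show "has_unique g (N r)" if "N r \<noteq> {}" using uniq[OF that] has_unique_cong[of "N r" g f] g(2) by blast
  qed
  then show False using not_completable[of g] dec g(3,4) by blast
qed

end

section \<open>Threads\<close>

definition two :: "'c set \<Rightarrow> bool" where
  "two A \<longleftrightarrow> (\<exists>a\<in>A. \<exists>b\<in>A. a \<noteq> b)"

lemma two_mono: "two A \<Longrightarrow> A \<subseteq> B \<Longrightarrow> two B"
  by (auto simp: two_def)

lemma two_if_card: "2 \<le> card A \<Longrightarrow> two A"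
proof -
  assume "2 \<le> card A"
  then obtain T where "T \<subseteq> A" "card T = 2" by (meson obtain_subset_with_card_n)
  then show ?thesis by (auto simp: two_def card_2_iff)
qed

lemma nonempty_if_card: "1 \<le> card A \<Longrightarrow> A \<noteq> {}"
  by auto

lemma card_Diff_ge: "finite B \<Longrightarrow> card A \<le> card B + card (A - B)"
  using diff_card_le_card_Diff[of B A] by linarith

lemma card_Diff1_ge: "card A \<le> Suc (card (A - {x}))"
  using card_Diff_ge[of "{x}" A] by simp

text \<open>The palettes \<open>W\<close>, \<open>W'\<close>, \<open>W''\<close> of successive thread vertices leave two choices for the first
  one, except when the root has one of few colors.\<close>

lemma two_step_choices:
  assumes "3 \<le> card W" "2 \<le> card W'"
  shows "\<exists>F r. finite F \<and> card F \<le> 2 \<and>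
    (\<forall>t. two {a \<in> W. a \<noteq> t \<and> (\<exists>b\<in>W'. b \<noteq> t \<and> b \<noteq> a)} \<or>
      (t \<in> F \<and> r \<in> {a \<in> W. a \<noteq> t \<and> (\<exists>b\<in>W'. b \<noteq> t \<and> b \<noteq> a)}))"
proof -
  obtain p q where pq: "p \<in> W'" "q \<in> W'" "p \<noteq> q" using two_if_card[OF assms(2)] by (auto simp: two_def)
  have "1 \<le> card (W - {p, q})" using card_Diff_ge[of "{p, q}" W] assms(1) pq by simp
  then obtain r where r: "r \<in> W" "r \<noteq> p" "r \<noteq> q" using nonempty_if_card by blast
  \<comment> \<open>For \<open>t\<close> outside \<open>{p, q}\<close>, one of \<open>p\<close> and
    \<open>q\<close> differs from both \<open>a\<close> and \<open>t\<close>, so every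
    \<open>a\<close> in \<open>W\<close> other than \<open>t\<close> works.\<close>
  have "two {a \<in> W. a \<noteq> t \<and> (\<exists>b\<in>W'. b \<noteq> t \<and> b \<noteq> a)}" if "t \<notin> {p, q}" for t
  proof -
    have "2 \<le> card (W - {t})" using card_Diff1_ge[of W t] assms(1) by simp
    then have "two (W - {t})" by (rule two_if_card)
    moreover have "W - {t} \<subseteq> {a \<in> W. a \<noteq> t \<and> (\<exists>b\<in>W'. b \<noteq> t \<and> b \<noteq> a)}"
    proof
      fix a assume "a \<in> W - {t}"
      then show "a \<in> {a \<in> W. a \<noteq> t \<and> (\<exists>b\<in>W'. b \<noteq> t \<and> b \<noteq> a)}"
        using pq that by (cases "a = p") auto
    qed
    ultimately show ?thesis by (rule two_mono)
  qed
  moreover have "r \<in> {a \<in> W. a \<noteq> t \<and> (\<exists>b\<in>W'. b \<noteq> t \<and> b \<noteq> a)}" if "t \<in> {p, q}" for t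
    using that pq r by auto
  ultimately show ?thesis using pq by (intro exI[of _ "{p, q}"] exI[of _ r]) auto
qed

lemma three_step_choices:
  assumes "4 \<le> card W" "3 \<le> card W'" "2 \<le> card W''"
  shows "\<exists>F r. finite F \<and> card F \<le> 1 \<and>
    (\<forall>t. two {a \<in> W. a \<noteq> t \<and> (\<exists>b\<in>W'. b \<noteq> t \<and> b \<noteq> a \<and> (\<exists>d\<in>W''. d \<noteq> a \<and> d \<noteq> b))} \<or>
      (t \<in> F \<and> r \<in> {a \<in> W. a \<noteq> t \<and> (\<exists>b\<in>W'. b \<noteq> t \<and> b \<noteq> a \<and> (\<exists>d\<in>W''. d \<noteq> a \<and> d \<noteq> b))}))"
proof -
  let ?G = "\<lambda>t. {a \<in> W. a \<noteq> t \<and> (\<exists>b\<in>W'. b \<noteq> t \<and> b \<noteq> a \<and> (\<exists>d\<in>W''. d \<noteq> a \<and> d \<noteq> b))}"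
  obtain p q where pq: "p \<in> W''" "q \<in> W''" "p \<noteq> q" using two_if_card[OF assms(3)] by (auto simp: two_def)
  \<comment> \<open>A color off \<open>p\<close> and \<open>q\<close> always extends:
    \<open>b\<close> avoids \<open>a\<close> and \<open>t\<close>, and can then block only one of
    \<open>p\<close> and \<open>q\<close> as choice for \<open>d\<close>.\<close>
  have good: "a \<in> ?G t" if a: "a \<in> W" "a \<noteq> t" "a \<noteq> p" "a \<noteq> q" for a t
  proof -
    have "1 \<le> card (W' - {a, t})" using card_Diff_ge[of "{a, t}" W'] assms(2) a by simp
    then obtain b where b: "b \<in> W'" "b \<noteq> a" "b \<noteq> t" using nonempty_if_card by blast
    obtain d where "d \<in> W''" "d \<noteq> a" "d \<noteq> b" using pq a by metis
    then show ?thesis using a b by blast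
  qed
  \<comment> \<open>The only harmful root color is the third element of a \<open>W'\<close>
    consisting of \<open>p\<close>, \<open>q\<close> and one more. If two colors of \<open>W\<close>
    avoid \<open>t\<close>, \<open>p\<close> and \<open>q\<close>, they serve; else some
    \<open>b\<close> in \<open>W'\<close> outside \<open>{p, q, t}\<close> makes \<open>p\<close> or
    \<open>q\<close> usable as first color.\<close>
  have main: "two (?G t)" if nb: "\<not> (W' = {p, q, t} \<and> t \<notin> {p, q})" for t
  proof (cases "two (W - {t, p, q})")
    case True
    moreover have "W - {t, p, q} \<subseteq> ?G t"
    proof
      fix a assume "a \<in> W - {t, p, q}"
      then show "a \<in> ?G t" by (intro good) auto
    qed
    ultimately show ?thesis by (rule two_mono)
  next
    case False
    have c1: "card W \<le> card {t, p, q} + card (W - {t, p, q})" by (rule card_Diff_ge) simp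
    have "card (W - {t, p, q}) \<le> 1" using False two_if_card by (metis not_less_eq_eq One_nat_def numeral_2_eq_2)
    then have "3 \<le> card {t, p, q}" using c1 assms(1) by linarith
    then have wpq: "t \<noteq> p" "t \<noteq> q" using pq by (auto simp: card_insert_if split: if_splits)
    then have "card {t, p, q} = 3" using pq by simp
    then have "1 \<le> card (W - {t, p, q})" using c1 assms(1) by linarith
    then obtain a where a: "a \<in> W" "a \<noteq> t" "a \<noteq> p" "a \<noteq> q" using nonempty_if_card by blast
    have "2 \<le> card (W - {t, a})" using card_Diff_ge[of "{t, a}" W] assms(1) a by simp
    then have "two (W - {t, a})" by (rule two_if_card)
    then obtain e where e: "e \<in> W" "e \<noteq> t" "e \<noteq> a" by (auto simp: two_def)
    have "\<not> W' \<subseteq> {p, q, t}"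
    proof
      assume s: "W' \<subseteq> {p, q, t}"
      have "card {p, q, t} \<le> card W'" using assms(2) wpq pq by simp
      then have "W' = {p, q, t}" using s by (intro card_seteq) auto
      then show False using nb wpq by blast
    qed
    then obtain b where b: "b \<in> W'" "b \<noteq> p" "b \<noteq> q" "b \<noteq> t" by blast
    have "e \<in> ?G t"
    proof (cases "e = p \<or> e = q")
      case True
      obtain d where "d \<in> W''" "d \<noteq> e" "d \<noteq> b" using pq b True by metis
      moreover have "b \<noteq> e" using b True by auto
      ultimately show ?thesis using e b by blast
    next
      case False
      then show ?thesis using e by (intro good) auto
    qed
    moreover have "a \<in> ?G t" using a by (rule good)
    ultimately show ?thesis using e unfolding two_def by blast
  qed
  show ?thesis
  proof (cases "\<exists>f. W' = {p, q, f} \<and> f \<notin> {p, q}")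
    case True
    then obtain f where f: "W' = {p, q, f}" "f \<notin> {p, q}" by blast
    then have "p \<noteq> f" "q \<noteq> f" by auto
    then have "1 \<le> card (W - {p, q, f})" using card_Diff_ge[of "{p, q, f}" W] assms(1) pq by simp
    then obtain r where r: "r \<in> W" "r \<noteq> p" "r \<noteq> q" "r \<noteq> f" using nonempty_if_card by blast
    have "two (?G t)" if "t \<noteq> f" for t
    proof (rule main)
      show "\<not> (W' = {p, q, t} \<and> t \<notin> {p, q})" using f that by auto
    qed
    moreover have "r \<in> ?G f" using r by (intro good)
    ultimately have "two (?G t) \<or> (t \<in> {f} \<and> r \<in> ?G t)" for t
      by (cases "t = f") simp_all
    then show ?thesis by (intro exI[of _ "{f}"] exI[of _ r] conjI allI) simp_all
  next
    case False
    then have "two (?G t)" for t using main by blast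
    then show ?thesis by (intro exI[of _ "{}"]) simp
  qed
qed

section \<open>Options offered by leaves, threads and deficient vertices\<close>

context deletion
begin

lemma card_L2: "\<lbrakk>u \<in> V; card (N u) = 2\<rbrakk> \<Longrightarrow> card (L u) = 4"
  by (simp add: cardL kap_def)

lemma leaf_opt:
  assumes "w \<in> S" "u \<in> S" "N u = {w}"
  shows "L u - {t} \<subseteq> opt w u t"
proof
  fix a assume a: "a \<in> L u - {t}"
  show "a \<in> opt w u t"
  \<comment> \<open>A leaf has no neighbor besides \<open>w\<close>, so the function of options is
    never consulted.\<close>
  proof (rule opt_compose[where f = "\<lambda>_. undefined"])
    show "u \<in> N w" using assms(3) N_sym by blast
  qed (use assms a in \<open>auto simp: has_unique_def\<close>)
qed

text \<open>A vertex with two neighbors sees a unique color exactly when these are colored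
  differently. So colors two steps apart on a thread must differ, which explains
  \<open>b \<noteq> t\<close> here and the conditions of the following lemmas.\<close>

lemma thread_step:
  assumes "w \<in> S" "u \<in> S" "N u = {w, x}" "w \<noteq> x" "a \<in> L u" "a \<noteq> t" "b \<in> opt u x a" "b \<noteq> t"
    and "x \<notin> S \<Longrightarrow> a \<noteq> \<phi> x \<and> a \<noteq> c x"
  shows "a \<in> opt w u t"
proof (rule opt_compose[where f = "\<lambda>_. b"])
  show "u \<in> N w" using assms(3) N_sym by blast
  show "b \<in> opt u y a" if "y \<in> N u - {w}" for y using that assms by auto
  show "a \<noteq> \<phi> y \<and> a \<noteq> c y" if "y \<in> N u - S" for y using that assms by auto
  show "has_unique ((\<lambda>_. b)(w := t)) (N u)" using assms(3,4,8) by (auto simp: has_unique_def)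
qed (use assms in auto)

lemma thread1_opt:
  assumes "w \<in> S" "u \<in> S" "N u = {w, x}" "w \<noteq> x" "x \<notin> S" "t \<noteq> \<phi> x"
  shows "L u - {\<phi> x, c x, t} \<subseteq> opt w u t"
proof
  fix a assume a: "a \<in> L u - {\<phi> x, c x, t}"
  have "x \<in> V" using assms N_sub by blast
  then have "\<phi> x \<in> opt u x a" using opt_outside assms by blast
  then show "a \<in> opt w u t" using thread_step[OF assms(1-4)] a assms by blast
qed

lemma thread2_opt:
  assumes "w \<in> S" "u \<in> S" "N u = {w, x}" "w \<noteq> x" "x \<in> S" "N x = {u, y}" "u \<noteq> y" "y \<notin> S"
  shows "{a \<in> L u - {\<phi> y}. a \<noteq> t \<and> (\<exists>b\<in>L x - {\<phi> y, c y}. b \<noteq> t \<and> b \<noteq> a)} \<subseteq> opt w u t"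
proof
  fix a assume "a \<in> {a \<in> L u - {\<phi> y}. a \<noteq> t \<and> (\<exists>b\<in>L x - {\<phi> y, c y}. b \<noteq> t \<and> b \<noteq> a)}"
  then obtain b where b: "a \<in> L u" "a \<noteq> \<phi> y" "a \<noteq> t" "b \<in> L x - {\<phi> y, c y, a}" "b \<noteq> t" by blast
  then have "b \<in> opt u x a" using thread1_opt[OF assms(2,5-8), of a] by blast
  then show "a \<in> opt w u t" using thread_step[OF assms(1-4)] b assms(5) by blast
qed

lemma thread3_opt:
  assumes "w \<in> S" "u \<in> S" "N u = {w, x}" "w \<noteq> x" "x \<in> S" "N x = {u, y}" "u \<noteq> y"
    "y \<in> S" "N y = {x, z}" "x \<noteq> z" "z \<notin> S"
  shows "{a \<in> L u. a \<noteq> t \<and> (\<exists>b\<in>L x - {\<phi> z}. b \<noteq> t \<and> b \<noteq> a \<and>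
    (\<exists>d\<in>L y - {\<phi> z, c z}. d \<noteq> a \<and> d \<noteq> b))} \<subseteq> opt w u t"
proof
  fix a assume "a \<in> {a \<in> L u. a \<noteq> t \<and> (\<exists>b\<in>L x - {\<phi> z}. b \<noteq> t \<and> b \<noteq> a \<and>
    (\<exists>d\<in>L y - {\<phi> z, c z}. d \<noteq> a \<and> d \<noteq> b))}"
  then obtain b d where b: "a \<in> L u" "a \<noteq> t" "b \<in> L x - {\<phi> z}" "b \<noteq> t" "b \<noteq> a"
    "d \<in> L y - {\<phi> z, c z}" "d \<noteq> a" "d \<noteq> b" by blast
  then have "b \<in> opt u x a" using thread2_opt[OF assms(2,5-11), of a] by blast
  then show "a \<in> opt w u t" using thread_step[OF assms(1-4)] b assms(5) by blast
qed

text \<open>The fallback color \<open>k\<close> is the same for all exceptional \<open>t\<close>;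
  deficient vertices and roots with threads of lengths 2, 1, 1 rely on this.\<close>

definition free_arm :: "'a \<Rightarrow> 'a \<Rightarrow> 'c set \<Rightarrow> bool" where
  "free_arm w u F \<longleftrightarrow> finite F \<and> (\<exists>k. \<forall>t. two (opt w u t) \<or> (t \<in> F \<and> k \<in> opt w u t))"

lemma free_arm_nonempty: "free_arm w u F \<Longrightarrow> opt w u t \<noteq> {}"
  by (auto simp: free_arm_def two_def)

lemma free_arm_two: "free_arm w u F \<Longrightarrow> t \<notin> F \<Longrightarrow> two (opt w u t)"
  by (auto simp: free_arm_def)

lemma thread2_free:
  assumes "w \<in> S" "u \<in> S" "N u = {w, x}" "w \<noteq> x" "x \<in> S" "N x = {u, y}" "u \<noteq> y" "y \<notin> S"
  shows "\<exists>F. card F \<le> 2 \<and> free_arm w u F"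
proof -
  have "card (L u) = 4" "card (L x) = 4" using assms S_sub by (auto intro!: card_L2)
  \<comment> \<open>The vertex next to the outside end \<open>y\<close> loses
    \<open>\<phi> y\<close> and \<open>c y\<close>, the one before it only
    \<open>\<phi> y\<close>.\<close>
  then have "3 \<le> card (L u - {\<phi> y})" "2 \<le> card (L x - {\<phi> y, c y})"
    using card_Diff1_ge[of "L u" "\<phi> y"] card_Diff_ge[of "{\<phi> y, c y}" "L x"]
    by (auto simp: card_insert_if split: if_splits)
  from two_step_choices[OF this] obtain F k where "finite F" "card F \<le> 2"
    "\<forall>t. two {a \<in> L u - {\<phi> y}. a \<noteq> t \<and> (\<exists>b\<in>L x - {\<phi> y, c y}. b \<noteq> t \<and> b \<noteq> a)} \<or>
      (t \<in> F \<and> k \<in> {a \<in> L u - {\<phi> y}. a \<noteq> t \<and> (\<exists>b\<in>L x - {\<phi> y, c y}. b \<noteq> t \<and> b \<noteq> a)})"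
    by blast
  then show ?thesis
    using two_mono[OF _ thread2_opt[OF assms]] thread2_opt[OF assms] unfolding free_arm_def by blast
qed

lemma thread3_free:
  assumes "w \<in> S" "u \<in> S" "N u = {w, x}" "w \<noteq> x" "x \<in> S" "N x = {u, y}" "u \<noteq> y"
    "y \<in> S" "N y = {x, z}" "x \<noteq> z" "z \<notin> S"
  shows "\<exists>F. card F \<le> 1 \<and> free_arm w u F"
proof -
  have "card (L u) = 4" "card (L x) = 4" "card (L y) = 4" using assms S_sub by (auto intro!: card_L2)
  then have "4 \<le> card (L u)" "3 \<le> card (L x - {\<phi> z})" "2 \<le> card (L y - {\<phi> z, c z})"
    using card_Diff1_ge[of "L x" "\<phi> z"] card_Diff_ge[of "{\<phi> z, c z}" "L y"]
    by (auto simp: card_insert_if split: if_splits)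
  from three_step_choices[OF this] obtain F k where "finite F" "card F \<le> 1"
    "\<forall>t. two {a \<in> L u. a \<noteq> t \<and> (\<exists>b\<in>L x - {\<phi> z}. b \<noteq> t \<and> b \<noteq> a \<and>
        (\<exists>d\<in>L y - {\<phi> z, c z}. d \<noteq> a \<and> d \<noteq> b))} \<or>
      (t \<in> F \<and> k \<in> {a \<in> L u. a \<noteq> t \<and> (\<exists>b\<in>L x - {\<phi> z}. b \<noteq> t \<and> b \<noteq> a \<and>
        (\<exists>d\<in>L y - {\<phi> z, c z}. d \<noteq> a \<and> d \<noteq> b))})"
    by blast
  then show ?thesis
    using two_mono[OF _ thread3_opt[OF assms]] thread3_opt[OF assms] unfolding free_arm_def by blast
qed

text \<open>It suffices that \<open>w1\<close> and \<open>v\<close> have different colors: then one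
  of the two is unique around \<open>h\<close> whatever \<open>w2\<close> gets. This can fail only
  if \<open>v\<close> has the fallback color \<open>k\<close> of the arm \<open>w1\<close> and the
  color of \<open>h\<close> is in \<open>F\<close>. Of the four colors of \<open>h\<close>, at least
  two remain when \<open>v\<close> avoids \<open>k\<close>, and at least one otherwise.
  \<open>B\<close> holds the colors of \<open>h\<close> for which the second arm may be
  stuck.\<close>

lemma deficient_free:
  assumes v: "v \<in> S" "h \<in> S" "N h = {v, w1, w2}" "v \<noteq> w1" "v \<noteq> w2" "w1 \<noteq> w2" "w1 \<in> S" "w2 \<in> S"
    and F: "free_arm h w1 F" and B: "finite B" "\<And>\<beta>. \<beta> \<notin> B \<Longrightarrow> opt h w2 \<beta> \<noteq> {}"
    and few: "card F + card B \<le> 2" "card B \<le> 1"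
  shows "\<exists>F'. card F' \<le> 1 \<and> free_arm v h F'"
proof -
  have cL: "card (L h) = 4" using v S_sub by (auto simp: cardL kap_def)
  obtain k where k: "\<And>t. two (opt h w1 t) \<or> (t \<in> F \<and> k \<in> opt h w1 t)" and finF: "finite F"
    using F unfolding free_arm_def by blast
  have good: "\<beta> \<in> opt v h \<zeta>" if \<beta>: "\<beta> \<in> L h" "\<beta> \<notin> B" "\<beta> \<noteq> \<zeta>" "\<zeta> \<noteq> k \<or> \<beta> \<notin> F" for \<beta> \<zeta>
  proof -
    obtain b where b: "b \<in> opt h w2 \<beta>" using B(2)[OF \<beta>(2)] by blast
    have "\<exists>a\<in>opt h w1 \<beta>. a \<noteq> \<zeta>" using k[of \<beta>] \<beta>(4) unfolding two_def by metis
    then obtain a where a: "a \<in> opt h w1 \<beta>" "a \<noteq> \<zeta>" by blast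
    show ?thesis
    proof (rule opt_compose[where f = "(\<lambda>_. b)(w1 := a)"])
      show "h \<in> N v" using v N_sym[of v h] by simp
      show "((\<lambda>_. b)(w1 := a)) u \<in> opt h u \<beta>" if "u \<in> N h - {v}" for u using that v a b by auto
      show "\<beta> \<noteq> \<phi> u \<and> \<beta> \<noteq> c u" if "u \<in> N h - S" for u using that v by auto
      show "has_unique ((\<lambda>_. b)(w1 := a, v := \<zeta>)) (N h)"
        using v(3-6) a(2) by (auto simp: has_unique_def)
    qed (use v \<beta> in auto)
  qed
  have "two (opt v h \<zeta>)" if "\<zeta> \<noteq> k" for \<zeta>
  proof -
    have "card (B \<union> {\<zeta>}) \<le> 2" using few(2) card_Un_le[of B "{\<zeta>}"] by simp
    then have "2 \<le> card (L h - (B \<union> {\<zeta>}))" using card_Diff_ge[of "B \<union> {\<zeta>}" "L h"] B(1) cL by simp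
    then have "two (L h - (B \<union> {\<zeta>}))" by (rule two_if_card)
    then show ?thesis by (rule two_mono) (use good that in blast)
  qed
  moreover have "opt v h k \<noteq> {}"
  proof -
    have "card (B \<union> {k} \<union> F) \<le> 3"
      using few card_Un_le[of B "{k}"] card_Un_le[of "B \<union> {k}" F] by simp
    then have "1 \<le> card (L h - (B \<union> {k} \<union> F))"
      using card_Diff_ge[of "B \<union> {k} \<union> F" "L h"] B(1) finF cL by simp
    then obtain \<beta> where "\<beta> \<in> L h - (B \<union> {k} \<union> F)" using nonempty_if_card by blast
    then show ?thesis using good[of \<beta> k] by blast
  qed
  ultimately have "free_arm v h {k}" unfolding free_arm_def by (metis ex_in_conv finite.emptyI finite.insertI singletonI)
  then show ?thesis by (intro exI[of _ "{k}"]) simp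
qed

end

section \<open>Vertices with leaves\<close>

definition (in ngraph) leaves :: "'a \<Rightarrow> 'a set" where
  "leaves v = {u \<in> N v. card (N u) = 1}"

lemma (in ngraph) leaf_nbhd: "u \<in> leaves v \<Longrightarrow> N u = {v}"
  using N_sym[of u v] by (auto simp: leaves_def card_1_singleton_iff)

lemma (in ngraph) leaves_sub: "leaves v \<subseteq> N v"
  by (auto simp: leaves_def)

lemma (in ngraph) finite_leaves [simp]: "finite (leaves v)"
  by (simp add: leaves_def)

section \<open>Counting offered colors against forced neighbors of the root\<close>

context deletion
begin

definition allowed :: "'c \<Rightarrow> bool" where
  "allowed t \<longleftrightarrow> t \<in> L r \<and> (\<forall>u\<in>N r - S. t \<noteq> \<phi> u \<and> t \<noteq> c u) \<and> (\<forall>u\<in>N r. opt r u t \<noteq> {})"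

definition forced :: "'c \<Rightarrow> 'a set" where
  "forced t = {u \<in> N r. \<exists>x. opt r u t = {x}}"

definition reach :: "'c \<Rightarrow> 'c set" where
  "reach t = (\<Union>u\<in>N r. opt r u t)"

lemma finite_reach: "finite (reach t)"
  unfolding reach_def using finite_opt[OF r_in] by (intro finite_UN_I) simp_all

lemma finite_forced [simp]: "finite (forced t)"
  by (simp add: forced_def)

text \<open>An allowed root color must run into the obstruction of \<open>choose_unique\<close>,
  otherwise the coloring would extend. The reductions at a deleted root are counts violating the
  inequality.\<close>

lemma allowed_fails:
  assumes "allowed t"
  shows "2 * card (reach t) \<le> card (forced t)" and "N r \<noteq> {}"
proof -
  show "2 * card (reach t) \<le> card (forced t)"
  proof (rule ccontr)
    assume "\<not> 2 * card (reach t) \<le> card (forced t)"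
    then have "card (forced t) < 2 * card (reach t)" by simp
    then obtain f where "\<forall>u\<in>N r. f u \<in> opt r u t" "has_unique f (N r)"
      using choose_unique[of "N r" "\<lambda>u. opt r u t"] assms finN
      unfolding forced_def reach_def allowed_def by blast
    then show False using root_contradiction[of t f] assms unfolding allowed_def by blast
  qed
  show "N r \<noteq> {}"
  proof
    assume "N r = {}"
    then show False using root_contradiction[of t undefined] assms by (auto simp: allowed_def)
  qed
qed

lemma two_reach:
  assumes "u \<in> N r" "two (opt r u t)"
  shows "2 \<le> card (reach t)"
proof -
  obtain a b where ab: "a \<in> opt r u t" "b \<in> opt r u t" "a \<noteq> b" using assms(2) by (auto simp: two_def)
  then have "{a, b} \<subseteq> reach t" using assms(1) by (auto simp: reach_def)
  then have "card {a, b} \<le> card (reach t)" by (intro card_mono finite_reach)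
  then show ?thesis using ab by simp
qed

lemma not_forced_two: "two (opt r u t) \<Longrightarrow> u \<notin> forced t"
  by (auto simp: two_def forced_def)

lemma four_forced_if_two:
  assumes "allowed t" "u \<in> N r" "two (opt r u t)"
  shows "4 \<le> card (forced t)"
  using allowed_fails(1)[OF assms(1)] two_reach[OF assms(2,3)] by linarith

lemma leaf_palette:
  assumes "leaves r \<subseteq> S" "u \<in> leaves r"
  shows "L u - {t} \<subseteq> opt r u t" "card (L u) = 2"
    and "u \<in> forced t \<Longrightarrow> t \<in> L u"
proof -
  show *: "L u - {t} \<subseteq> opt r u t"
    using leaf_opt[OF r_in, of u] assms leaf_nbhd by blast
  have "u \<in> V" using assms leaves_sub N_sub by blast
  then show L2: "card (L u) = 2" using assms by (simp add: cardL kap_def leaves_def)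
  show "t \<in> L u" if "u \<in> forced t"
  proof (rule ccontr)
    assume "t \<notin> L u"
    then have "L u \<subseteq> opt r u t" using * by blast
    moreover have "two (L u)" by (rule two_if_card) (simp add: L2)
    ultimately have "two (opt r u t)" using two_mono by blast
    then show False using not_forced_two that by blast
  qed
qed

text \<open>If no leaf list contained \<open>t\<close>, each leaf would keep both its colors: no
  leaf is forced and at least two colors are offered, so four neighbors other than leaves would be
  forced.\<close>

lemma allowed_in_leaf_list:
  assumes "leaves r \<subseteq> S" "leaves r \<noteq> {}" "allowed t" "card (forced t - leaves r) \<le> 3"
  shows "t \<in> (\<Union>u\<in>leaves r. L u)"
proof (rule ccontr)
  assume n: "t \<notin> (\<Union>u\<in>leaves r. L u)"
  obtain u where u: "u \<in> leaves r" using assms(2) by blast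
  have "t \<notin> L u" using n u by blast
  then have "L u \<subseteq> opt r u t" using leaf_palette(1)[OF assms(1) u, of t] by blast
  moreover have "two (L u)" by (rule two_if_card) (simp add: leaf_palette(2)[OF assms(1) u])
  ultimately have "two (opt r u t)" using two_mono by blast
  then have "4 \<le> card (forced t)"
    using four_forced_if_two[OF assms(3), of u] u leaves_sub[of r] by blast
  moreover have "w \<notin> forced t" if "w \<in> leaves r" for w
    using leaf_palette(3)[OF assms(1) that, of t] n that by blast
  then have "forced t - leaves r = forced t" by blast
  ultimately show False using assms(4) by simp
qed

lemma leaf_lists_reach:
  assumes "leaves r \<subseteq> S"
  shows "(\<Union>u\<in>leaves r. L u) - {t} \<subseteq> reach t"
  using leaf_palette(1)[OF assms] leaves_sub unfolding reach_def by blast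

lemma card_forced_le: "card (forced t) \<le> card (forced t - leaves r) + card (leaves r)"
  using card_Diff_ge[of "leaves r" "forced t"] by simp

text \<open>The \<open>l\<close> leaves alone offer all of \<open>C\<close> except \<open>t\<close>,
  at least \<open>l + 1\<close> colors, so \<open>2 (l + 1) <= 3 + l\<close> and
  \<open>l = 1\<close>. A single leaf has a list of two colors, too short to contain the three of
  \<open>C\<close>.\<close>

lemma leafy_root_contradiction:
  assumes lv: "leaves r \<subseteq> S" "leaves r \<noteq> {}" and D: "finite C" "card (leaves r) + 2 \<le> card C"
    and C: "\<And>t. t \<in> C \<Longrightarrow> allowed t \<and> card (forced t - leaves r) \<le> 3"
  shows False
proof -
  let ?G = "\<Union>u\<in>leaves r. L u"
  have CG: "C \<subseteq> ?G" using allowed_in_leaf_list[OF lv] C by blast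
  obtain t where w: "t \<in> C" using D(2) by (metis add_is_0 card.empty ex_in_conv le_zero_eq zero_neq_numeral)
  have "C - {t} \<subseteq> reach t" using CG leaf_lists_reach[OF lv(1)] by blast
  then have "card (C - {t}) \<le> card (reach t)" by (intro card_mono finite_reach)
  then have "card (leaves r) + 1 \<le> card (reach t)" using D w by simp
  moreover have "2 * card (reach t) \<le> 3 + card (leaves r)"
    using allowed_fails(1)[of t] card_forced_le[of t] C[OF w] by linarith
  ultimately have "card (leaves r) \<le> 1" by linarith
  moreover have "card (leaves r) \<noteq> 0" using lv(2) by simp
  ultimately have "card (leaves r) = 1" by linarith
  then obtain u where u: "leaves r = {u}" by (rule card_1_singletonE)
  then have "finite (L u)" using finL N_sub leaves_sub by blast
  then have "card C \<le> card (L u)" using CG u by (intro card_mono) auto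
  then show False using leaf_palette(2)[OF lv(1), of u] u D by simp
qed

text \<open>One color fewer is compensated twice: \<open>\<phi> z\<close> is offered in addition and
  lies outside \<open>C\<close>, and \<open>t\<close> is chosen outside \<open>F\<close>, so at most
  two non-leaves are forced. Then \<open>2 (l + 1) <= 2 + l\<close>, impossible for
  \<open>l > 0\<close> leaves.\<close>

lemma leafy_root_contradiction':
  assumes lv: "leaves r \<subseteq> S" "leaves r \<noteq> {}" and D: "finite C" "card (leaves r) + 1 \<le> card C"
    and C: "\<And>t. t \<in> C \<Longrightarrow> allowed t \<and> card (forced t - leaves r) \<le> 3"
    and F: "card F \<le> 1" "finite F" "\<And>t. t \<in> C - F \<Longrightarrow> card (forced t - leaves r) \<le> 2"
    and z: "z \<in> N r - S"
  shows False
proof -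
  let ?G = "\<Union>u\<in>leaves r. L u"
  have CG: "C \<subseteq> ?G" using allowed_in_leaf_list[OF lv] C by blast
  have l1: "card (leaves r) \<noteq> 0" using lv(2) by simp
  have "1 \<le> card (C - F)" using card_Diff_ge[OF F(2), of C] D F(1) l1 by linarith
  then obtain t where w: "t \<in> C" "t \<notin> F" using nonempty_if_card by blast
  have "\<phi> z \<notin> C" using C z by (auto simp: allowed_def)
  have "\<phi> z \<in> reach t" using z opt_outside[of z r] r_in N_sub by (auto simp: reach_def)
  then have "insert (\<phi> z) (C - {t}) \<subseteq> reach t" using CG leaf_lists_reach[OF lv(1)] by blast
  then have "card (insert (\<phi> z) (C - {t})) \<le> card (reach t)" by (intro card_mono finite_reach)
  moreover have "card (insert (\<phi> z) (C - {t})) = card C" 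
    using D w \<open>\<phi> z \<notin> C\<close> by (simp add: card_Suc_Diff1)
  ultimately have "card (leaves r) + 1 \<le> card (reach t)" using D by simp
  moreover have "2 * card (reach t) \<le> 2 + card (leaves r)"
    using allowed_fails(1)[of t] card_forced_le[of t] C[OF w(1)] F(3)[of t] w by fastforce
  ultimately show False using l1 by linarith
qed

lemma small_core_contradiction:
  assumes S: "S = insert r (leaves r)" and ne: "leaves r \<noteq> {}"
    and core: "card (N r - leaves r) \<le> 3" "2 * card (N r - leaves r) < card (L r)"
    and big: "card (N r) + 2 * card (N r - leaves r) + 2 < 2 * card (L r)"
  shows False
proof -
  let ?K = "N r - leaves r" and ?G = "\<Union>u\<in>leaves r. L u"
  have lv: "leaves r \<subseteq> S" using S by blast
  have K: "N r - S = ?K" using S N_irr by blast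
  have cN: "card (N r) = card (leaves r) + card ?K"
    using leaves_sub[of r] by (simp add: card_Diff_subset card_mono)
  define C where "C = L r - (\<phi> ` ?K \<union> c ` ?K)"
  have "card (\<phi> ` ?K \<union> c ` ?K) \<le> 2 * card ?K"
    using card_Un_le[of "\<phi> ` ?K" "c ` ?K"] card_image_le[of ?K \<phi>] card_image_le[of ?K c] by simp
  then have "1 \<le> card C"
    using card_Diff_ge[of "\<phi> ` ?K \<union> c ` ?K" "L r"] core(2) unfolding C_def by simp
  then obtain t where w: "t \<in> C" using nonempty_if_card by blast
  have al: "allowed t'" if "t' \<in> C" for t'
    unfolding allowed_def
  proof (intro conjI ballI)
    show "t' \<in> L r" using that by (simp add: C_def)
    show "t' \<noteq> \<phi> u" "t' \<noteq> c u" if "u \<in> N r - S" for u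
      using that \<open>t' \<in> C\<close> unfolding K C_def by blast+
    show "opt r u t' \<noteq> {}" if u: "u \<in> N r" for u
    proof (cases "u \<in> leaves r")
      case True
      have "1 \<le> card (L u - {t'})"
        using card_Diff1_ge[of "L u" t'] leaf_palette(2)[OF lv True] by simp
      then show ?thesis using leaf_palette(1)[OF lv True] nonempty_if_card by blast
    next
      case False
      then have "u \<notin> S" using K u by blast
      then show ?thesis using opt_outside[of u r t'] u N_sub r_in by blast
    qed
  qed
  have fK: "forced t' - leaves r \<subseteq> ?K" for t' by (auto simp: forced_def)
  then have fK3: "card (forced t' - leaves r) \<le> card ?K" for t' by (intro card_mono) auto
  then have "C \<subseteq> ?G" using allowed_in_leaf_list[OF lv ne al] core(1) order_trans by blast
  then have "C - {t} \<subseteq> reach t" using leaf_lists_reach[OF lv] by blast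
  moreover have "\<phi> ` ?K \<subseteq> reach t"
    using opt_outside[of _ r t] r_in N_sub K by (fastforce simp: reach_def)
  \<comment> \<open>The colors \<open>\<phi>\<close> of the core are forbidden for the root but do
    occur around it, so only \<open>c\<close> of the core and \<open>t\<close> may be lost from
    \<open>L r\<close>.\<close>
  ultimately have "L r - (c ` ?K \<union> {t}) \<subseteq> reach t" unfolding C_def by blast
  then have "card (L r - (c ` ?K \<union> {t})) \<le> card (reach t)" by (intro card_mono finite_reach)
  moreover have "card (L r) \<le> card (c ` ?K \<union> {t}) + card (L r - (c ` ?K \<union> {t}))"
    by (intro card_Diff_ge) simp
  moreover have "card (c ` ?K \<union> {t}) \<le> card ?K + 1"
    using card_Un_le[of "c ` ?K" "{t}"] card_image_le[of ?K c] by simp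
  ultimately have "card (L r) \<le> card ?K + 1 + card (reach t)" by linarith
  moreover have "2 * card (reach t) \<le> card (leaves r) + card ?K"
    using allowed_fails(1)[OF al[OF w]] card_forced_le[of t] fK3[of t] by linarith
  ultimately show False using big cN by linarith
qed

lemma plain_root_contradiction:
  assumes "allowed t" "u \<in> N r" "two (opt r u t)" "card (N r) \<le> 3"
  shows False
proof -
  have "card (forced t) \<le> card (N r)" by (intro card_mono) (auto simp: forced_def)
  then show False using four_forced_if_two[OF assms(1-3)] assms(4) by linarith
qed

text \<open>With at most three forced neighbors only one color is offered, and it must be the
  fallback \<open>k\<close> of the free arm. Then \<open>W\<close> is contained in both
  \<open>{t, k}\<close> and \<open>{t', k}\<close>, hence in \<open>{k}\<close>.\<close>

lemma root211_contradiction: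
  assumes "card (N r) \<le> 3" "allowed t" "allowed t'" "t \<noteq> t'"
    and u: "u \<in> N r" "free_arm r u F"
    and w: "w \<in> N r" "2 \<le> card W" "W - {t} \<subseteq> opt r w t" "W - {t'} \<subseteq> opt r w t'"
  shows False
proof -
  obtain k where k: "\<And>t. two (opt r u t) \<or> k \<in> opt r u t"
    using u(2) by (auto simp: free_arm_def)
  have *: "W \<subseteq> {x, k} \<and> k \<noteq> x" if x: "allowed x" "W - {x} \<subseteq> opt r w x" for x
  proof -
    have "card (forced x) \<le> card (N r)" by (intro card_mono) (auto simp: forced_def)
    then have c1: "card (reach x) \<le> 1" using allowed_fails(1)[OF x(1)] assms(1) by linarith
    then have "\<not> two (opt r u x)" using two_reach[OF u(1)] by fastforce
    then have "k \<in> opt r u x" using k by blast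
    then have kr: "k \<in> reach x" using u(1) by (auto simp: reach_def)
    have "reach x \<subseteq> {k}" using c1 kr finite_reach card_le_Suc0_iff_eq[of "reach x"] by auto
    then have "opt r w x \<subseteq> {k}" using w(1) by (auto simp: reach_def)
    then have W: "W \<subseteq> {x, k}" using x(2) by blast
    have "card W \<le> card {x, k}" using W by (intro card_mono) auto
    then have "k \<noteq> x" using w(2) by auto
    then show ?thesis using W by blast
  qed
  have W1: "W \<subseteq> {t, k}" "W \<subseteq> {t', k}" using *[OF assms(2) w(3)] *[OF assms(3) w(4)] by auto
  then have "W \<subseteq> {k}" using assms(4) by blast
  then have "card W \<le> 1" using card_mono[of "{k}" W] by simp
  then show False using w(2) by simp
qed

end

context minimal_counterexample
begin

lemma tree_set_star: "v \<in> V \<Longrightarrow> tree_set v (insert v (leaves v))"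
proof -
  assume v: "v \<in> V"
  have "(v, u) \<in> adj (insert v (leaves v)) ^^ 1" if "u \<in> leaves v" for u
    using that leaves_sub by (auto simp: adj_def)
  moreover have "(v, v) \<in> adj (insert v (leaves v)) ^^ 0" by simp
  ultimately have "\<exists>n\<le>4. (v, x) \<in> adj (insert v (leaves v)) ^^ n" if "x \<in> insert v (leaves v)" for x
    using that by (metis insertE one_le_numeral zero_le)
  then show ?thesis using v leaves_sub N_sub unfolding tree_set_def by blast
qed

lemma nbhd_nonempty:
  assumes "v \<in> V"
  shows "N v \<noteq> {}"
proof
  assume e: "N v = {}"
  then have "leaves v = {}" by (simp add: leaves_def)
  then have "tree_set v {v}" using tree_set_star[OF assms] by simp
  then obtain \<phi> c where "deletion V N L v {v} \<phi> c" by (rule deletion_exists)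
  then interpret deletion V N L v "{v}" \<phi> c .
  have "card (L v) = 1" using assms e by (simp add: cardL kap_def)
  then obtain t where "t \<in> L v" by (metis card_1_singletonE singletonI)
  then have "allowed t" using e by (simp add: allowed_def)
  then show False using allowed_fails(2) e by blast
qed

text \<open>For \<open>k\<close> core neighbors and \<open>l\<close> leaves the last hypothesis of
  \<open>small_core_contradiction\<close> amounts to \<open>k < l\<close>, unless the degree is 2,
  where the longer list helps. So it holds for \<open>k <= 1\<close> whenever there are leaves, and
  for \<open>k = 2\<close> with at least three leaves.\<close>

lemma core_ge_2:
  assumes "v \<in> V" "leaves v \<noteq> {}"
  shows "2 \<le> card (N v - leaves v)" and "card (N v - leaves v) = 2 \<Longrightarrow> card (leaves v) \<le> 2"
proof -
  obtain \<phi> c where "deletion V N L v (insert v (leaves v)) \<phi> c"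
    by (rule deletion_exists[OF tree_set_star[OF assms(1)]])
  then interpret deletion V N L v "insert v (leaves v)" \<phi> c .
  have l: "card (leaves v) \<noteq> 0" using assms by simp
  have cN: "card (N v) = card (leaves v) + card (N v - leaves v)"
    using leaves_sub[of v] by (simp add: card_Diff_subset card_mono)
  have cl: "card (N v) = 2 \<and> card (L v) = 4 \<or> card (N v) \<noteq> 2 \<and> card (L v) = card (N v) + 1"
    using assms cardL by (simp add: kap_def)
  show "2 \<le> card (N v - leaves v)"
  proof (rule ccontr)
    assume "\<not> 2 \<le> card (N v - leaves v)"
    then have "card (N v - leaves v) \<le> 3" "2 * card (N v - leaves v) < card (L v)"
      "card (N v) + 2 * card (N v - leaves v) + 2 < 2 * card (L v)"
      using cN cl l by arith+
    then show False by (rule small_core_contradiction[OF refl assms(2)])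
  qed
  show "card (leaves v) \<le> 2" if "card (N v - leaves v) = 2"
  proof (rule ccontr)
    assume "\<not> card (leaves v) \<le> 2"
    then have "card (N v - leaves v) \<le> 3" "2 * card (N v - leaves v) < card (L v)"
      "card (N v) + 2 * card (N v - leaves v) + 2 < 2 * card (L v)"
      using cN cl that by arith+
    then show False by (rule small_core_contradiction[OF refl assms(2)])
  qed
qed

end

context minimal_counterexample
begin

text \<open>Here only the leaves are deleted; with two leaves, the color that could force them to take
  both colors of the core neighbors is removed from the list of \<open>v\<close> beforehand.\<close>

lemma core_two_leafless:
  assumes v: "v \<in> V" and core: "card (N v - leaves v) = 2"
  shows "leaves v = {}"
proof (rule ccontr)
  assume ne: "leaves v \<noteq> {}"
  let ?S = "leaves v"
  have l: "card ?S \<le> 2" "1 \<le> card ?S" using core_ge_2(2)[OF v ne core] ne by (simp_all add: Suc_le_eq card_gt_0_iff)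
  obtain w1 w2 where w: "N v - ?S = {w1, w2}" "w1 \<noteq> w2" using core by (meson card_2_iff)
  have SV: "?S \<subseteq> V" using leaves_sub N_sub by blast
  have L2: "card (L u) = 2" if "u \<in> ?S" for u
    using that SV cardL[of u] by (auto simp: leaves_def kap_def)
  have finLu: "finite (L u)" if "u \<in> ?S" for u using that SV finL by blast
  have vS: "v \<notin> ?S" using leaves_sub[of v] N_irr by blast
  have Nx: "N x \<inter> ?S = {}" if "x \<noteq> v" for x
    using that leaf_nbhd[of _ v] N_sym by blast
  \<comment> \<open>A color of \<open>v\<close> outside \<open>R\<close> never lies in two different
    leaf lists, so it cannot force two leaves to different colors.\<close>
  define R where "R = {\<beta>. \<exists>u\<in>?S. \<exists>u'\<in>?S. L u \<noteq> L u' \<and> \<beta> \<in> L u \<and> \<beta> \<in> L u'}"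
  have R: "finite R \<and> card R + 1 \<le> card ?S"
  proof (cases "card ?S = 1")
    case True
    then obtain u where "?S = {u}" by (rule card_1_singletonE)
    then have "R = {}" by (auto simp: R_def)
    then show ?thesis using l by simp
  next
    case False
    then have "card ?S = 2" using l by linarith
    then obtain u u' where u: "?S = {u, u'}" "u \<noteq> u'" by (meson card_2_iff)
    show ?thesis
    proof (cases "L u = L u'")
      case True
      then have "R = {}" using u by (auto simp: R_def)
      then show ?thesis using l by simp
    next
      case False
      have "R \<subseteq> L u \<inter> L u'" using u by (auto simp: R_def)
      moreover have "card (L u \<inter> L u') \<noteq> 2"
      proof
        assume c: "card (L u \<inter> L u') = 2"
        have "L u \<inter> L u' = L u" by (rule card_subset_eq) (use c L2 u finLu in simp_all)
        moreover have "L u \<inter> L u' = L u'" by (rule card_subset_eq) (use c L2 u finLu in simp_all)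
        ultimately show False using False by blast
      qed
      moreover have "card (L u \<inter> L u') \<le> card (L u)" using finLu u by (intro card_mono) auto
      ultimately have "card (L u \<inter> L u') \<le> 1" using L2[of u] u by simp
      moreover have "finite (L u \<inter> L u')" using finLu u by simp
      ultimately show ?thesis
        using card_mono[of "L u \<inter> L u'" R] finite_subset[of R "L u \<inter> L u'"] \<open>R \<subseteq> _\<close> \<open>card ?S = 2\<close>
        by linarith
    qed
  qed
  define L' where "L' x = (if x = v then L v - R else L x)" for x
  have cN: "card (N v) = card ?S + 2"
    using leaves_sub[of v] core by (simp add: card_Diff_subset card_mono)
  have "finite (L' x) \<and> kap (card (N x - ?S)) \<le> card (L' x)" if x: "x \<in> V - ?S" for x
  proof (cases "x = v")
    case True
    have "card (L v) = card ?S + 3" using cardL[OF v] cN ne by (simp add: kap_def)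
    \<comment> \<open>Without its leaves \<open>v\<close> has degree 2 and needs 4 colors. With
      \<open>l\<close> leaves it has \<open>l + 3\<close>, and \<open>R\<close> takes at most
      \<open>l - 1\<close>.\<close>
    then have "4 \<le> card (L v - R)" using card_Diff_ge[of R "L v"] R by linarith
    then show ?thesis using True core finL v by (simp add: L'_def kap_def)
  next
    case False
    then show ?thesis using x finL cardL kap_mono[of "card (N x - ?S)" "card (N x)"]
      by (auto simp: L'_def card_mono)
  qed
  then obtain \<phi> where \<phi>: "pcf (V - ?S) L' \<phi>" using smaller[OF SV ne] by blast
  have NK: "N v \<inter> (V - ?S) = {w1, w2}" using w N_sub by blast
  have "has_unique \<phi> {w1, w2}" and adj_v: "\<phi> w1 \<noteq> \<phi> v" "\<phi> w2 \<noteq> \<phi> v" and \<beta>: "\<phi> v \<in> L v" "\<phi> v \<notin> R"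
  proof -
    have "v \<in> V - ?S" using v vS by blast
    then have "\<phi> v \<in> L' v \<and> (\<forall>y\<in>N v \<inter> (V - ?S). \<phi> y \<noteq> \<phi> v) \<and>
        (N v \<inter> (V - ?S) \<noteq> {} \<longrightarrow> has_unique \<phi> (N v \<inter> (V - ?S)))"
      using \<phi> unfolding pcf_def by blast
    then show "has_unique \<phi> {w1, w2}" "\<phi> w1 \<noteq> \<phi> v" "\<phi> w2 \<noteq> \<phi> v" "\<phi> v \<in> L v" "\<phi> v \<notin> R"
      unfolding NK L'_def by auto
  qed
  then have w12: "\<phi> w1 \<noteq> \<phi> w2" using w(2) by (auto simp: has_unique_def)
  define Q where "Q u = (if u \<in> ?S then L u - {\<phi> v} else {\<phi> u})" for u
  have Qne: "Q u \<noteq> {}" for u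
    using card_Diff1_ge[of "L u" "\<phi> v"] L2[of u] nonempty_if_card[of "L u - {\<phi> v}"] by (auto simp: Q_def)
  have Nv: "u \<in> N v \<longleftrightarrow> u \<in> ?S \<or> u = w1 \<or> u = w2" for u using w leaves_sub[of v] by blast
  have wS: "w1 \<notin> ?S" "w2 \<notin> ?S" using w by auto
  \<comment> \<open>The colors of \<open>w1\<close> and \<open>w2\<close> differ, since these are
    the only neighbors of \<open>v\<close> in the smaller graph. One of the two colors is forced on
    no leaf and serves as the unique one.\<close>
  have "\<exists>f. (\<forall>u\<in>N v. f u \<in> Q u) \<and> has_unique f (N v)"
  proof (cases "\<exists>u\<in>?S. Q u = {\<phi> w1}")
    case False
    show ?thesis
    proof (rule choose_unique_at[of w1 "N v" "\<phi> w1"])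
      show "Q u \<noteq> {\<phi> w1}" if "u \<in> N v" "u \<noteq> w1" for u
        using that Nv False wS w12 by (auto simp: Q_def)
    qed (use Nv wS Qne in \<open>auto simp: Q_def\<close>)
  next
    case True
    then obtain u where u: "u \<in> ?S" "Q u = {\<phi> w1}" by blast
    have inL: "\<phi> v \<in> L u" if "u \<in> ?S" "Q u = {k}" for u k
    proof (rule ccontr)
      assume "\<phi> v \<notin> L u"
      then have "L u = {k}" using that by (simp add: Q_def)
      then show False using L2[OF that(1)] by simp
    qed
    have no2: "Q u' \<noteq> {\<phi> w2}" if u': "u' \<in> ?S" for u'
    proof
      assume q: "Q u' = {\<phi> w2}"
      have "L u \<noteq> L u'" using u q u' w12 by (auto simp: Q_def)
      then have "\<phi> v \<in> R" using inL[OF u] inL[OF u' q] u u' by (auto simp: R_def)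
      then show False using \<beta> by blast
    qed
    show ?thesis
    proof (rule choose_unique_at[of w2 "N v" "\<phi> w2"])
      show "Q u \<noteq> {\<phi> w2}" if "u \<in> N v" "u \<noteq> w2" for u
        using that Nv no2 wS w12 by (auto simp: Q_def)
    qed (use Nv wS Qne in \<open>auto simp: Q_def\<close>)
  qed
  then obtain f where f: "\<And>u. u \<in> N v \<Longrightarrow> f u \<in> Q u" and uf: "has_unique f (N v)" by blast
  define g where "g x = (if x \<in> ?S then f x else \<phi> x)" for x
  have fS: "g u \<in> L u" "g u \<noteq> \<phi> v" if "u \<in> ?S" for u
    using f[of u] that leaves_sub[of v] by (auto simp: g_def Q_def)
  have psiN: "g u = f u" if "u \<in> N v" for u
    using f[OF that] by (auto simp: g_def Q_def split: if_splits)
  have psiv: "g v = \<phi> v" using vS by (simp add: g_def)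
  have "pcf V L g"
    unfolding pcf_def
  proof
    have NV: "N x \<inter> V = N x" for x using N_sub by blast
    fix x assume x: "x \<in> V"
    show "g x \<in> L x \<and> (\<forall>y\<in>N x \<inter> V. g y \<noteq> g x) \<and> (N x \<inter> V \<noteq> {} \<longrightarrow> has_unique g (N x \<inter> V))"
      unfolding NV
    proof (cases "x \<in> ?S")
      case True
      then have "N x = {v}" by (rule leaf_nbhd)
      then show "g x \<in> L x \<and> (\<forall>y\<in>N x. g y \<noteq> g x) \<and> (N x \<noteq> {} \<longrightarrow> has_unique g (N x))"
        using fS[OF True] psiv by (auto simp: has_unique_def)
    next
      case xS: False
      show "g x \<in> L x \<and> (\<forall>y\<in>N x. g y \<noteq> g x) \<and> (N x \<noteq> {} \<longrightarrow> has_unique g (N x))"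
      proof (cases "x = v")
        case True
        have "g y \<noteq> \<phi> v" if "y \<in> N v" for y
          using that Nv fS wS adj_v by (auto simp: g_def)
        moreover have "has_unique g (N v)" using uf has_unique_cong[of "N v" g f] psiN by blast
        ultimately show ?thesis using True psiv \<beta> by simp
      next
        case False
        have "N x \<inter> (V - ?S) = N x" using Nx[OF False] N_sub by blast
        then have "\<phi> x \<in> L x \<and> (\<forall>y\<in>N x. \<phi> y \<noteq> \<phi> x) \<and> (N x \<noteq> {} \<longrightarrow> has_unique \<phi> (N x))"
        proof -
          have "x \<in> V - ?S" using x xS by blast
          then have "\<phi> x \<in> L' x \<and> (\<forall>y\<in>N x \<inter> (V - ?S). \<phi> y \<noteq> \<phi> x) \<and>
              (N x \<inter> (V - ?S) \<noteq> {} \<longrightarrow> has_unique \<phi> (N x \<inter> (V - ?S)))"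
            using \<phi> unfolding pcf_def by blast
          then show ?thesis using False unfolding \<open>N x \<inter> (V - ?S) = N x\<close> L'_def by simp
        qed
        moreover have "g y = \<phi> y" if "y \<in> N x" for y using that Nx[OF False] by (auto simp: g_def)
        moreover have "g x = \<phi> x" using xS by (simp add: g_def)
        ultimately show ?thesis using has_unique_cong[of "N x" g \<phi>] by simp
      qed
    qed
  qed
  then show False using not_colorable by blast
qed

lemma two_leafless: "v \<in> V \<Longrightarrow> card (N v) = 2 \<Longrightarrow> leaves v = {}"
proof (rule ccontr)
  assume v: "v \<in> V" "card (N v) = 2" "leaves v \<noteq> {}"
  have "card (N v - leaves v) < card (N v)"
    using v(3) leaves_sub[of v] by (intro psubset_card_mono) auto
  then show False using core_ge_2(1)[OF v(1,3)] v(2) by simp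
qed

lemma core_ge_3: "v \<in> V \<Longrightarrow> 3 \<le> card (N v) \<Longrightarrow> 3 \<le> card (N v - leaves v)"
proof (cases "leaves v = {}")
  case False
  assume "v \<in> V"
  then have "2 \<le> card (N v - leaves v)" "card (N v - leaves v) \<noteq> 2"
    using core_ge_2(1) core_two_leafless False by blast+
  then show ?thesis by linarith
qed simp

text \<open>All four are deleted, with root \<open>b\<close>. Leaving out at most two root colors
  for the arm through \<open>c\<close> and \<open>e\<close> and one for \<open>z1\<close>, a fourth
  color remains. It gives \<open>c\<close> two options, which would require four forced neighbors of
  a root of degree 2.\<close>

lemma no_four_thread:
  assumes N: "N a = {z1, b}" "N b = {a, c}" "N c = {b, e}" "N e = {c, z2}"
    and ne: "z1 \<noteq> b" "a \<noteq> c" "b \<noteq> e" "c \<noteq> z2"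
  shows False
proof -
  have ae: "a \<noteq> e"
  proof
    assume "a = e"
    moreover have "a \<noteq> b" "b \<noteq> c" using N N_irr by blast+
    ultimately have "12 \<le> length [a, b, c]"
      using N ne by (intro no_short_cycle) (auto simp: less_Suc_eq)
    then show False by simp
  qed
  have d: "a \<noteq> b" "b \<noteq> c" "c \<noteq> e" "z1 \<noteq> a" "z2 \<noteq> e" using N N_irr by blast+
  have no4: "a \<notin> N e"
  proof
    assume "a \<in> N e"
    then have "12 \<le> length [a, b, c, e]"
      using N ne d ae by (intro no_short_cycle) (auto simp: less_Suc_eq)
    then show False by simp
  qed
  let ?S = "{a, b, c, e}"
  have z1: "z1 \<notin> ?S"
    using d ne ae no4 N N_sym[of z1 a] by auto
  have z2: "z2 \<notin> ?S"
    using d ne ae no4 N N_sym[of z2 e] by auto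
  have SV: "?S \<subseteq> V" using N N_sub[of b] N_sub[of c] by auto
  have steps: "(b, a) \<in> adj ?S ^^ 1" "(b, c) \<in> adj ?S ^^ 1" "(b, b) \<in> adj ?S ^^ 0"
    using N by (auto simp: adj_def)
  have step2: "(b, e) \<in> adj ?S ^^ Suc 1"
    using steps(2) by (rule relpow_Suc_I) (use N in \<open>auto simp: adj_def\<close>)
  have "\<exists>n\<le>4. (b, x) \<in> adj ?S ^^ n" if x: "x \<in> ?S" for x
  proof -
    consider "x = a" | "x = b" | "x = c" | "x = e" using x by blast
    then show ?thesis
    proof cases
      case 1
      then show ?thesis using steps(1) by (intro exI[of _ 1]) simp
    next
      case 2
      then show ?thesis by (intro exI[of _ 0]) simp
    next
      case 3
      then show ?thesis using steps(2) by (intro exI[of _ 1]) simp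
    next
      case 4
      then show ?thesis using step2 by (intro exI[of _ "Suc 1"]) simp
    qed
  qed
  then have "tree_set b ?S" using SV by (auto simp: tree_set_def)
  then obtain \<phi> k where "deletion V N L b ?S \<phi> k" by (rule deletion_exists)
  then interpret deletion V N L b ?S \<phi> k .
  obtain F where F: "card F \<le> 2" "free_arm b c F"
    using thread2_free[of b c e z2] N ne d z2 by auto
  have c2: "card (N a) = 2" "card (N b) = 2" using N ne by auto
  have L4: "card (L a) = 4" "card (L b) = 4" using card_L2 c2 SV by auto
  have "card (insert (\<phi> z1) F) \<le> 3" using F(1) card_insert_le_m1[of 3 F "\<phi> z1"] by simp
  moreover have "finite F" using F(2) by (simp add: free_arm_def)
  ultimately have "1 \<le> card (L b - insert (\<phi> z1) F)"
    using card_Diff_ge[of "insert (\<phi> z1) F" "L b"] L4 by simp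
  then obtain t where w: "t \<in> L b" "t \<noteq> \<phi> z1" "t \<notin> F" using nonempty_if_card by blast
  have "1 \<le> card (L a - {\<phi> z1, k z1, t})"
    using card_Diff_ge[of "{\<phi> z1, k z1, t}" "L a"] L4 by (auto simp: card_insert_if split: if_splits)
  moreover have "L a - {\<phi> z1, k z1, t} \<subseteq> opt b a t"
    using thread1_opt[of b a z1 t] N z1 w ne by (auto simp: insert_commute)
  ultimately have "opt b a t \<noteq> {}" using nonempty_if_card by blast
  then have "allowed t"
    unfolding allowed_def using w N free_arm_nonempty[OF F(2)] by auto
  then show False
    using plain_root_contradiction[of t c] free_arm_two[OF F(2) w(3)] N c2 by simp
qed

end

section \<open>Clusters\<close>

context minimal_counterexample
begin

definition other :: "'a \<Rightarrow> 'a \<Rightarrow> 'a" where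
  "other u w = (THE x. x \<in> N u \<and> x \<noteq> w)"

lemma nbhd_other:
  assumes "card (N u) = 2" "w \<in> N u"
  shows "N u = {w, other u w}" "w \<noteq> other u w"
proof -
  obtain x where x: "N u = {w, x}" "w \<noteq> x"
    using assms by (metis card_2_iff doubleton_eq_iff insertE singletonD)
  then have "other u w = x" unfolding other_def by (intro the_equality) auto
  then show "N u = {w, other u w}" "w \<noteq> other u w" using x by auto
qed

lemma other_eq: "\<lbrakk>N u = {w, x}; w \<noteq> x\<rbrakk> \<Longrightarrow> other u w = x"
  unfolding other_def by (intro the_equality) auto

text \<open>Looking three steps ahead is enough, as four consecutive vertices of degree 2 are excluded.\<close>

definition thread :: "'a \<Rightarrow> 'a \<Rightarrow> 'a list" where
  "thread v w = (if card (N w) \<noteq> 2 then [] else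
     if card (N (other w v)) \<noteq> 2 then [w] else
     if card (N (other (other w v) w)) \<noteq> 2 then [w, other w v]
     else [w, other w v, other (other w v) w])"

lemma big_beside_two:
  assumes "card (N u) = 2" "x \<in> N u" "card (N x) \<noteq> 2"
  shows "3 \<le> card (N x)"
proof -
  have V: "u \<in> V" "x \<in> V" using assms(2) N_sym N_sub by blast+
  have "x \<notin> leaves u" using two_leafless[OF V(1) assms(1)] by simp
  then have "card (N x) \<noteq> 1" using assms(2) by (simp add: leaves_def)
  moreover have "card (N x) \<noteq> 0" using nbhd_nonempty[OF V(2)] by simp
  ultimately show ?thesis using assms(3) by linarith
qed

lemma thread_cases [consumes 1]:
  assumes "w \<in> N v"
  obtains (none) "card (N w) \<noteq> 2" "thread v w = []"
  | (one) x where "N w = {v, x}" "v \<noteq> x" "3 \<le> card (N x)" "thread v w = [w]"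
  | (two) x y where "N w = {v, x}" "v \<noteq> x" "N x = {w, y}" "w \<noteq> y" "3 \<le> card (N y)" "thread v w = [w, x]"
  | (three) x y z where "N w = {v, x}" "v \<noteq> x" "N x = {w, y}" "w \<noteq> y" "N y = {x, z}" "x \<noteq> z"
      "3 \<le> card (N z)" "thread v w = [w, x, y]"
proof (cases "card (N w) = 2")
  case False
  then show ?thesis using none by (simp add: thread_def)
next
  case w2: True
  define x where "x = other w v"
  have Nw: "N w = {v, x}" "v \<noteq> x" using nbhd_other[OF w2 N_sym[OF assms]] by (simp_all add: x_def)
  show ?thesis
  proof (cases "card (N x) = 2")
    case False
    then show ?thesis using one[of x] Nw w2 big_beside_two[of w x] by (simp add: thread_def x_def)
  next
    case x2: True
    define y where "y = other x w"
    have Nx: "N x = {w, y}" "w \<noteq> y"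
      using nbhd_other[OF x2 N_sym[of x w]] Nw by (simp_all add: y_def)
    show ?thesis
    proof (cases "card (N y) = 2")
      case False
      then show ?thesis using two[of x y] Nw Nx w2 x2 big_beside_two[of x y]
        by (simp add: thread_def x_def y_def)
    next
      case y2: True
      define z where "z = other y x"
      have Ny: "N y = {x, z}" "x \<noteq> z"
        using nbhd_other[OF y2 N_sym[of y x]] Nx by (simp_all add: z_def)
      have "card (N z) \<noteq> 2"
      proof
        assume z2: "card (N z) = 2"
        have "N z = {y, other z y}" "y \<noteq> other z y"
          using nbhd_other[OF z2 N_sym[of z y]] Ny by simp_all
        then show False using no_four_thread[OF Nw(1) Nx(1) Ny(1)] Nw Nx Ny by blast
      qed
      then show ?thesis using three[of x y z] Nw Nx Ny w2 x2 y2 big_beside_two[of y z]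
        by (simp add: thread_def x_def y_def)
    qed
  qed
qed

definition arms :: "nat \<Rightarrow> 'a \<Rightarrow> 'a set" where
  "arms i v = {w \<in> N v. length (thread v w) = i}"

definition big_nbrs :: "'a \<Rightarrow> 'a set" where
  "big_nbrs v = {w \<in> N v. 3 \<le> card (N w)}"

text \<open>The charge \<open>5 * 3 - 12 = 3\<close> is one short of the demand 4 of two threads
  with lengths 2 and 2 or 3 and 1. These are the shapes which the case analysis in
  \<open>demand_bound\<close> leaves over.\<close>

definition deficient :: "'a \<Rightarrow> bool" where
  "deficient h \<longleftrightarrow> card (N h) = 3 \<and> leaves h = {} \<and> card (big_nbrs h) = 1 \<and>
     (card (arms 2 h) = 2 \<or> card (arms 3 h) = 1 \<and> card (arms 1 h) = 1)"

definition def_nbrs :: "'a \<Rightarrow> 'a set" where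
  "def_nbrs v = {w \<in> N v. deficient w}"

definition star :: "'a \<Rightarrow> 'a set" where
  "star h = insert h (leaves h \<union> (\<Union>w\<in>N h. set (thread h w)))"

definition hubs :: "'a \<Rightarrow> 'a set" where
  "hubs v = insert v (def_nbrs v)"

definition cluster :: "'a \<Rightarrow> 'a set" where
  "cluster v = (\<Union>h\<in>hubs v. star h)"

lemma def_nbrs_big: "def_nbrs v \<subseteq> big_nbrs v"
  by (auto simp: def_nbrs_def big_nbrs_def deficient_def)

lemma card_core:
  assumes "v \<in> V"
  shows "card (N v - leaves v) = card (arms 1 v) + card (arms 2 v) + card (arms 3 v) + card (big_nbrs v)"
proof -
  have fin: "finite (arms i v)" "finite (big_nbrs v)" for i by (simp_all add: arms_def big_nbrs_def)
  have two_iff: "thread v w \<noteq> [] \<longleftrightarrow> card (N w) = 2" for w by (simp add: thread_def)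
  have "N v - leaves v = arms 1 v \<union> arms 2 v \<union> arms 3 v \<union> big_nbrs v"
  proof (intro subset_antisym subsetI)
    fix w assume w: "w \<in> N v - leaves v"
    have "card (N w) \<noteq> 0" using nbhd_nonempty w N_sub by fastforce
    moreover have "card (N w) \<noteq> 1" using w by (simp add: leaves_def)
    ultimately have "card (N w) = 2 \<or> 3 \<le> card (N w)" by linarith
    then show "w \<in> arms 1 v \<union> arms 2 v \<union> arms 3 v \<union> big_nbrs v"
      using w by (auto simp: arms_def big_nbrs_def thread_def)
  next
    fix w assume w: "w \<in> arms 1 v \<union> arms 2 v \<union> arms 3 v \<union> big_nbrs v"
    then have "card (N w) = 2 \<or> 3 \<le> card (N w)"
      by (auto simp: arms_def big_nbrs_def thread_def split: if_splits)
    then show "w \<in> N v - leaves v" using w by (auto simp: arms_def big_nbrs_def leaves_def)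
  qed
  moreover have "(arms 1 v \<union> arms 2 v \<union> arms 3 v) \<inter> big_nbrs v = {}"
    by (auto simp: arms_def big_nbrs_def thread_def split: if_splits)
  moreover have "(arms 1 v \<union> arms 2 v) \<inter> arms 3 v = {}" "arms 1 v \<inter> arms 2 v = {}"
    by (auto simp: arms_def)
  ultimately show ?thesis using fin by (simp add: card_Un_disjoint)
qed

lemma thread_sub:
  assumes "w \<in> N v"
  shows "set (thread v w) \<subseteq> V \<and> (\<forall>x\<in>set (thread v w). card (N x) = 2)"
  using assms
proof (cases rule: thread_cases)
  case (two x y)
  then show ?thesis using assms N_sub[of v] N_sub[of w] by auto
next
  case (three x y z)
  then show ?thesis using assms N_sub[of v] N_sub[of w] N_sub[of x] by auto
qed (use assms N_sub in auto)

lemma star_sub: "v \<in> V \<Longrightarrow> star v \<subseteq> V"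
  using thread_sub N_sub leaves_sub unfolding star_def by blast

lemma hubs_sub: "v \<in> V \<Longrightarrow> hubs v \<subseteq> V"
  using N_sub by (auto simp: hubs_def def_nbrs_def)

lemma cluster_big:
  assumes "3 \<le> card (N v)" "x \<in> cluster v" "3 \<le> card (N x)"
  shows "x \<in> hubs v"
proof -
  obtain h where h: "h \<in> hubs v" "x \<in> star h" using assms(2) by (auto simp: cluster_def)
  then show ?thesis using assms(3) thread_sub[of _ h] by (fastforce simp: star_def leaves_def)
qed

lemma hubs_big: "3 \<le> card (N v) \<Longrightarrow> h \<in> hubs v \<Longrightarrow> 3 \<le> card (N h)"
  by (auto simp: hubs_def def_nbrs_def deficient_def)

lemma star_walk:
  assumes "x \<in> star h"
  shows "\<exists>n\<le>3. (h, x) \<in> adj (star h) ^^ n"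
proof -
  have h0: "h \<in> star h" by (simp add: star_def)
  have nb: "(a, b) \<in> adj (star h)" if "a \<in> star h" "b \<in> star h" "b \<in> N a" for a b
    using that by (simp add: adj_def)
  consider "x = h" | "x \<in> leaves h" | w where "w \<in> N h" "x \<in> set (thread h w)"
    using assms by (auto simp: star_def)
  then show ?thesis
  proof cases
    case 1
    then show ?thesis by (intro exI[of _ 0]) simp
  next
    case 2
    then have "(h, x) \<in> adj (star h)" using nb h0 assms leaves_sub by blast
    then show ?thesis by (intro exI[of _ 1]) simp
  next
    case 3
    have sub: "set (thread h w) \<subseteq> star h" using 3(1) by (auto simp: star_def)
    from 3(1) show ?thesis
    proof (cases rule: thread_cases)
      case none
      then show ?thesis using 3 by simp
    next
      case (one y)
      then have "(h, x) \<in> adj (star h)" using nb[OF h0] 3 sub by auto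
      then show ?thesis by (intro exI[of _ 1]) simp
    next
      case (two y z)
      then have s1: "(h, w) \<in> adj (star h) ^^ 1" and "(w, y) \<in> adj (star h)"
        using nb h0 3(1) sub by auto
      then have s2: "(h, y) \<in> adj (star h) ^^ Suc 1" by (intro relpow_Suc_I)
      have "x = w \<or> x = y" using 3(2) two by simp
      moreover have "1 \<le> (3::nat)" "Suc 1 \<le> 3" by simp_all
      ultimately show ?thesis using s1 s2 by blast
    next
      case (three y z u)
      then have s1: "(h, w) \<in> adj (star h) ^^ 1" and e: "(w, y) \<in> adj (star h)" "(y, z) \<in> adj (star h)"
        using nb h0 3(1) sub by auto
      then have s2: "(h, y) \<in> adj (star h) ^^ Suc 1" by (intro relpow_Suc_I)
      then have s3: "(h, z) \<in> adj (star h) ^^ Suc (Suc 1)" using e(2) by (rule relpow_Suc_I)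
      have "x = w \<or> x = y \<or> x = z" using 3(2) three by simp
      moreover have "1 \<le> (3::nat)" "Suc 1 \<le> 3" "Suc (Suc 1) \<le> 3" by simp_all
      ultimately show ?thesis using s1 s2 s3 by blast
    qed
  qed
qed

lemma tree_set_cluster:
  assumes "v \<in> V"
  shows "tree_set v (cluster v)"
proof -
  have sub: "star h \<subseteq> cluster v" if "h \<in> hubs v" for h using that by (auto simp: cluster_def)
  have hin: "h \<in> cluster v" if "h \<in> hubs v" for h using sub[OF that] by (auto simp: star_def)
  have vin: "v \<in> hubs v" by (simp add: hubs_def)
  have walk: "\<exists>n\<le>4. (v, x) \<in> adj (cluster v) ^^ n" if x: "x \<in> cluster v" for x
  proof -
    obtain h where h: "h \<in> hubs v" "x \<in> star h" using x by (auto simp: cluster_def)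
    obtain n where n: "n \<le> 3" "(h, x) \<in> adj (star h) ^^ n" using star_walk[OF h(2)] by blast
    then have hx: "(h, x) \<in> adj (cluster v) ^^ n" using adj_relpow_mono[OF sub[OF h(1)]] by blast
    show ?thesis
    proof (cases "h = v")
      case True
      then show ?thesis using n hx by (intro exI[of _ n]) simp
    next
      case False
      then have "h \<in> N v" using h by (auto simp: hubs_def def_nbrs_def)
      then have "(v, h) \<in> adj (cluster v)" using hin h(1) vin by (simp add: adj_def)
      then have "(v, x) \<in> adj (cluster v) ^^ Suc n" using hx by (rule relpow_Suc_I2)
      then show ?thesis using n by (intro exI[of _ "Suc n"]) simp
    qed
  qed
  have "cluster v \<subseteq> V" using star_sub hubs_sub[OF assms] unfolding cluster_def by blast
  then show ?thesis using walk hin[OF vin] unfolding tree_set_def by blast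
qed

end

section \<open>Arms of a deleted cluster\<close>

locale cluster_deletion = deletion V N L r S \<phi> c
  for V :: "'a set" and N and L :: "'a \<Rightarrow> 'c set" and r S \<phi> c +
  assumes S_cluster: "S = cluster r" and big: "3 \<le> card (N r)"
begin

lemma hub_in: "h \<in> hubs r \<Longrightarrow> h \<in> S"
  unfolding S_cluster cluster_def star_def by blast

lemma thread_in: "h \<in> hubs r \<Longrightarrow> w \<in> N h \<Longrightarrow> set (thread h w) \<subseteq> S"
  unfolding S_cluster cluster_def star_def by blast

lemma leaves_in: "leaves r \<subseteq> S"
  unfolding S_cluster cluster_def star_def hubs_def by blast

text \<open>Hubs other than \<open>r\<close> are adjacent to \<open>r\<close>, so no vertex of
  degree 2 separates them.\<close>

lemma hubs_connected:
  assumes "h \<in> hubs r" "z \<in> hubs r" "card (N y) = 2"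
  shows "(h, z) \<in> (adj (S - {y}))\<^sup>*"
proof -
  have yh: "y \<notin> hubs r" using hubs_big[OF big, of y] assms(3) by auto
  have "(r, x) \<in> (adj (S - {y}))\<^sup>*" if x: "x \<in> hubs r" for x
  proof (cases "x = r")
    case False
    then have "x \<in> N r" using x by (auto simp: hubs_def def_nbrs_def)
    moreover have "r \<in> hubs r" by (simp add: hubs_def)
    ultimately have "(r, x) \<in> adj (S - {y})" using hub_in x yh by (auto simp: adj_def)
    then show ?thesis by blast
  qed simp
  then show ?thesis using assms sym_adj_rtrancl by (metis rtrancl_trans)
qed

text \<open>A big vertex of \<open>S\<close> is a hub. If the thread ended in one, the two neighbors
  of its last vertex \<open>y\<close> would be connected through the hubs, closing a cycle. Hence
  the far end of a thread has a fixed color.\<close>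

lemma end_outside:
  assumes "h \<in> hubs r" "(p, h) \<in> (adj (S - {y}))\<^sup>*" "p \<in> S" "N y = {p, z}" "p \<noteq> z" "3 \<le> card (N z)"
  shows "z \<notin> S"
proof
  assume z: "z \<in> S"
  then have "z \<in> hubs r" using cluster_big[OF big] assms(6) S_cluster by blast
  then have "(h, z) \<in> (adj (S - {y}))\<^sup>*" using hubs_connected assms by auto
  then have "(p, z) \<in> (adj (S - {y}))\<^sup>*" using assms(2) by (metis rtrancl_trans)
  then show False using tree_set_separated[OF tree assms(3) z assms(5), of y] assms(4) by blast
qed

lemma arm1:
  assumes h: "h \<in> hubs r" and w: "w \<in> arms 1 h"
  shows "\<exists>W k. 2 \<le> card W \<and> (\<forall>t. t \<noteq> k \<longrightarrow> W - {t} \<subseteq> opt h w t)"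
proof -
  have wN: "w \<in> N h" and len: "length (thread h w) = 1" using w by (auto simp: arms_def)
  then obtain x where x: "N w = {h, x}" "h \<noteq> x" "3 \<le> card (N x)" "thread h w = [w]"
    by (cases rule: thread_cases) auto
  have hS: "h \<in> S" "w \<in> S" using hub_in[OF h] thread_in[OF h wN] x by auto
  have xo: "x \<notin> S" using end_outside[OF h _ hS(1) x(1-3)] by blast
  have "card (L w) = 4" using card_L2 x S_sub hS by auto
  then have "2 \<le> card (L w - {\<phi> x, c x})"
    using card_Diff_ge[of "{\<phi> x, c x}" "L w"] by (auto simp: card_insert_if split: if_splits)
  moreover have "L w - {\<phi> x, c x} - {t} \<subseteq> opt h w t" if "t \<noteq> \<phi> x" for t
    using thread1_opt[OF hS x(1,2) xo that] by blast
  \<comment> \<open>The exceptional color is that of the far end, since the two neighbors of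
    \<open>w\<close> must differ.\<close>
  ultimately show ?thesis by (intro exI[of _ "L w - {\<phi> x, c x}"] exI[of _ "\<phi> x"]) blast
qed

lemma arm2:
  assumes h: "h \<in> hubs r" and w: "w \<in> arms 2 h"
  shows "\<exists>F. card F \<le> 2 \<and> free_arm h w F"
proof -
  have wN: "w \<in> N h" and len: "length (thread h w) = 2" using w by (auto simp: arms_def)
  then obtain x y where x: "N w = {h, x}" "h \<noteq> x" "N x = {w, y}" "w \<noteq> y" "3 \<le> card (N y)"
      "thread h w = [w, x]"
    by (cases rule: thread_cases) auto
  have hS: "h \<in> S" "w \<in> S" "x \<in> S" using hub_in[OF h] thread_in[OF h wN] x by auto
  have "w \<noteq> x" using x N_irr by blast
  then have "(w, h) \<in> adj (S - {x})" using hS x by (auto simp: adj_def)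
  then have "y \<notin> S" using end_outside[OF h _ hS(2) x(3-5)] by blast
  then show ?thesis using thread2_free hS x by blast
qed

lemma arm3:
  assumes h: "h \<in> hubs r" and w: "w \<in> arms 3 h"
  shows "\<exists>F. card F \<le> 1 \<and> free_arm h w F"
proof -
  have wN: "w \<in> N h" and len: "length (thread h w) = 3" using w by (auto simp: arms_def)
  then obtain x y z where x: "N w = {h, x}" "h \<noteq> x" "N x = {w, y}" "w \<noteq> y" "N y = {x, z}" "x \<noteq> z"
      "3 \<le> card (N z)" "thread h w = [w, x, y]"
    by (cases rule: thread_cases) auto
  have hS: "h \<in> S" "w \<in> S" "x \<in> S" "y \<in> S" using hub_in[OF h] thread_in[OF h wN] x by auto
  have "card (N y) = 2" using x by simp
  then have ne: "x \<noteq> y" "h \<noteq> y" using x N_irr hubs_big[OF big h] by auto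
  then have "(x, w) \<in> adj (S - {y})" "(w, h) \<in> adj (S - {y})" using hS x by (auto simp: adj_def)
  then have "(x, h) \<in> (adj (S - {y}))\<^sup>*" by (meson r_into_rtrancl rtrancl_trans)
  then have "z \<notin> S" using end_outside[OF h _ hS(3) x(5-7)] by blast
  then show ?thesis using thread3_free hS x by blast
qed

text \<open>For thread lengths 2 and 2 the sets \<open>F\<close> and \<open>B\<close> have sizes at
  most 2 and 0, for lengths 3 and 1 at most 1 and 1; both fit the bound 2 of
  \<open>deficient_free\<close>.\<close>

lemma deficient_arm:
  assumes h: "h \<in> def_nbrs r"
  shows "\<exists>F. card F \<le> 1 \<and> free_arm r h F"
proof -
  have hN: "h \<in> N r" and d: "deficient h" using h by (auto simp: def_nbrs_def)
  have hh: "h \<in> hubs r" using h by (simp add: hubs_def)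
  have hS: "h \<in> S" using hub_in[OF hh] .
  have "r \<in> big_nbrs h" using N_sym[OF hN] big by (simp add: big_nbrs_def)
  then have B: "big_nbrs h = {r}" using d unfolding deficient_def by (metis card_1_singletonE singletonD)
  have cN: "card (N h) = 3" using d by (simp add: deficient_def)
  have arm_not_r: "w \<noteq> r" if "w \<in> arms i h" "i > 0" for w i
    using that big by (auto simp: arms_def thread_def split: if_splits)
  have arm_in: "w \<in> S" if "w \<in> arms i h" "i > 0" for w i
  proof -
    have "w \<in> set (thread h w)" using that by (auto simp: arms_def thread_def split: if_splits)
    then show ?thesis using thread_in[OF hh] that by (auto simp: arms_def)
  qed
  have Nh: "N h = {r, w1, w2}" if w: "w1 \<in> arms i h" "w2 \<in> arms j h" "i > 0" "j > 0" "w1 \<noteq> w2" for w1 w2 i j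
  proof -
    have "{r, w1, w2} \<subseteq> N h" using w N_sym[OF hN] by (auto simp: arms_def)
    moreover have "card {r, w1, w2} = 3" using w arm_not_r by (metis card_3_iff)
    ultimately show ?thesis using cN by (metis card_subset_eq finN)
  qed
  consider "card (arms 2 h) = 2" | "card (arms 3 h) = 1" "card (arms 1 h) = 1"
    using d by (auto simp: deficient_def)
  then show ?thesis
  proof cases
    case 1
    then obtain w1 w2 where "arms 2 h = {w1, w2}" "w1 \<noteq> w2" by (meson card_2_iff)
    then have w: "w1 \<in> arms 2 h" "w2 \<in> arms 2 h" "w1 \<noteq> w2" by auto
    obtain F1 F2 where F: "card F1 \<le> 2" "free_arm h w1 F1" "free_arm h w2 F2"
      using arm2[OF hh] w by blast
    show ?thesis
    proof (rule deficient_free[of r h w1 w2 F1 "{}"])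
      show "N h = {r, w1, w2}" using Nh[OF w(1,2)] w(3) by simp
      show "w1 \<in> S" "w2 \<in> S" using arm_in w by auto
      show "r \<noteq> w1" "r \<noteq> w2" using arm_not_r[OF w(1)] arm_not_r[OF w(2)] by auto
    qed (use w hS r_in F free_arm_nonempty in auto)
  next
    case 2
    then obtain w1 w2 where "arms 3 h = {w1}" "arms 1 h = {w2}" by (meson card_1_singletonE)
    then have w: "w1 \<in> arms 3 h" "w2 \<in> arms 1 h" by auto
    then have ne: "w1 \<noteq> w2" by (auto simp: arms_def)
    obtain F where F: "card F \<le> 1" "free_arm h w1 F" using arm3[OF hh] w by blast
    obtain W k where W: "2 \<le> card W" "\<And>t. t \<noteq> k \<Longrightarrow> W - {t} \<subseteq> opt h w2 t"
      using arm1[OF hh w(2)] by blast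
    have ne2: "opt h w2 \<beta> \<noteq> {}" if "\<beta> \<notin> {k}" for \<beta>
    proof -
      have "1 \<le> card (W - {\<beta>})" using card_Diff1_ge[of W \<beta>] W(1) by simp
      then show ?thesis using W(2)[of \<beta>] that nonempty_if_card by blast
    qed
    show ?thesis
    proof (rule deficient_free[of r h w1 w2 F "{k}"])
      show "N h = {r, w1, w2}" using Nh[OF w] ne by simp
      show "w1 \<in> S" "w2 \<in> S" using arm_in w by auto
      show "r \<noteq> w1" "r \<noteq> w2" using arm_not_r[OF w(1)] arm_not_r[OF w(2)] by auto
    qed (use ne hS r_in F ne2 in auto)
  qed
qed

end

section \<open>Charges\<close>

text \<open>The equation counts three non-leaf neighbors, the first inequality says that the root
  has lost too many colors, the second that the demand exceeds the charge 3. One rigid neighbor with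
  threads of lengths 1 and 3 is all that is left.\<close>

lemma demand_arith:
  fixes a1 a2 a3 ad b0 :: nat
  assumes "a1 + a2 + a3 + ad + b0 = 3" "3 \<le> 2 * b0 + a1" "4 \<le> a1 + 2 * a2 + 3 * a3 + ad"
  shows "b0 = 1" "a1 = 1" "a3 = 1" "ad = 0"
proof -
  have "b0 \<le> 1" "1 \<le> b0" using assms by linarith+
  then show b: "b0 = 1" by linarith
  have "a1 \<le> 1" "1 \<le> a1" using assms b by linarith+
  then show a: "a1 = 1" by linarith
  have "a3 \<le> 1" "1 \<le> a3" using assms a b by linarith+
  then show "a3 = 1" by linarith
  then show "ad = 0" using assms a b by linarith
qed

context cluster_deletion
begin

definition rigid :: "'a set" where
  "rigid = big_nbrs r - def_nbrs r"

lemma rigid_outside: "rigid = N r - S"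
proof
  show "rigid \<subseteq> N r - S"
  proof
    fix w assume w: "w \<in> rigid"
    then have wN: "w \<in> N r" "3 \<le> card (N w)" "w \<notin> def_nbrs r" by (auto simp: rigid_def big_nbrs_def)
    moreover have "w \<noteq> r" using wN(1) N_irr by blast
    ultimately have "w \<notin> hubs r" by (auto simp: hubs_def)
    then have "w \<notin> S" using cluster_big[OF big _ wN(2)] S_cluster by blast
    then show "w \<in> N r - S" using wN by blast
  qed
  show "N r - S \<subseteq> rigid"
  proof
    fix w assume w: "w \<in> N r - S"
    have rh: "r \<in> hubs r" by (simp add: hubs_def)
    have "w \<notin> leaves r" using leaves_in w by blast
    then have "card (N w) \<noteq> 1" using w by (simp add: leaves_def)
    moreover have "card (N w) \<noteq> 2"
    proof
      assume "card (N w) = 2"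
      then have "w \<in> set (thread r w)" by (auto simp: thread_def)
      then show False using thread_in[OF rh, of w] w by blast
    qed
    moreover have "card (N w) \<noteq> 0" using nbhd_nonempty w N_sub by fastforce
    ultimately have "3 \<le> card (N w)" by linarith
    moreover have "w \<notin> def_nbrs r" using w hub_in[of w] by (auto simp: hubs_def)
    ultimately show "w \<in> rigid" using w by (auto simp: rigid_def big_nbrs_def)
  qed
qed

lemma free_arm1: "w \<in> arms 3 r \<union> def_nbrs r \<Longrightarrow> \<exists>F. card F \<le> 1 \<and> free_arm r w F"
  using arm3[of r w] deficient_arm[of w] by (auto simp: hubs_def)

text \<open>A rigid neighbor \<open>u\<close> costs the root the two colors \<open>\<phi> u\<close>
  and \<open>c u\<close>, a thread of length 1 the color of its far end. All other neighbors have an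
  option for every root color.\<close>

lemma root_palette:
  obtains C where "finite C" "\<And>t. t \<in> C \<Longrightarrow> allowed t"
    "card (L r) \<le> card C + 2 * card rigid + card (arms 1 r)"
    "\<And>w. w \<in> arms 1 r \<Longrightarrow> \<exists>W. 2 \<le> card W \<and> (\<forall>t\<in>C. W - {t} \<subseteq> opt r w t)"
proof -
  have rh: "r \<in> hubs r" by (simp add: hubs_def)
  have "\<forall>w\<in>arms 1 r. \<exists>k. \<exists>W. 2 \<le> card W \<and> (\<forall>t. t \<noteq> k \<longrightarrow> W - {t} \<subseteq> opt r w t)"
  proof
    fix w assume "w \<in> arms 1 r"
    then obtain W k where "2 \<le> card W" "\<forall>t. t \<noteq> k \<longrightarrow> W - {t} \<subseteq> opt r w t"
      using arm1[OF rh] by meson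
    then show "\<exists>k. \<exists>W. 2 \<le> card W \<and> (\<forall>t. t \<noteq> k \<longrightarrow> W - {t} \<subseteq> opt r w t)" by metis
  qed
  from bchoice[OF this] obtain k where
    "\<forall>w\<in>arms 1 r. \<exists>W. 2 \<le> card W \<and> (\<forall>t. t \<noteq> k w \<longrightarrow> W - {t} \<subseteq> opt r w t)"
    by (rule exE)
  note k = this[THEN bspec]
  have fin: "finite rigid" "finite (arms 1 r)" by (simp_all add: rigid_def arms_def big_nbrs_def)
  define X where "X = \<phi> ` rigid \<union> c ` rigid \<union> k ` arms 1 r"
  have cX: "card X \<le> 2 * card rigid + card (arms 1 r)"
    using card_Un_le[of "\<phi> ` rigid \<union> c ` rigid" "k ` arms 1 r"] card_Un_le[of "\<phi> ` rigid" "c ` rigid"]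
      card_image_le[OF fin(1), of \<phi>] card_image_le[OF fin(1), of c] card_image_le[OF fin(2), of k]
    unfolding X_def by linarith
  have finX: "finite X" using fin by (simp add: X_def)
  have rV: "r \<in> V" using r_in S_sub by blast
  have W: "\<exists>W. 2 \<le> card W \<and> (\<forall>t\<in>L r - X. W - {t} \<subseteq> opt r w t)" if w: "w \<in> arms 1 r" for w
  proof -
    have "t \<noteq> k w" if "t \<in> L r - X" for t using that w by (auto simp: X_def)
    then show ?thesis using k[OF w] by blast
  qed
  have ne: "opt r u t \<noteq> {}" if u: "u \<in> N r" and w: "t \<in> L r - X" for u t
  proof -
    have minus: "V' - {t} \<noteq> {}" if "2 \<le> card V'" for V'
      using card_Diff1_ge[of V' t] that nonempty_if_card[of "V' - {t}"] by simp
    show ?thesis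
    proof (cases "u \<in> S")
      case False
      then show ?thesis using opt_outside[of u r] u N_sub r_in by blast
    next
      case True
      then have nr: "u \<notin> rigid" using rigid_outside by blast
      consider "u \<in> leaves r" | "u \<in> arms 1 r" | "u \<in> arms 2 r" | "u \<in> arms 3 r \<union> def_nbrs r"
      proof -
        have "card (N u) \<noteq> 0" using nbhd_nonempty u N_sub by fastforce
        then consider "card (N u) = 1" | "card (N u) = 2" | "3 \<le> card (N u)" by linarith
        then show ?thesis
        proof cases
          case 1
          then show ?thesis using that(1) u by (simp add: leaves_def)
        next
          case 2
          then have "length (thread r u) \<in> {1, 2, 3}" by (simp add: thread_def)
          then show ?thesis using that(2-4) u by (auto simp: arms_def)
        next
          case 3
          then show ?thesis using that(4) u nr by (auto simp: rigid_def big_nbrs_def)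
        qed
      qed
      then show ?thesis
      proof cases
        case 1
        then show ?thesis using leaf_palette(1,2)[OF leaves_in 1] minus[of "L u"] by fastforce
      next
        case 2
        obtain W' where W': "2 \<le> card W'" "\<forall>t\<in>L r - X. W' - {t} \<subseteq> opt r u t"
          using W[OF 2] by (elim exE conjE)
        have "W' - {t} \<subseteq> opt r u t" using W'(2) w by (rule bspec)
        then show ?thesis using minus[OF W'(1)] by blast
      next
        case 3
        then show ?thesis using arm2[OF rh 3] free_arm_nonempty by blast
      next
        case 4
        then show ?thesis using free_arm1[OF 4] free_arm_nonempty by blast
      qed
    qed
  qed
  show ?thesis
  proof (rule that[of "L r - X"])
    show "finite (L r - X)" using finL[OF rV] by simp
    show "card (L r) \<le> card (L r - X) + 2 * card rigid + card (arms 1 r)"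
      using card_Diff_ge[OF finX, of "L r"] cX by linarith
    show "allowed t" if "t \<in> L r - X" for t
      unfolding allowed_def
    proof (intro conjI ballI)
      show "t \<in> L r" using that by blast
      show "opt r u t \<noteq> {}" if "u \<in> N r" for u using ne that \<open>t \<in> L r - X\<close> by blast
      show "t \<noteq> \<phi> u" "t \<noteq> c u" if "u \<in> N r - S" for u
        using that \<open>t \<in> L r - X\<close> unfolding X_def rigid_outside[symmetric] by auto
    qed
  qed (rule W)
qed

text \<open>The cases are governed by \<open>k + l + 1 - 2 b0 - a1\<close>, a lower bound for the
  number of allowed root colors. If it is large enough, some allowed color escapes the exceptional
  sets of the free arms; if it is small, rigid neighbors and short threads abound and the demand is
  low.\<close>

lemma demand_bound:
  "card (arms 1 r) + 2 * card (arms 2 r) + 3 * card (arms 3 r) + card (def_nbrs r) + 12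
    \<le> 5 * card (N r - leaves r) + (if deficient r then 1 else 0)"
proof (rule ccontr)
  define a1 a2 a3 ad b0 k l where abbr: "a1 = card (arms 1 r)" "a2 = card (arms 2 r)"
    "a3 = card (arms 3 r)" "ad = card (def_nbrs r)" "b0 = card rigid"
    "k = card (N r - leaves r)" "l = card (leaves r)"
  assume "\<not> ?thesis"
  then have dem: "5 * k + (if deficient r then 1 else 0) < a1 + 2 * a2 + 3 * a3 + ad + 12"
    by (simp add: abbr)
  have rV: "r \<in> V" using r_in S_sub by blast
  have rh: "r \<in> hubs r" by (simp add: hubs_def)
  have fin: "finite (arms i r)" "finite (big_nbrs r)" for i by (simp_all add: arms_def big_nbrs_def)
  have bb: "card (big_nbrs r) = ad + b0"
    using fin(2) def_nbrs_big[of r] finite_subset[OF def_nbrs_big fin(2)]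
    by (simp add: abbr rigid_def card_Diff_subset card_mono)
  have k: "k = a1 + a2 + a3 + ad + b0" using card_core[OF rV] bb by (simp add: abbr)
  have k3: "3 \<le> k" using core_ge_3[OF rV big] by (simp add: abbr)
  have cN: "card (N r) = k + l"
    using leaves_sub[of r] by (simp add: abbr card_Diff_subset card_mono)
  have cL: "card (L r) = k + l + 1" using cardL[OF rV] cN k3 by (simp add: kap_def)
  obtain C where C: "finite C" "\<And>t. t \<in> C \<Longrightarrow> allowed t" and cC: "k + l + 1 \<le> card C + 2 * b0 + a1"
    and CW: "\<And>w. w \<in> arms 1 r \<Longrightarrow> \<exists>W. 2 \<le> card W \<and> (\<forall>t\<in>C. W - {t} \<subseteq> opt r w t)"
    using root_palette cL by (metis abbr(1,5))
  have l0: "l = 0 \<longleftrightarrow> leaves r = {}" by (simp add: abbr)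
  have arms_core: "arms i r \<subseteq> N r - leaves r" if "i > 0" for i
    using that by (auto simp: arms_def thread_def leaves_def split: if_splits)
  have forced_core: "forced t - leaves r \<subseteq> N r - leaves r" for t by (auto simp: forced_def)

  \<comment> \<open>Leaving out at most one exceptional color for each of \<open>k - 3\<close>
    threads of length 3 still keeps \<open>l + 2\<close> root colors, and those threads are not
    forced. So at most three non-leaves are forced.\<close>
  have general: False if a3: "k - 3 \<le> a3" and few: "2 * b0 + a1 \<le> 2" and or: "l \<noteq> 0 \<or> 4 \<le> k"
  proof -
    obtain X where X: "X \<subseteq> arms 3 r" "card X = k - 3"
      using a3 obtain_subset_with_card_n[of "k - 3" "arms 3 r"] by (auto simp: abbr)
    have finX: "finite X" using X fin finite_subset by blast
    have "\<forall>w\<in>X. \<exists>F. card F \<le> 1 \<and> free_arm r w F" using arm3[OF rh] X by blast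
    from bchoice[OF this] obtain F where F: "\<And>w. w \<in> X \<Longrightarrow> card (F w) \<le> 1 \<and> free_arm r w (F w)" by blast
    let ?F = "\<Union>w\<in>X. F w"
    have finF: "finite ?F" using finX F by (auto simp: free_arm_def)
    have "card ?F \<le> (\<Sum>w\<in>X. card (F w))" using finX by (rule card_UN_le)
    also have "\<dots> \<le> (\<Sum>w\<in>X. 1)" using F by (intro sum_mono) blast
    finally have "card ?F \<le> k - 3" using X by simp
    then have cD: "l + 2 \<le> card (C - ?F)"
      using card_Diff_ge[OF finF, of C] cC few k3 by linarith
    have f3: "card (forced t - leaves r) \<le> 3" if w: "t \<in> C - ?F" for t
    proof -
      have "u \<notin> forced t" if u: "u \<in> X" for u
      proof (rule not_forced_two, rule free_arm_two)
        show "free_arm r u (F u)" using F[OF u] by blast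
        show "t \<notin> F u" using w u by blast
      qed
      then have "forced t - leaves r \<subseteq> (N r - leaves r) - X" using forced_core by blast
      then have "card (forced t - leaves r) \<le> card ((N r - leaves r) - X)" by (intro card_mono) auto
      also have "\<dots> = k - (k - 3)"
      proof -
        have "X \<subseteq> N r - leaves r" using X(1) arms_core[of 3] by simp
        then show ?thesis using finX X(2) by (simp add: card_Diff_subset abbr(6))
      qed
      finally show ?thesis by linarith
    qed
    show False
    proof (cases "l = 0")
      case False
      show False
      proof (rule leafy_root_contradiction[OF leaves_in, of "C - ?F"])
        show "leaves r \<noteq> {}" using False l0 by blast
        show "card (leaves r) + 2 \<le> card (C - ?F)" using cD abbr(7) by simp
        show "allowed t \<and> card (forced t - leaves r) \<le> 3" if "t \<in> C - ?F" for t
          using C(2)[of t] f3[OF that] that by blast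
      qed (use C in simp)
    next
      case True
      then have "X \<noteq> {}" using or X by auto
      then obtain u where u: "u \<in> X" by blast
      have "1 \<le> card (C - ?F)" using cD by simp
      then obtain t where w: "t \<in> C - ?F" using nonempty_if_card by blast
      have "two (opt r u t)"
      proof (rule free_arm_two)
        show "free_arm r u (F u)" using F[OF u] by blast
        show "t \<notin> F u" using w u by blast
      qed
      moreover have "u \<in> N r" using u X by (auto simp: arms_def)
      ultimately have "4 \<le> card (forced t)" using four_forced_if_two C(2) w by blast
      then show False using f3[OF w] True l0 by simp
    qed
  qed

  have plain_free: False if "l = 0" "k = 3" "w \<in> N r" "free_arm r w F" "card F < card C" for w F
  proof -
    have "finite F" using that by (simp add: free_arm_def)
    then have "1 \<le> card (C - F)" using card_Diff_ge[of F C] that(5) by linarith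
    then obtain t where w: "t \<in> C" "t \<notin> F" using nonempty_if_card by blast
    then show False
      using plain_root_contradiction[OF C(2)[OF w(1)] that(3)] free_arm_two[OF that(4) w(2)] cN that by simp
  qed

  \<comment> \<open>Each neighbor demands at most 3, and \<open>3 k + 12 <= 5 k\<close> from
    \<open>k = 6\<close> on.\<close>
  have k_less: "k < 6"
  proof (rule ccontr)
    assume "\<not> k < 6"
    then show False using dem k by (auto split: if_splits)
  qed
  show False
  proof (cases "4 \<le> k")
    case True
    \<comment> \<open>The demand falls short of \<open>3 k\<close> by
      \<open>2 a1 + a2 + 2 ad + 3 b0\<close>, which negative charge limits to 3 for
      \<open>k = 4\<close> and to 1 for \<open>k = 5\<close>.\<close>
    then have "k - 3 \<le> a3" "2 * b0 + a1 \<le> 2" using k_less k dem by (auto split: if_splits)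
    then show False using general True by blast
  next
    case False
    then have k_eq: "k = 3" using k3 by simp
    have dem4: "4 + (if deficient r then 1 else 0) \<le> a1 + 2 * a2 + 3 * a3 + ad" using dem k_eq by simp
    show False
    proof (cases "l = 0")
      case l: False
      \<comment> \<open>\<open>general\<close> needs no thread of length 3 when
        \<open>k = 3\<close>, so the root must have lost at least three colors.\<close>
      have "\<not> 2 * b0 + a1 \<le> 2" using general l k_eq by auto
      moreover have "4 \<le> a1 + 2 * a2 + 3 * a3 + ad" using dem4 by (simp split: if_splits)
      ultimately have e: "b0 = 1" "a1 = 1" "a3 = 1"
        using demand_arith[of a1 a2 a3 ad b0] k k_eq by simp_all
      have "arms 3 r \<noteq> {}" "rigid \<noteq> {}" using e by (auto simp: abbr)
      then obtain w z where w: "w \<in> arms 3 r" and z: "z \<in> rigid" by blast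
      obtain F where F: "card F \<le> 1" "free_arm r w F" using arm3[OF rh w] by blast
      show False
      proof (rule leafy_root_contradiction'[OF leaves_in, of C F z])
        show "leaves r \<noteq> {}" using l l0 by blast
        show "card (leaves r) + 1 \<le> card C" using cC e k_eq by (simp add: abbr)
        show "finite F" using F by (simp add: free_arm_def)
        show "z \<in> N r - S" using z rigid_outside by blast
        have core3: "card (N r - leaves r) = 3" using k_eq by (simp add: abbr)
        show "allowed t \<and> card (forced t - leaves r) \<le> 3" if "t \<in> C" for t
          using C(2)[OF that] card_mono[OF _ forced_core[of t]] core3 by simp
        show "card (forced t - leaves r) \<le> 2" if "t \<in> C - F" for t
        proof -
          have "w \<notin> forced t"
            by (rule not_forced_two, rule free_arm_two[OF F(2)]) (use that in blast)
          then have "forced t - leaves r \<subseteq> (N r - leaves r) - {w}" using forced_core by blast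
          then have "card (forced t - leaves r) \<le> card ((N r - leaves r) - {w})" by (intro card_mono) auto
          then show ?thesis using arms_core[of 3] w core3 by (auto simp: card_Diff_singleton)
        qed
      qed (use C F in auto)
    next
      case l: True
      have no_free1: False if "a3 + ad \<noteq> 0" "2 * b0 + a1 \<le> 2"
      proof -
        have "arms 3 r \<union> def_nbrs r \<noteq> {}" using that(1) by (auto simp: abbr)
        then obtain w where w: "w \<in> arms 3 r \<union> def_nbrs r" by blast
        then obtain F where F: "card F \<le> 1" "free_arm r w F" using free_arm1 by blast
        have "w \<in> N r" using w by (auto simp: arms_def def_nbrs_def)
        then show False using plain_free[OF l k_eq _ F(2)] F(1) cC that(2) k_eq l by simp
      qed
      have no_free2: False if "a2 \<noteq> 0" "2 * b0 + a1 \<le> 1"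
      proof -
        have "arms 2 r \<noteq> {}" using that(1) by (auto simp: abbr)
        then obtain w where w: "w \<in> arms 2 r" by blast
        then obtain F where F: "card F \<le> 2" "free_arm r w F" using arm2[OF rh] by blast
        have "w \<in> N r" using w by (auto simp: arms_def)
        then show False using plain_free[OF l k_eq _ F(2)] F(1) cC that(2) k_eq l by simp
      qed
      have no211: False if "a2 = 1" "a1 = 2"
      proof -
        have "arms 2 r \<noteq> {}" "arms 1 r \<noteq> {}" using that by (auto simp: abbr)
        then obtain u w where u: "u \<in> arms 2 r" and w: "w \<in> arms 1 r" by blast
        obtain F where F: "free_arm r u F" using arm2[OF rh u] by blast
        obtain W where W: "2 \<le> card W" "\<And>t. t \<in> C \<Longrightarrow> W - {t} \<subseteq> opt r w t" using CW[OF w] by blast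
        have "b0 = 0" using k k_eq that by simp
        then have "2 \<le> card C" using cC that k_eq by simp
        then obtain t t' where om: "t \<in> C" "t' \<in> C" "t \<noteq> t'" using two_if_card[of C] by (auto simp: two_def)
        show False
          by (rule root211_contradiction[OF _ C(2)[OF om(1)] C(2)[OF om(2)] om(3) _ F _ W(1) W(2)[OF om(1)] W(2)[OF om(2)]])
            (use u w cN k_eq l in \<open>auto simp: arms_def\<close>)
      qed
      \<comment> \<open>A deficient root receives one unit, so negative charge would require a
        demand of 5, but these shapes demand only 4.\<close>
      have not_def: False if "b0 = 1" "ad = 0" "a2 = 2 \<or> a3 = 1 \<and> a1 = 1"
      proof -
        have "deficient r"
          unfolding deficient_def using that cN k_eq l bb l0 by (simp add: abbr)
        then show False using dem4 k k_eq that by auto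
      qed
      show False
      proof (cases "a3 + ad = 0")
        case True
        then have "a1 + a2 + b0 = 3" "4 \<le> a1 + 2 * a2" using k k_eq dem4 by auto
        then consider "a2 = 1" "a1 = 2" | "a2 \<noteq> 0" "2 * b0 + a1 \<le> 1" | "b0 = 1" "a2 = 2"
        proof -
          have "1 \<le> a2" "b0 \<le> 1" "b0 + a1 \<le> 2" using \<open>a1 + a2 + b0 = 3\<close> \<open>4 \<le> a1 + 2 * a2\<close> by linarith+
          then show ?thesis
            using that \<open>a1 + a2 + b0 = 3\<close> \<open>4 \<le> a1 + 2 * a2\<close> by (cases "b0 = 0"; cases "a1 \<le> 1") auto
        qed
        then show False using no_free2 no211 not_def True by cases auto
      next
        case f: False
        then have "3 \<le> 2 * b0 + a1" using no_free1 by force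
        moreover have "4 \<le> a1 + 2 * a2 + 3 * a3 + ad" using dem4 by (simp split: if_splits)
        ultimately show False
          using demand_arith[of a1 a2 a3 ad b0] k k_eq not_def by simp
      qed
    qed
  qed
qed

end

section \<open>Summing the charges\<close>

context minimal_counterexample
begin

lemma demand:
  assumes "v \<in> V" "3 \<le> card (N v)"
  shows "card (arms 1 v) + 2 * card (arms 2 v) + 3 * card (arms 3 v) + card (def_nbrs v) + 12
    \<le> 5 * card (N v - leaves v) + (if deficient v then 1 else 0)"
proof -
  obtain \<phi> c where "deletion V N L v (cluster v) \<phi> c"
    by (rule deletion_exists[OF tree_set_cluster[OF assms(1)]])
  then interpret deletion V N L v "cluster v" \<phi> c .
  interpret cluster_deletion V N L v "cluster v" \<phi> c
    by unfold_locales (use assms in simp_all)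
  show ?thesis by (rule demand_bound)
qed

lemma sum_thread_length:
  "(\<Sum>w\<in>N v. length (thread v w)) = card (arms 1 v) + 2 * card (arms 2 v) + 3 * card (arms 3 v)"
proof -
  have arm: "card (arms i v) = (\<Sum>w\<in>N v. if length (thread v w) = i then 1 else 0)" for i
    by (simp add: arms_def sum.If_cases Int_def)
  have "(\<Sum>w\<in>N v. length (thread v w)) = (\<Sum>w\<in>N v. (if length (thread v w) = 1 then 1 else 0)
     + 2 * (if length (thread v w) = 2 then 1 else 0) + 3 * (if length (thread v w) = 3 then 1 else 0))"
    by (intro sum.cong refl) (simp add: thread_def)
  also have "\<dots> = card (arms 1 v) + 2 * card (arms 2 v) + 3 * card (arms 3 v)"
    unfolding arm by (simp only: sum.distrib sum_distrib_left)
  finally show ?thesis .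
qed

text \<open>Walking from a vertex of degree 2 in either direction one reaches a big vertex after at
  most three steps, so each such vertex receives charge along both of its edges.\<close>

lemma two_charge:
  "2 * card {x \<in> V. card (N x) = 2} \<le> (\<Sum>v\<in>{v \<in> V. 3 \<le> card (N v)}. \<Sum>w\<in>N v. length (thread v w))"
proof -
  let ?T = "{x \<in> V. card (N x) = 2}" and ?B = "{v \<in> V. 3 \<le> card (N v)}"
  let ?Q = "SIGMA v:?B. SIGMA w:N v. {..<length (thread v w)}"
  \<comment> \<open>With \<open>v\<close> put in front, position \<open>i\<close> holds the
    predecessor of the thread vertex at position \<open>Suc i\<close>, also for
    \<open>i = 0\<close>. The map thus yields pairs of a degree-2 vertex and its neighbor towards
    the big vertex that pays it.\<close>
  let ?m = "\<lambda>(v, w, i). ((v # thread v w) ! Suc i, (v # thread v w) ! i)"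
  have finB: "finite ?B" "finite ?T" using finV by simp_all
  have "card (SIGMA x:?T. N x) = (\<Sum>x\<in>?T. card (N x))" using finB by (intro card_SigmaI) auto
  also have "\<dots> = 2 * card ?T" by simp
  finally have "2 * card ?T = card (SIGMA x:?T. N x)" by simp
  also have "\<dots> \<le> card (?m ` ?Q)"
  proof (rule card_mono)
    show "finite (?m ` ?Q)" using finB by (intro finite_imageI finite_SigmaI) auto
    show "(SIGMA x:?T. N x) \<subseteq> ?m ` ?Q"
    proof
      fix d assume "d \<in> (SIGMA x:?T. N x)"
      then obtain x p where d: "d = (x, p)" "x \<in> V" "card (N x) = 2" "p \<in> N x" by auto
      have mem: "(x, p) \<in> ?m ` ?Q"
        if "v \<in> ?B" "w \<in> N v" "i < length (thread v w)" "(v # thread v w) ! Suc i = x" "(v # thread v w) ! i = p"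
        for v w i
        using that by (intro image_eqI[of _ _ "(v, w, i)"]) auto
      have pV: "p \<in> V" using d N_sub by blast
      show "d \<in> ?m ` ?Q"
      proof (cases "card (N p) = 2")
        case False
        then have "p \<in> ?B" using big_beside_two[of x p] d pV by simp
        moreover have "x \<in> N p" using d N_sym by blast
        moreover have "0 < length (thread p x)" "thread p x ! 0 = x" using d(3) by (simp_all add: thread_def)
        ultimately show ?thesis using mem[of p x 0] d(1) by simp
      next
        case p2: True
        define q where "q = other p x"
        have Np: "N p = {x, q}" "x \<noteq> q" using nbhd_other[OF p2 N_sym[OF d(4)]] by (simp_all add: q_def)
        have qp: "p \<in> N q" "other p q = x" using Np N_sym[of q p] other_eq[of p q x] by (auto simp: insert_commute)
        have qV: "q \<in> V" using Np N_sub[of p] by blast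
        show ?thesis
        proof (cases "card (N q) = 2")
          case False
          then have "q \<in> ?B" using big_beside_two[of p q] p2 Np qV by simp
          moreover have "1 < length (thread q p)" "thread q p ! 0 = p" "thread q p ! 1 = x"
            using d(3) p2 qp by (simp_all add: thread_def)
          ultimately show ?thesis using mem[of q p 1] d(1) qp by simp
        next
          case q2: True
          define s where "s = other q p"
          have Nq: "N q = {p, s}" "p \<noteq> s" using nbhd_other[OF q2 qp(1)] by (simp_all add: s_def)
          have sq: "q \<in> N s" "other q s = p" using Nq N_sym[of s q] other_eq[of q s p] by (auto simp: insert_commute)
          have sV: "s \<in> V" using Nq N_sub[of q] by blast
          have "card (N s) \<noteq> 2"
          proof
            assume s2: "card (N s) = 2"
            have Ns: "N s = {q, other s q}" "q \<noteq> other s q" using nbhd_other[OF s2 sq(1)] by simp_all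
            have Nx: "N x = {p, other x p}" "p \<noteq> other x p" using nbhd_other[OF d(3,4)] by simp_all
            show False
              using no_four_thread[of x "other x p" p q s "other s q"] Nx Np Nq Ns by (auto simp: insert_commute)
          qed
          then have "s \<in> ?B" using big_beside_two[of q s] q2 Nq sV by simp
          moreover have "thread s q = [q, p, x]" using d(3) p2 q2 qp sq by (simp add: thread_def)
          ultimately show ?thesis using mem[of s q 2] d(1) sq by simp
        qed
      qed
    qed
  qed
  also have "\<dots> \<le> card ?Q" using finB by (intro card_image_le finite_SigmaI) auto
  also have "\<dots> = (\<Sum>v\<in>?B. \<Sum>w\<in>N v. length (thread v w))"
    using finB by (simp add: card_SigmaI)
  finally show ?thesis .
qed

lemma deficient_charge:
  "card {v \<in> V. 3 \<le> card (N v) \<and> deficient v} \<le> (\<Sum>v\<in>{v \<in> V. 3 \<le> card (N v)}. card (def_nbrs v))"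
proof -
  let ?B = "{v \<in> V. 3 \<le> card (N v)}"
  have finB: "finite ?B" "finite (def_nbrs v)" for v using finV by (simp_all add: def_nbrs_def)
  have "card {v \<in> V. 3 \<le> card (N v) \<and> deficient v} \<le> card (snd ` (SIGMA v:?B. def_nbrs v))"
  proof (rule card_mono)
    show "finite (snd ` (SIGMA v:?B. def_nbrs v))" using finB by (intro finite_imageI finite_SigmaI) auto
    show "{v \<in> V. 3 \<le> card (N v) \<and> deficient v} \<subseteq> snd ` (SIGMA v:?B. def_nbrs v)"
    proof
      fix h assume h: "h \<in> {v \<in> V. 3 \<le> card (N v) \<and> deficient v}"
      then have "card (big_nbrs h) = 1" by (simp add: deficient_def)
      then obtain v where "big_nbrs h = {v}" by (rule card_1_singletonE)
      then have v: "v \<in> N h" "3 \<le> card (N v)" by (auto simp: big_nbrs_def)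
      then have "v \<in> ?B" "h \<in> def_nbrs v" using N_sub N_sym h by (auto simp: def_nbrs_def)
      then show "h \<in> snd ` (SIGMA v:?B. def_nbrs v)" by (intro image_eqI[of _ _ "(v, h)"]) auto
    qed
  qed
  also have "\<dots> \<le> card (SIGMA v:?B. def_nbrs v)" using finB by (intro card_image_le finite_SigmaI) auto
  also have "\<dots> = (\<Sum>v\<in>?B. card (def_nbrs v))" using finB by (intro card_SigmaI) auto
  finally show ?thesis .
qed

text \<open>\<open>W\<close> consists of all vertices that are not leaves. A vertex of degree 2 has
  charge \<open>10 - 12\<close>, repaid by its two units, and what big vertices pay to deficient
  neighbors covers the deficits, so the total is nonnegative.\<close>

lemma dense_core:
  "\<exists>W\<subseteq>V. W \<noteq> {} \<and> 12 * card W \<le> (\<Sum>v\<in>W. 5 * card (N v \<inter> W))"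
proof -
  let ?T = "{x \<in> V. card (N x) = 2}" and ?B = "{v \<in> V. 3 \<le> card (N v)}"
  let ?W = "?T \<union> ?B"
  have fin: "finite ?T" "finite ?B" using finV by simp_all
  have W: "x \<in> ?W \<longleftrightarrow> card (N x) \<noteq> 1" if "x \<in> V" for x
  proof -
    have "card (N x) \<noteq> 0" using nbhd_nonempty[OF that] by simp
    moreover have "x \<in> ?W \<longleftrightarrow> card (N x) = 2 \<or> 3 \<le> card (N x)" using that by simp
    ultimately show ?thesis by arith
  qed
  have NW: "N v \<inter> ?W = N v - leaves v" for v
    using W N_sub unfolding leaves_def by blast
  have "V \<noteq> {}" using not_colorable by (auto simp: pcf_def)
  then obtain v where v: "v \<in> V" by blast
  have ne: "?W \<noteq> {}"
  proof (cases "card (N v) = 1")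
    case False
    then show ?thesis using W v by blast
  next
    case True
    then obtain u where u: "N v = {u}" by (rule card_1_singletonE)
    then have "v \<in> leaves u" using True N_sym[of u v] by (simp add: leaves_def)
    moreover have uV: "u \<in> V" using u N_sub[of v] by blast
    ultimately have "2 \<le> card (N u - leaves u)" using core_ge_2(1) by blast
    also have "\<dots> \<le> card (N u)" by (intro card_mono) auto
    finally have "u \<in> ?W" using W uV by simp
    then show ?thesis by blast
  qed
  have sumB: "(\<Sum>v\<in>?B. (\<Sum>w\<in>N v. length (thread v w)) + card (def_nbrs v) + 12)
      \<le> (\<Sum>v\<in>?B. 5 * card (N v - leaves v) + (if deficient v then 1 else 0))"
    using demand unfolding sum_thread_length by (intro sum_mono) simp
  have defs: "(\<Sum>v\<in>?B. if deficient v then 1 else 0) = card {v \<in> V. 3 \<le> card (N v) \<and> deficient v}"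
    using fin by (simp add: sum.If_cases Int_def conj_assoc)
  have "2 * card ?T + card {v \<in> V. 3 \<le> card (N v) \<and> deficient v} + 12 * card ?B \<le>
      (\<Sum>v\<in>?B. 5 * card (N v - leaves v)) + card {v \<in> V. 3 \<le> card (N v) \<and> deficient v}"
    using sumB two_charge deficient_charge defs by (simp add: sum.distrib)
  then have B: "2 * card ?T + 12 * card ?B \<le> (\<Sum>v\<in>?B. 5 * card (N v \<inter> ?W))" unfolding NW by simp
  have T: "(\<Sum>v\<in>?T. 5 * card (N v \<inter> ?W)) = 10 * card ?T"
    unfolding NW using two_leafless by simp
  have disj: "?T \<inter> ?B = {}" by auto
  have "12 * card ?W = 12 * card ?T + 12 * card ?B" using fin disj by (simp add: card_Un_disjoint)
  also have "\<dots> \<le> (\<Sum>v\<in>?T. 5 * card (N v \<inter> ?W)) + (\<Sum>v\<in>?B. 5 * card (N v \<inter> ?W))"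
    using B T by linarith
  also have "\<dots> = (\<Sum>v\<in>?W. 5 * card (N v \<inter> ?W))" using fin disj by (intro sum.union_disjoint[symmetric])
  finally show ?thesis using ne by (intro exI[of _ ?W]) auto
qed

end

section \<open>Induction over induced subgraphs\<close>

context ngraph
begin

text \<open>A failing \<open>U\<close> all of whose proper subsets are colorable is a minimal
  counterexample once its lists are cut down to exact size, and its dense core violates
  sparsity.\<close>

lemma pcf_of_sparse:
  fixes L :: "'a \<Rightarrow> 'c set"
  assumes sparse: "\<And>U. U \<subseteq> V \<Longrightarrow> U \<noteq> {} \<Longrightarrow> (\<Sum>x\<in>U. 5 * card (N x \<inter> U)) < 12 * card U"
    and "U \<subseteq> V" "\<And>x. x \<in> U \<Longrightarrow> finite (L x) \<and> kap (card (N x \<inter> U)) \<le> card (L x)"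
  shows "\<exists>\<phi>. pcf U L \<phi>"
proof -
  have "finite U" using assms(2) finV finite_subset by blast
  then show ?thesis using assms(2,3)
  proof (induction U arbitrary: L rule: finite_psubset_induct)
    case (psubset U)
    show ?case
    proof (rule ccontr)
      assume no: "\<nexists>\<phi>. pcf U L \<phi>"
      have "\<forall>x\<in>U. \<exists>M. M \<subseteq> L x \<and> card M = kap (card (N x \<inter> U))"
        using psubset.prems(2) by (meson obtain_subset_with_card_n)
      from bchoice[OF this] obtain M where M: "\<forall>x\<in>U. M x \<subseteq> L x \<and> card (M x) = kap (card (N x \<inter> U))" by blast
      \<comment> \<open>Empty off \<open>U\<close>, because the locale asks for neighborhoods inside
        \<open>U\<close> and symmetry for all elements of the type.\<close>
      define NU where "NU x = (if x \<in> U then N x \<inter> U else {})" for x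
      interpret H: ngraph U NU
      proof
        show "finite U" by (rule psubset.hyps)
        show "NU x \<subseteq> U" for x by (simp add: NU_def)
        show "x \<in> NU y" if "y \<in> NU x" for x y using that N_sym by (auto simp: NU_def split: if_splits)
        show "x \<notin> NU x" for x using N_irr by (simp add: NU_def)
        show "12 \<le> length p" if p: "distinct p" "3 \<le> length p"
            "\<forall>i. Suc i < length p \<longrightarrow> p ! Suc i \<in> NU (p ! i)" "hd p \<in> NU (last p)" for p
        proof (rule no_short_cycle[OF p(1,2)])
          have "NU x \<subseteq> N x" for x by (simp add: NU_def)
          then show "\<forall>i. Suc i < length p \<longrightarrow> p ! Suc i \<in> N (p ! i)" "hd p \<in> N (last p)" using p by blast+
        qed
      qed
      have pcf_eq: "H.pcf W K \<phi> \<longleftrightarrow> pcf W K \<phi>" if "W \<subseteq> U" for W and K :: "'a \<Rightarrow> 'c set" and \<phi>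
      proof -
        have "NU x \<inter> W = N x \<inter> W" if "x \<in> W" for x using that \<open>W \<subseteq> U\<close> by (auto simp: NU_def)
        then show ?thesis unfolding H.pcf_def pcf_def by simp
      qed
      interpret H: minimal_counterexample U NU M
      proof
        fix x assume x: "x \<in> U"
        show "finite (M x)" using M psubset.prems(2) x finite_subset by blast
        show "card (M x) = kap (card (NU x))" using M x by (simp add: NU_def)
      next
        fix S and K :: "'a \<Rightarrow> 'c set"
        assume S: "S \<subseteq> U" "S \<noteq> {}"
          and K: "\<And>x. x \<in> U - S \<Longrightarrow> finite (K x) \<and> kap (card (NU x - S)) \<le> card (K x)"
        have "finite (K x) \<and> kap (card (N x \<inter> (U - S))) \<le> card (K x)" if "x \<in> U - S" for x
        proof -
          have "NU x - S = N x \<inter> (U - S)" using that by (auto simp: NU_def)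
          then show ?thesis using K[OF that] by simp
        qed
        moreover have "U - S \<subset> U" "U - S \<subseteq> V" using S psubset.prems(1) by auto
        ultimately have "\<exists>\<phi>. pcf (U - S) K \<phi>" using psubset.IH[of "U - S" K] by blast
        then show "\<exists>\<phi>. H.pcf (U - S) K \<phi>" using pcf_eq[of "U - S"] by blast
      next
        fix \<phi>
        show "\<not> H.pcf U M \<phi>"
        proof
          assume "H.pcf U M \<phi>"
          then have "pcf U M \<phi>" using pcf_eq by blast
          then have "pcf U L \<phi>" using M unfolding pcf_def by blast
          then show False using no by blast
        qed
      qed
      obtain W where W: "W \<subseteq> U" "W \<noteq> {}" "12 * card W \<le> (\<Sum>v\<in>W. 5 * card (NU v \<inter> W))"
        using H.dense_core by blast
      have "NU v \<inter> W = N v \<inter> W" if "v \<in> W" for v using that W(1) by (auto simp: NU_def)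
      then have "(\<Sum>v\<in>W. 5 * card (NU v \<inter> W)) = (\<Sum>v\<in>W. 5 * card (N v \<inter> W))" by simp
      moreover have "W \<subseteq> V" using W(1) psubset.prems(1) by blast
      ultimately show False using sparse[OF _ W(2)] W(3) by simp
    qed
  qed
qed

end

section \<open>Planar graphs of girth at least 12\<close>

lemma (in simple_graph) nbhd_graph:
  assumes "12 \<le> girth E"
  shows "ngraph V (nbhd E)"
proof
  show "finite V" by (rule finite_verts)
  show "nbhd E x \<subseteq> V" for x using edges by (auto simp: nbhd_def)
  show "x \<in> nbhd E y" if "y \<in> nbhd E x" for x y using that by (simp add: nbhd_def insert_commute)
  show "x \<notin> nbhd E x" for x using edges[of "{x}"] by (auto simp: nbhd_def)
  show "12 \<le> length p" if p: "distinct p" "3 \<le> length p"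
      "\<forall>i. Suc i < length p \<longrightarrow> p ! Suc i \<in> nbhd E (p ! i)" "hd p \<in> nbhd E (last p)" for p
  proof -
    have "{p ! i, p ! (Suc i mod length p)} \<in> E" if i: "i < length p" for i
    proof (cases "Suc i < length p")
      case True
      then show ?thesis using p(3) by (simp add: nbhd_def)
    next
      case False
      then have l: "Suc i = length p" using i by simp
      then have "p ! i = last p" "p ! 0 = hd p"
        using i by (metis diff_Suc_1 last_conv_nth list.size(3) not_less_zero,
          metis hd_conv_nth list.size(3) not_less_zero)
      then show ?thesis using p(4) l by (simp add: nbhd_def)
    qed
    then have "is_cycle E p" using p by (simp add: is_cycle_def)
    then have "girth E \<le> enat (length p)" unfolding girth_def by (intro INF_lower) simp
    then have "(12::enat) \<le> enat (length p)" using assms order_trans by blast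
    then show ?thesis by (simp add: numeral_eq_enat)
  qed
qed

lemma (in simple_graph) degree_sum_le:
  "(\<Sum>x\<in>U. card (nbhd E x \<inter> U)) \<le> 2 * card {e \<in> E. e \<subseteq> U}" if "U \<subseteq> V"
proof -
  let ?F = "{e \<in> E. e \<subseteq> U}"
  have finE: "finite E"
    using edges finite_verts by (meson PowI finite_Pow_iff finite_subset subsetI)
  have finU: "finite U" using that finite_verts finite_subset by blast
  have finN: "finite (nbhd E x \<inter> U)" for x using finU by simp
  have two: "finite {(x, y). {x, y} = e} \<and> card {(x, y). {x, y} = e} \<le> 2" if "e \<in> ?F" for e
  proof -
    have "card e = 2" using edges that by blast
    then obtain a b where e: "e = {a, b}" by (meson card_2_iff)
    have sub: "{(x, y). {x, y} = e} \<subseteq> {(a, b), (b, a)}"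
    proof
      fix d assume "d \<in> {(x, y). {x, y} = e}"
      then obtain x y where "d = (x, y)" "{x, y} = {a, b}" unfolding e by blast
      then show "d \<in> {(a, b), (b, a)}" unfolding doubleton_eq_iff by blast
    qed
    then have "card {(x, y). {x, y} = e} \<le> card {(a, b), (b, a)}" by (intro card_mono) auto
    also have "\<dots> \<le> 2" using card_insert_le_m1[of 2 "{(b, a)}" "(a, b)"] by simp
    finally have "card {(x, y). {x, y} = e} \<le> 2" .
    moreover have "finite {(x, y). {x, y} = e}" by (rule finite_subset[OF sub]) simp
    ultimately show ?thesis by simp
  qed
  have "(\<Sum>x\<in>U. card (nbhd E x \<inter> U)) = card (SIGMA x:U. nbhd E x \<inter> U)"
    using finU finN by (simp add: card_SigmaI)
  also have "\<dots> \<le> card (\<Union>e\<in>?F. {(x, y). {x, y} = e})"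
  proof (rule card_mono)
    show "finite (\<Union>e\<in>?F. {(x, y). {x, y} = e})" using finE two by (intro finite_UN_I) simp_all
    show "(SIGMA x:U. nbhd E x \<inter> U) \<subseteq> (\<Union>e\<in>?F. {(x, y). {x, y} = e})" by (auto simp: nbhd_def)
  qed
  also have "\<dots> \<le> (\<Sum>e\<in>?F. card {(x, y). {x, y} = e})" using finE by (intro card_UN_le) simp
  also have "\<dots> \<le> (\<Sum>e\<in>?F. 2)" using two by (intro sum_mono) simp
  finally show ?thesis by simp
qed

text \<open>Drawings restrict to induced subgraphs and the girth does not drop, so the edge bound
  applies to \<open>U\<close>. Degrees count every edge twice, which turns 5 and 6 into 10 and
  12.\<close>

lemma planar_girth_sparse:
  assumes G: "simple_graph V E" "planar V E" "12 \<le> girth E" and U: "U \<subseteq> V" "U \<noteq> {}"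
  shows "(\<Sum>x\<in>U. 5 * card (nbhd E x \<inter> U)) < 12 * card U"
proof -
  interpret simple_graph V E by (rule G(1))
  let ?F = "{e \<in> E. e \<subseteq> U}"
  obtain pos \<gamma> where d: "plane_drawing V E pos \<gamma>" using G(2) by (auto simp: planar_def)
  have "plane_drawing U ?F pos \<gamma>"
    unfolding plane_drawing_def
  proof (intro conjI ballI impI)
    have "inj_on pos V" using d by (simp add: plane_drawing_def)
    then show "inj_on pos U" using U(1) by (rule inj_on_subset)
    fix e assume e: "e \<in> ?F"
    then have *: "arc (\<gamma> e)" "{pathstart (\<gamma> e), pathfinish (\<gamma> e)} = pos ` e"
      "path_image (\<gamma> e) \<inter> pos ` V = pos ` e"
      using d unfolding plane_drawing_def by auto
    then show "arc (\<gamma> e)" "{pathstart (\<gamma> e), pathfinish (\<gamma> e)} = pos ` e" by auto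
    show "path_image (\<gamma> e) \<inter> pos ` U = pos ` e" using *(3) e U by blast
    show "path_image (\<gamma> e) \<inter> path_image (\<gamma> f) \<subseteq> pos ` (e \<inter> f)" if "f \<in> ?F" "e \<noteq> f" for f
      using d e that unfolding plane_drawing_def by auto
  qed
  moreover have "simple_graph U ?F"
  proof
    show "finite U" using U(1) finite_verts by (rule finite_subset)
  qed (use U(2) edges in auto)
  ultimately interpret P: plane_graph U ?F pos \<gamma>
    by (simp add: plane_graph_def plane_graph_axioms_def)
  have "girth E \<le> girth ?F"
    unfolding girth_def by (intro INF_superset_mono) (auto simp: is_cycle_def)
  then have "5 * card ?F < 6 * card U" using P.sparse_of_girth G(3) order_trans by blast
  moreover have "(\<Sum>x\<in>U. 5 * card (nbhd E x \<inter> U)) \<le> 10 * card ?F"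
    using degree_sum_le[OF U(1)] by (simp flip: sum_distrib_left)
  ultimately show ?thesis by linarith
qed

theorem corollary1p7p1:
  fixes V :: "'a set" and E :: "'a set set"
  assumes "simple_graph V E"
    and "planar V E"
    and "girth E \<ge> 12"
  shows "pcf_choosable TYPE('c) V E (kappa E)"
  unfolding pcf_choosable_def
proof (intro allI impI)
  fix L :: "'a \<Rightarrow> 'c set"
  assume L: "\<forall>v\<in>V. infinite (L v) \<or> kappa E v \<le> card (L v)"
  interpret simple_graph V E by (rule assms(1))
  interpret ngraph V "nbhd E" by (rule nbhd_graph[OF assms(3)])
  have kap: "kappa E v = kap (card (nbhd E v))" for v
    by (simp add: kappa_def vdegree_def kap_def)
  \<comment> \<open>Infinite lists are replaced by finite ones of the required size, as the coloring
    argument works with finite lists.\<close>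
  have "\<exists>M. M \<subseteq> L v \<and> finite M \<and> card M = kappa E v" if "v \<in> V" for v
  proof (cases "finite (L v)")
    case True
    then have "kappa E v \<le> card (L v)" using L that by blast
    then show ?thesis by (meson True finite_subset obtain_subset_with_card_n)
  next
    case False
    then show ?thesis by (meson infinite_arbitrarily_large)
  qed
  then have "\<forall>v\<in>V. \<exists>M. M \<subseteq> L v \<and> finite M \<and> card M = kappa E v" by blast
  from bchoice[OF this] obtain M where
    M: "\<forall>v\<in>V. M v \<subseteq> L v \<and> finite (M v) \<and> card (M v) = kappa E v" by blast
  have NV: "nbhd E v \<inter> V = nbhd E v" for v using N_sub by blast
  have "\<exists>\<phi>. pcf V M \<phi>"
    using planar_girth_sparse[OF assms] M by (intro pcf_of_sparse) (auto simp: NV kap)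
  then obtain \<phi> where \<phi>: "pcf V M \<phi>" by blast
  have "list_coloring V E L \<phi>"
    unfolding list_coloring_def
  proof (intro conjI ballI allI impI)
    show "\<phi> v \<in> L v" if "v \<in> V" for v using \<phi> M that unfolding pcf_def by blast
    show "\<phi> u \<noteq> \<phi> v" if "{u, v} \<in> E" for u v
    proof -
      have "u \<in> nbhd E v" "v \<in> V" "u \<in> V" using edges[OF that] that by (auto simp: nbhd_def insert_commute)
      then show ?thesis using \<phi> unfolding pcf_def by blast
    qed
  qed
  moreover have "conflict_free V E \<phi>"
    unfolding conflict_free_def
  proof (intro ballI impI)
    fix v assume "v \<in> V" "nbhd E v \<noteq> {}"
    then have "has_unique \<phi> (nbhd E v)" using \<phi> NV unfolding pcf_def by metis
    then show "\<exists>c. \<exists>!u. u \<in> nbhd E v \<and> \<phi> u = c" unfolding has_unique_def by metis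
  qed
  ultimately show "\<exists>\<phi>. list_coloring V E L \<phi> \<and> conflict_free V E \<phi>" by blast
qed

end
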